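(* Let $n\ge 0$, and let $(H_1,W_1)=\widetilde{\Phi}(\kappa_1)$ and $(H_2,W_2)=\widetilde{\Phi}(\kappa_2)$ be the spin decorated horospheres in $\mathbb{H}^{n+2}$ with spinor coordinates $\kappa_1=(\xi_1,\eta_1)$, $\kappa_2=(\xi_2,\eta_2)\in S\$\Gamma_{n+1}$. Then the lambda length $\lambda_{12}$ from $(H_1,W_1)$ to $(H_2,W_2)$ is $$\lambda_{12}=\{\kappa_1,\kappa_2\}=\xi_1^*\eta_2-\eta_1^*\xi_2 .$$
   Context: **Clifford algebra and spinors.** $\mathcal{C}\ell_{0,n}$ is the real unital associative algebra generated by $i_1,\dots,i_n$ with $i_j^2=-1$, $i_ji_k=-i_ki_j$ ($j\ne k$). $x'$ is the image of $x$ under the automorphism with $i_j\mapsto -i_j$; $x^*$ the image under the antiautomorphism fixing each $i_j$; $\overline{x}=(x')^*$; $N(x)=|x|^2=\mathrm{Re}(x\overline{x})$, $\mathrm{Re}$ being the coefficient of $1$. Paravectors: $\$\mathbb{R}^{n+1}=\mathbb{R}\oplus\mathrm{span}(i_1,\dots,i_n)$. $\$\Gamma_{n+1}$ is the group generated by non-zero paravectors; $\$\Gamma_{n+1}^\triangleright=\$\Gamma_{n+1}\cup\{0\}$; for $s\in\$\Gamma_{n+1}$, $\sigma(s)(\mathbf{V})=s\mathbf{V}s^*$ maps $\$\mathbb{R}^{n+1}$ to itself; $Spin(n+1)$ is realised as $\{s\in\$\Gamma_{n+1}:N(s)=1\}$, double covering $SO(\$\mathbb{R}^{n+1})$ via $\sigma$.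 $S\$\Gamma_{n+1}$ is the set of column pairs $\kappa=(\xi,\eta)$, $\xi,\eta\in\$\Gamma_{n+1}^\triangleright$ not both zero, $\xi\overline\eta\in\$\mathbb{R}^{n+1}$. For columns, $v^\dagger=(\overline{x},\overline{y})$ if $v=(x,y)$, $va=(xa,ya)$; $\check\kappa=(\eta',-\xi')$. The bracket is $\{(x_1,y_1),(x_2,y_2)\}=x_1^*y_2-y_1^*x_2$. **Map to decorated horospheres.** $\mathbb{R}^{1,n+2}$ has coordinates $(T,Z;\mathbf{X})$, $\mathbf{X}\in\$\mathbb{R}^{n+1}$, form $(\cdot|\cdot)_{1,n+2}$ with quadratic form $T^2-Z^2-|\mathbf{X}|^2$, and is identified with the matrices $\frac12\begin{pmatrix}T+Z&\mathbf{X}\\ \overline{\mathbf{X}}&T-Z\end{pmatrix}$; $\mathbb{H}^{n+2}=\{x:(x|x)_{1,n+2}=1,T>0\}$. For $\kappa\in S\$\Gamma_{n+1}$ let $p=\kappa\kappa^\dagger$ (a null vector with $T>0$) and $v_j=\kappa(\check\kappa i_j)^\dagger+(\check\kappa i_j)\kappa^\dagger$. $\Phi(\kappa)$ is the horosphere $H=\{x\in\mathbb{H}^{n+2}:(x|p)_{1,n+2}=1\}$ with centre the ideal point $\mathbb{R}^+p$, decorated by the $n$ oriented line fields whose $j$-th one at $q\in H$ is $T_qH\cap\mathrm{span}(p,v_j)$, oriented so that it projects in an orientation-preserving way to $\mathrm{span}(p,v_j)/\mathbb{R}p$ oriented by $v_j$; these fields are mutually orthogonal and parallel in the Euclidean geometry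 of $H$. $D\mathrm{Hor}^{n+2}$ is the space of decorated horospheres (horospheres with an ordered $n$-tuple of oriented, mutually orthogonal, parallel line fields). **Spin decorations.** $\mathbb{H}^{n+2}$ is identified with the upper half-space $\{(z;\mathbf{x}):z>0,\mathbf{x}=x_0+\sum x_ji_j\}$ by $(T,Z;\mathbf{X})\mapsto(\frac1{T-Z};\frac{\mathbf{X}}{T-Z})$ and oriented so that $(\partial_z,\partial_{x_1},\dots,\partial_{x_n},\partial_{x_0})$ is positive. $\mathrm{Fr}^{n+2}$ is the bundle of positively oriented orthonormal frames and $S\mathrm{Fr}^{n+2}$ its spin double cover (a principal $Spin(n+2)$-bundle). On a decorated horosphere $H$ let $N^{out}$ be the unit normal pointing towards the centre, $N^{in}=-N^{out}$, $\widehat D_j$ the unit field directing the $j$-th line field, and $F^{out}=(N^{out},\widehat D_1,\dots,\widehat D_n,1^{out})$, $F^{in}=(N^{in},\widehat D_1,\dots,\widehat D_n,1^{in})$, where $1^{out},1^{in}$ complete positively oriented orthonormal frames. Outward (inward) spin frames are continuous lifts $W^{out}$ ($W^{in}$) of $F^{out}$ ($F^{in}$) along $H$ to $S\mathrm{Fr}^{n+2}$. The inward spin frame associated to $W^{out}$ is obtained by (continuously) rotating $W^{out}$ by $\pi$ in the plane of $N^{out},1^{out}$ from $N^{out}$ towards $1^{out}$; the outward one associated to $W^{in}$ by the inverse rotation. A spin decorated horosphere is $(H,W)$, $W=(W^{in},W^{out})$ an associated pair; the space $S\mathrm{Hor}^{n+2}$ of these double covers $D\mathrm{Hor}^{n+2}$.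 $\widetilde\Phi:S\$\Gamma_{n+1}\to S\mathrm{Hor}^{n+2}$ is a continuous lift of $\Phi$ (there are two, differing by the deck transformation; either may be fixed); it is a bijection. **Lambda length.** If $H_1,H_2$ have the same centre, $\lambda_{12}=0$. Otherwise let $\gamma$ be the geodesic oriented from the centre of $H_1$ to the centre of $H_2$, $p_k=\gamma\cap H_k$, and $d$ the signed hyperbolic distance from $p_1$ to $p_2$ along $\gamma$. Parallel transport the spin frame $W_1^{in}$ at $p_1$ along $\gamma$ to $p_2$; identify $\$\mathbb{R}^{n+1}$ isometrically with $T_{p_2}H_2$ by sending $i_j$ to the transported $\widehat D_j$ and $1$ to the transported $1^{in}$ of $W_1^{in}$. Under this identification $s\in Spin(n+1)$ acts on spin frames at $p_2$ by the lift of the rotation $\sigma(s)$ of $T_{p_2}H_2$ (fixing the normal direction), the lift being that of $Spin(n+1)\subset Spin(n+2)$ (so $1$ acts trivially and $-1$ exchanges the two lifts of a frame). Then $\lambda_{12}=e^{d/2}s\in\$\Gamma_{n+1}$, where $s\in Spin(n+1)$ is the unique element taking the transported $W_1^{in}$ to $W_2^{out}$ at $p_2$. *)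

theory Defs
  imports "HOL-Analysis.Analysis" "Jordan_Normal_Form.Determinant"
begin

section \<open>Clifford algebras\<close>

text \<open>
  The type \<open>cl\<close> is the union of the Clifford algebras with generators
  \<open>i\<^sub>1, \<dots>, i\<^sub>n\<close> over all \<open>n\<close>, so that the inclusion of
  the algebra on \<open>n\<close> generators into that on \<open>n + 1\<close> generators is literal.
  An element is given by its coefficients in the basis of the products
  \<open>e\<^sub>A = i\<^bsub>a1\<^esub> \<dots> i\<^bsub>ak\<^esub>\<close>
  for finite \<open>A = {a1 < \<dots> < ak}\<close>.
\<close>

typedef cl = "{f :: nat set \<Rightarrow> real. finite {A. f A \<noteq> 0} \<and> (\<forall>A. f A \<noteq> 0 \<longrightarrow> finite A)}"
  morphisms cl_coeff Abs_cl
  by (rule exI[of _ "\<lambda>_. 0"]) simp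

setup_lifting type_definition_cl

definition symdiff :: "'a set \<Rightarrow> 'a set \<Rightarrow> 'a set" where
  "symdiff A B = (A - B) \<union> (B - A)"

text \<open>
  \<open>e\<^sub>A e\<^sub>B = cl_sign A B \<cdot> e\<^bsub>symdiff A B\<^esub>\<close>:
  there is one sign for each pair \<open>b < a\<close> that has to be transposed and one for each square
  \<open>i\<^sub>a i\<^sub>a = -1\<close> with \<open>a\<close> in both \<open>A\<close> and \<open>B\<close>.
\<close>

definition cl_sign :: "nat set \<Rightarrow> nat set \<Rightarrow> real" where
  "cl_sign A B = (\<Prod>a\<in>A. \<Prod>b\<in>B. if b \<le> a then -1 else 1)"

lemma symdiff_simps [simp]:
  "symdiff A A = {}" "symdiff A {} = A" "symdiff {} A = A"
  "symdiff A (symdiff A B) = B"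
  by (auto simp: symdiff_def)

lemma symdiff_assoc: "symdiff (symdiff A B) C = symdiff A (symdiff B C)"
  by (auto simp: symdiff_def)

lemma symdiff_commute: "symdiff A B = symdiff B A"
  by (auto simp: symdiff_def)

lemma symdiff_empty_iff: "symdiff A B = {} \<longleftrightarrow> A = B"
  by (auto simp: symdiff_def)

lemma symdiff_mono: "A \<subseteq> S \<Longrightarrow> B \<subseteq> S \<Longrightarrow> symdiff A B \<subseteq> S"
  by (auto simp: symdiff_def)

lemma prod_symdiff:
  fixes f :: "'a \<Rightarrow> real"
  assumes "finite A" "finite B" and f: "\<And>a. f a * f a = 1"
  shows "prod f (symdiff A B) = prod f A * prod f B"
proof -
  have A: "prod f A = prod f (A - B) * prod f (A \<inter> B)"
    using assms(1) prod.Int_Diff[of A f B] by (simp add: mult.commute)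
  have B: "prod f B = prod f (B - A) * prod f (A \<inter> B)"
    using assms(2) prod.Int_Diff[of B f A] by (simp add: mult.commute Int_commute)
  have "prod f (A \<inter> B) * prod f (A \<inter> B) = 1"
    by (simp add: prod.distrib[symmetric] f)
  moreover have "prod f (symdiff A B) = prod f (A - B) * prod f (B - A)"
    unfolding symdiff_def by (rule prod.union_disjoint) (use assms in auto)
  moreover have "prod f A * prod f B =
      prod f (A - B) * prod f (B - A) * (prod f (A \<inter> B) * prod f (A \<inter> B))"
    unfolding A B by (simp only: mult_ac)
  ultimately show ?thesis by simp
qed

lemma cl_sign_symdiff_left:
  assumes "finite A" "finite B" "finite C"
  shows "cl_sign (symdiff A B) C = cl_sign A C * cl_sign B C"
  unfolding cl_sign_def
  by (rule prod_symdiff) (use assms in \<open>auto simp: prod.distrib[symmetric] intro!: prod.neutral\<close>)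

lemma cl_sign_symdiff_right:
  assumes "finite A" "finite B" "finite C"
  shows "cl_sign A (symdiff B C) = cl_sign A B * cl_sign A C"
  unfolding cl_sign_def
  by (subst prod_symdiff) (use assms in \<open>auto simp: prod.distrib[symmetric]\<close>)

lemma cl_coeff_finite: "finite {A. cl_coeff x A \<noteq> 0}"
  using cl_coeff[of x] by auto

lemma cl_coeff_infinite: "infinite A \<Longrightarrow> cl_coeff x A = 0"
  using cl_coeff[of x] by auto

lemma cl_support: "\<exists>N. \<forall>M\<ge>N. {A. cl_coeff x A \<noteq> 0} \<subseteq> Pow {..<M}"
proof -
  have "finite (\<Union>{A. cl_coeff x A \<noteq> 0})"
    using cl_coeff_finite[of x] cl_coeff_infinite[of _ x] by (intro finite_Union) auto
  then obtain N where "\<Union>{A. cl_coeff x A \<noteq> 0} \<subseteq> {..<N}"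
    using finite_nat_iff_bounded by blast
  then show ?thesis by (intro exI[of _ N]) force
qed

lemma cl_support2:
  obtains N where "{A. cl_coeff x A \<noteq> 0} \<subseteq> Pow {..<N}" "{A. cl_coeff y A \<noteq> 0} \<subseteq> Pow {..<N}"
  using cl_support[of x] cl_support[of y] by (meson nat_le_linear)

lemma cl_support3:
  obtains N where "{A. cl_coeff x A \<noteq> 0} \<subseteq> Pow {..<N}" "{A. cl_coeff y A \<noteq> 0} \<subseteq> Pow {..<N}"
    "{A. cl_coeff z A \<noteq> 0} \<subseteq> Pow {..<N}"
proof -
  obtain a b c where "\<forall>M\<ge>a. {A. cl_coeff x A \<noteq> 0} \<subseteq> Pow {..<M}"
    "\<forall>M\<ge>b. {A. cl_coeff y A \<noteq> 0} \<subseteq> Pow {..<M}" "\<forall>M\<ge>c. {A. cl_coeff z A \<noteq> 0} \<subseteq> Pow {..<M}"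
    using cl_support by metis
  then show ?thesis by (intro that[of "max a (max b c)"]) simp_all
qed

instantiation cl :: real_vector
begin

lift_definition zero_cl :: cl is "\<lambda>_. 0" by simp

lift_definition plus_cl :: "cl \<Rightarrow> cl \<Rightarrow> cl" is "\<lambda>x y A. x A + y A"
proof -
  fix x y :: "nat set \<Rightarrow> real"
  assume "finite {A. x A \<noteq> 0} \<and> (\<forall>A. x A \<noteq> 0 \<longrightarrow> finite A)"
    "finite {A. y A \<noteq> 0} \<and> (\<forall>A. y A \<noteq> 0 \<longrightarrow> finite A)"
  moreover have "{A. x A + y A \<noteq> 0} \<subseteq> {A. x A \<noteq> 0} \<union> {A. y A \<noteq> 0}" by auto
  ultimately show "finite {A. x A + y A \<noteq> 0} \<and> (\<forall>A. x A + y A \<noteq> 0 \<longrightarrow> finite A)"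
    by (auto intro: finite_subset)
qed

lift_definition uminus_cl :: "cl \<Rightarrow> cl" is "\<lambda>x A. - x A" by simp

definition minus_cl :: "cl \<Rightarrow> cl \<Rightarrow> cl" where "minus_cl x y = x + (- y)"

lift_definition scaleR_cl :: "real \<Rightarrow> cl \<Rightarrow> cl" is "\<lambda>c x A. c * x A"
  by (auto elim: rev_finite_subset)

instance
  by standard (transfer, auto simp: algebra_simps minus_cl_def)+

end

lemma cl_coeff_simps [simp]:
  "cl_coeff 0 A = 0" "cl_coeff (x + y) A = cl_coeff x A + cl_coeff y A"
  "cl_coeff (- x) A = - cl_coeff x A" "cl_coeff (x - y) A = cl_coeff x A - cl_coeff y A"
  "cl_coeff (c *\<^sub>R x) A = c * cl_coeff x A"
  unfolding minus_cl_def by (transfer, simp)+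

lemma cl_eqI: "(\<And>A. cl_coeff x A = cl_coeff y A) \<Longrightarrow> x = y"
  by (auto simp: cl_coeff_inject[symmetric])

lift_definition cl_basis :: "nat set \<Rightarrow> cl" is "\<lambda>A B. if B = A \<and> finite A then 1 else 0"
  by auto

lemma cl_coeff_basis [simp]: "cl_coeff (cl_basis A) B = (if B = A \<and> finite A then 1 else 0)"
  by transfer simp

instantiation cl :: ring_1
begin

definition one_cl :: cl where "one_cl = cl_basis {}"

lift_definition times_cl :: "cl \<Rightarrow> cl \<Rightarrow> cl" is
  "\<lambda>x y C. \<Sum>A | x A \<noteq> 0. cl_sign A (symdiff A C) * x A * y (symdiff A C)"
proof -
  fix x y :: "nat set \<Rightarrow> real"
  assume x: "finite {A. x A \<noteq> 0} \<and> (\<forall>A. x A \<noteq> 0 \<longrightarrow> finite A)"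
    and y: "finite {A. y A \<noteq> 0} \<and> (\<forall>A. y A \<noteq> 0 \<longrightarrow> finite A)"
  define f where "f = (\<lambda>C. \<Sum>A | x A \<noteq> 0. cl_sign A (symdiff A C) * x A * y (symdiff A C))"
  have ex: "\<exists>A B. x A \<noteq> 0 \<and> y B \<noteq> 0 \<and> C = symdiff A B" if "f C \<noteq> 0" for C
  proof -
    obtain A where A: "A \<in> {A. x A \<noteq> 0}"
      and "cl_sign A (symdiff A C) * x A * y (symdiff A C) \<noteq> 0"
      using \<open>f C \<noteq> 0\<close> unfolding f_def by (rule sum.not_neutral_contains_not_neutral)
    then have "x A \<noteq> 0 \<and> y (symdiff A C) \<noteq> 0 \<and> C = symdiff A (symdiff A C)" by simp
    then show ?thesis by blast
  qed
  have "{C. f C \<noteq> 0} \<subseteq> (\<lambda>(A, B). symdiff A B) ` ({A. x A \<noteq> 0} \<times> {B. y B \<noteq> 0})"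
    using ex by force
  then have "finite {C. f C \<noteq> 0}"
    using x y by (meson finite_SigmaI finite_imageI finite_subset)
  moreover have "finite C" if "f C \<noteq> 0" for C
    using ex[OF that] x y unfolding symdiff_def by auto
  ultimately show "finite {C. f C \<noteq> 0} \<and> (\<forall>C. f C \<noteq> 0 \<longrightarrow> finite C)" by blast
qed

lemma cl_coeff_times_supset:
  assumes "finite S" "{A. cl_coeff x A \<noteq> 0} \<subseteq> S"
  shows "cl_coeff (x * y) C =
    (\<Sum>A\<in>S. cl_sign A (symdiff A C) * cl_coeff x A * cl_coeff y (symdiff A C))"
  using assms unfolding times_cl.rep_eq by (intro sum.mono_neutral_left) auto

lemma cl_support_times:
  assumes "{A. cl_coeff x A \<noteq> 0} \<subseteq> Pow {..<N}" "{A. cl_coeff y A \<noteq> 0} \<subseteq> Pow {..<N}"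
  shows "{A. cl_coeff (x * y) A \<noteq> 0} \<subseteq> Pow {..<N}"
proof (rule subsetI, rule ccontr)
  fix C assume "C \<in> {A. cl_coeff (x * y) A \<noteq> 0}" and C: "C \<notin> Pow {..<N}"
  have "cl_sign A (symdiff A C) * cl_coeff x A * cl_coeff y (symdiff A C) = 0"
    if A: "A \<in> Pow {..<N}" for A
  proof -
    have "symdiff A C \<notin> Pow {..<N}"
    proof
      assume "symdiff A C \<in> Pow {..<N}"
      then have "symdiff A (symdiff A C) \<subseteq> {..<N}" 
        using A symdiff_mono[of A "{..<N}" "symdiff A C"] by blast
      then show False using C by simp
    qed
    then show ?thesis using assms(2) by auto
  qed
  then have "cl_coeff (x * y) C = 0"
    using assms(1) by (subst cl_coeff_times_supset[of "Pow {..<N}"]) (simp_all add: sum.neutral)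
  then show False using \<open>C \<in> _\<close> by simp
qed

lemma cl_mult_assoc: "(x * y) * z = x * (y * z)" for x y z :: cl
proof (rule cl_eqI)
  fix D
  obtain N where N: "{A. cl_coeff x A \<noteq> 0} \<subseteq> Pow {..<N}" "{A. cl_coeff y A \<noteq> 0} \<subseteq> Pow {..<N}"
    "{A. cl_coeff z A \<noteq> 0} \<subseteq> Pow {..<N}" using cl_support3 .
  let ?P = "Pow {..<N}"
  have P: "finite ?P" by simp
  show "cl_coeff (x * y * z) D = cl_coeff (x * (y * z)) D"
  proof (cases "finite D")
    case True
    have fin: "finite A" if "A \<in> ?P" for A using that finite_subset by auto
    have "cl_coeff (x * (y * z)) D = (\<Sum>A\<in>?P. \<Sum>B\<in>?P.
        cl_sign A (symdiff A D) * cl_coeff x A *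
        (cl_sign B (symdiff B (symdiff A D)) * cl_coeff y B * cl_coeff z (symdiff B (symdiff A D))))"
      by (simp add: cl_coeff_times_supset[OF P N(1)] cl_coeff_times_supset[OF P N(2)] sum_distrib_left)
    also have "\<dots> = (\<Sum>A\<in>?P. \<Sum>C\<in>?P.
        cl_sign C (symdiff C D) * (cl_sign A (symdiff A C) * cl_coeff x A * cl_coeff y (symdiff A C)) *
        cl_coeff z (symdiff C D))"
    proof (rule sum.cong[OF refl])
      fix A assume A: "A \<in> ?P"
      show "(\<Sum>B\<in>?P. cl_sign A (symdiff A D) * cl_coeff x A *
          (cl_sign B (symdiff B (symdiff A D)) * cl_coeff y B * cl_coeff z (symdiff B (symdiff A D))))
        = (\<Sum>C\<in>?P. cl_sign C (symdiff C D) *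
          (cl_sign A (symdiff A C) * cl_coeff x A * cl_coeff y (symdiff A C)) * cl_coeff z (symdiff C D))"
      proof (rule sum.reindex_bij_witness[of _ "symdiff A" "symdiff A"])
        fix B assume B: "B \<in> ?P"
        show "symdiff A (symdiff A B) = B" by simp
        show "symdiff A (symdiff A B) = B" by simp
        show "symdiff A B \<in> ?P" using A B symdiff_mono[of A "{..<N}" B] by simp
        show "symdiff A B \<in> ?P" using A B symdiff_mono[of A "{..<N}" B] by simp
        note f = fin[OF A] fin[OF B] True
        have e1: "symdiff (symdiff A B) D = symdiff B (symdiff A D)"
          by (metis symdiff_assoc symdiff_commute)
        have f': "finite (symdiff A D)" "finite (symdiff B (symdiff A D))"
          using f by (auto simp: symdiff_def)
        have "cl_sign (symdiff A B) (symdiff B (symdiff A D)) * cl_sign A B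
          = cl_sign A (symdiff B (symdiff A D)) * cl_sign A B * cl_sign B (symdiff B (symdiff A D))"
          using f f' by (simp add: cl_sign_symdiff_left)
        also have "cl_sign A (symdiff B (symdiff A D)) * cl_sign A B
            = cl_sign A (symdiff B (symdiff B (symdiff A D)))"
          using cl_sign_symdiff_right[of A B "symdiff B (symdiff A D)"] f f' by (simp add: mult.commute)
        finally show "cl_sign (symdiff A B) (symdiff (symdiff A B) D) *
            (cl_sign A (symdiff A (symdiff A B)) * cl_coeff x A * cl_coeff y (symdiff A (symdiff A B))) *
            cl_coeff z (symdiff (symdiff A B) D)
          = cl_sign A (symdiff A D) * cl_coeff x A *
            (cl_sign B (symdiff B (symdiff A D)) * cl_coeff y B * cl_coeff z (symdiff B (symdiff A D)))"
          unfolding e1 by (simp add: mult.assoc)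
      qed
    qed
    also have "\<dots> = (\<Sum>C\<in>?P. \<Sum>A\<in>?P.
        cl_sign C (symdiff C D) * (cl_sign A (symdiff A C) * cl_coeff x A * cl_coeff y (symdiff A C)) *
        cl_coeff z (symdiff C D))"
      by (rule sum.swap)
    also have "\<dots> = cl_coeff (x * y * z) D"
      by (simp add: cl_coeff_times_supset[OF P cl_support_times[OF N(1,2)]]
        cl_coeff_times_supset[OF P N(1)] sum_distrib_left sum_distrib_right)
    finally show ?thesis by simp
  qed (simp add: cl_coeff_infinite)
qed

lemma cl_coeff_basis_times:
  "finite A \<Longrightarrow> cl_coeff (cl_basis A * y) C = cl_sign A (symdiff A C) * cl_coeff y (symdiff A C)"
  by (subst cl_coeff_times_supset[of "{A}"]) auto

instance
proof
  fix x y z :: cl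
  show "x * y * z = x * (y * z)" by (rule cl_mult_assoc)
  show "1 * x = x"
    by (rule cl_eqI) (simp add: one_cl_def cl_coeff_basis_times cl_sign_def)
  show "x * 1 = x"
  proof (rule cl_eqI)
    fix C
    have "cl_coeff (x * 1) C = (\<Sum>A\<in>insert C {A. cl_coeff x A \<noteq> 0}.
        cl_sign A (symdiff A C) * cl_coeff x A * cl_coeff 1 (symdiff A C))"
      by (rule cl_coeff_times_supset) (auto simp: cl_coeff_finite)
    also have "\<dots> = (\<Sum>A\<in>insert C {A. cl_coeff x A \<noteq> 0}. if A = C then cl_coeff x C else 0)"
      by (rule sum.cong) (auto simp: one_cl_def cl_sign_def symdiff_empty_iff)
    finally have "cl_coeff (x * 1) C =
        (\<Sum>A\<in>insert C {A. cl_coeff x A \<noteq> 0}. if A = C then cl_coeff x C else 0)" .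
    then show "cl_coeff (x * 1) C = cl_coeff x C"
      by (simp add: cl_coeff_finite)
  qed
  show "(x + y) * z = x * z + y * z"
  proof (rule cl_eqI)
    fix C
    let ?S = "{A. cl_coeff x A \<noteq> 0} \<union> {A. cl_coeff y A \<noteq> 0}"
    have "finite ?S" "{A. cl_coeff x A \<noteq> 0} \<subseteq> ?S" "{A. cl_coeff y A \<noteq> 0} \<subseteq> ?S"
      "{A. cl_coeff (x + y) A \<noteq> 0} \<subseteq> ?S"
      by (auto simp: cl_coeff_finite)
    then show "cl_coeff ((x + y) * z) C = cl_coeff (x * z + y * z) C"
      by (simp only: cl_coeff_simps cl_coeff_times_supset[of ?S] sum.distrib[symmetric] algebra_simps)
  qed
  show "x * (y + z) = x * y + x * z"
    by (rule cl_eqI)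
      (simp add: cl_coeff_times_supset[OF cl_coeff_finite order.refl] sum.distrib[symmetric] algebra_simps)
  show "(0::cl) \<noteq> 1"
    using cl_coeff_basis[of "{}" "{}"] unfolding one_cl_def by (metis cl_coeff_simps(1) finite.emptyI zero_neq_one)
qed

end

instance cl :: real_algebra_1
proof
  fix a :: real and x y :: cl
  show "a *\<^sub>R x * y = a *\<^sub>R (x * y)"
  proof (rule cl_eqI)
    fix C
    have "{A. cl_coeff (a *\<^sub>R x) A \<noteq> 0} \<subseteq> {A. cl_coeff x A \<noteq> 0}" by auto
    then show "cl_coeff (a *\<^sub>R x * y) C = cl_coeff (a *\<^sub>R (x * y)) C"
      by (simp add: cl_coeff_times_supset[OF cl_coeff_finite[of x]] sum_distrib_left mult_ac)
  qed
  show "x * a *\<^sub>R y = a *\<^sub>R (x * y)"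
    by (rule cl_eqI)
      (simp add: cl_coeff_times_supset[OF cl_coeff_finite order.refl] sum_distrib_left mult_ac)
qed

instantiation cl :: real_inner
begin

definition inner_cl :: "cl \<Rightarrow> cl \<Rightarrow> real" where
  "inner_cl x y = (\<Sum>A | cl_coeff x A \<noteq> 0. cl_coeff x A * cl_coeff y A)"
definition norm_cl :: "cl \<Rightarrow> real" where "norm_cl x = sqrt (inner x x)"
definition sgn_cl :: "cl \<Rightarrow> cl" where "sgn_cl x = x /\<^sub>R norm x"
definition dist_cl :: "cl \<Rightarrow> cl \<Rightarrow> real" where "dist_cl x y = norm (x - y)"
definition uniformity_cl :: "(cl \<times> cl) filter" where
  "uniformity_cl = (INF e\<in>{0 <..}. principal {(x, y). dist x y < e})"
definition open_cl :: "cl set \<Rightarrow> bool" where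
  "open_cl U \<longleftrightarrow> (\<forall>x\<in>U. eventually (\<lambda>(x', y). x' = x \<longrightarrow> y \<in> U) uniformity)"

lemma inner_cl_supset:
  assumes "finite S" "{A. cl_coeff x A \<noteq> 0} \<subseteq> S"
  shows "inner x y = (\<Sum>A\<in>S. cl_coeff x A * cl_coeff y A)"
  using assms unfolding inner_cl_def by (intro sum.mono_neutral_left) auto

instance
proof
  fix x y z :: cl and r :: real
  let ?S = "{A. cl_coeff x A \<noteq> 0} \<union> {A. cl_coeff y A \<noteq> 0}"
  have S: "finite ?S" "{A. cl_coeff x A \<noteq> 0} \<subseteq> ?S" "{A. cl_coeff y A \<noteq> 0} \<subseteq> ?S"
    "{A. cl_coeff (x + y) A \<noteq> 0} \<subseteq> ?S" "{A. cl_coeff (r *\<^sub>R x) A \<noteq> 0} \<subseteq> ?S"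
    by (auto simp: cl_coeff_finite)
  show "inner x y = inner y x"
    using S by (simp add: inner_cl_supset[of ?S] mult.commute)
  show "inner (x + y) z = inner x z + inner y z"
    using S by (simp only: inner_cl_supset[of ?S] cl_coeff_simps sum.distrib[symmetric] algebra_simps)
  show "inner (r *\<^sub>R x) y = r * inner x y"
    using S by (simp only: inner_cl_supset[of ?S] cl_coeff_simps sum_distrib_left mult.assoc)
  show "0 \<le> inner x x" unfolding inner_cl_def by (intro sum_nonneg) simp
  show "inner x x = 0 \<longleftrightarrow> x = 0"
  proof
    assume "inner x x = 0"
    then have "\<forall>A\<in>{A. cl_coeff x A \<noteq> 0}. cl_coeff x A * cl_coeff x A = 0"
      unfolding inner_cl_def by (subst (asm) sum_nonneg_eq_0_iff) (auto simp: cl_coeff_finite)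
    then show "x = 0" by (intro cl_eqI) auto
  qed (simp add: inner_cl_def)
qed (rule norm_cl_def sgn_cl_def dist_cl_def uniformity_cl_def open_cl_def)+

end

definition gen :: "nat \<Rightarrow> cl" where "gen j = cl_basis {j}"

lemma cl_basis_times:
  assumes "finite A" "finite B"
  shows "cl_basis A * cl_basis B = cl_sign A B *\<^sub>R cl_basis (symdiff A B)"
proof (rule cl_eqI)
  fix C
  have "symdiff A C = B \<longleftrightarrow> C = symdiff A B" by (metis symdiff_simps(4))
  moreover have "finite (symdiff A B)" using assms by (auto simp: symdiff_def)
  ultimately show "cl_coeff (cl_basis A * cl_basis B) C = cl_coeff (cl_sign A B *\<^sub>R cl_basis (symdiff A B)) C"
    using assms by (auto simp: cl_coeff_basis_times)
qed

lemma gen_square: "gen j * gen j = -1"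
  by (simp add: gen_def cl_basis_times cl_sign_def one_cl_def)

lemma gen_anticommute: "j \<noteq> k \<Longrightarrow> gen j * gen k = - (gen k * gen j)"
  by (auto simp: gen_def cl_basis_times cl_sign_def symdiff_commute)

lemma cl_basis_insert_min:
  assumes "finite A" "\<forall>a\<in>A. j < a"
  shows "cl_basis (insert j A) = gen j * cl_basis A"
proof -
  have "cl_sign {j} A = 1"
    using assms unfolding cl_sign_def by (auto intro!: prod.neutral)
  moreover have "symdiff {j} A = insert j A"
    using assms unfolding symdiff_def by auto
  ultimately show ?thesis using assms by (simp add: gen_def cl_basis_times)
qed

text \<open>
  On a product \<open>e\<^sub>A\<close> of \<open>k\<close> distinct generators, \<open>i\<^sub>j \<mapsto> -i\<^sub>j\<close> contributes the
  sign \<open>(-1)\<^sup>k\<close>, and reversing the order of the factors contributes \<open>k (k - 1) / 2\<close> transpositions.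
\<close>

lift_definition cl_prime :: "cl \<Rightarrow> cl" is "\<lambda>x A. (-1) ^ card A * x A"
  by simp

lift_definition cl_star :: "cl \<Rightarrow> cl" is "\<lambda>x A. (-1) ^ (card A * (card A - 1) div 2) * x A"
  by simp

definition cl_conj :: "cl \<Rightarrow> cl" where "cl_conj x = cl_star (cl_prime x)"

definition cl_Re :: "cl \<Rightarrow> real" where "cl_Re x = cl_coeff x {}"

definition cl_N :: "cl \<Rightarrow> real" where "cl_N x = cl_Re (x * cl_conj x)"


section \<open>Paravectors and the paravector groups\<close>

text \<open>The subscript \<open>m\<close> is the dimension: there are \<open>m - 1\<close> generators.\<close>

definition paravectors :: "nat \<Rightarrow> cl set" where
  "paravectors m = span (insert 1 (gen ` {1..<m}))"

inductive_set Gamma :: "nat \<Rightarrow> cl set" for m :: nat where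
  one: "1 \<in> Gamma m"
| gen: "v \<in> paravectors m \<Longrightarrow> v \<noteq> 0 \<Longrightarrow> v \<in> Gamma m"
| mult: "x \<in> Gamma m \<Longrightarrow> y \<in> Gamma m \<Longrightarrow> x * y \<in> Gamma m"
| inv: "x \<in> Gamma m \<Longrightarrow> x * y = 1 \<Longrightarrow> y * x = 1 \<Longrightarrow> y \<in> Gamma m"

definition Gamma0 :: "nat \<Rightarrow> cl set" where "Gamma0 m = insert 0 (Gamma m)"

definition sigma :: "cl \<Rightarrow> cl \<Rightarrow> cl" where "sigma s V = s * V * cl_star s"

definition Spin :: "nat \<Rightarrow> cl set" where "Spin m = {s \<in> Gamma m. cl_N s = 1}"

type_synonym column = "cl \<times> cl"

definition SGamma :: "nat \<Rightarrow> column set" where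
  "SGamma m = {(\<xi>, \<eta>). \<xi> \<in> Gamma0 m \<and> \<eta> \<in> Gamma0 m \<and> (\<xi>, \<eta>) \<noteq> (0, 0) \<and> \<xi> * cl_conj \<eta> \<in> paravectors m}"

fun bracket :: "column \<Rightarrow> column \<Rightarrow> cl" where
  "bracket (x1, y1) (x2, y2) = cl_star x1 * y2 - cl_star y1 * x2"

fun check_col :: "column \<Rightarrow> column" where
  "check_col (\<xi>, \<eta>) = (cl_prime \<eta>, - cl_prime \<xi>)"

fun col_scale :: "column \<Rightarrow> cl \<Rightarrow> column" where
  "col_scale (x, y) a = (x * a, y * a)"

text \<open>A \<open>2 \<times> 2\<close> matrix is the pair of its rows.\<close>

type_synonym mat2 = "(cl \<times> cl) \<times> (cl \<times> cl)"

text \<open>The product \<open>v w\<^sup>\<dagger>\<close>.\<close>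

fun col_dagger_mult :: "column \<Rightarrow> column \<Rightarrow> mat2" where
  "col_dagger_mult (x1, y1) (x2, y2) =
    ((x1 * cl_conj x2, x1 * cl_conj y2), (y1 * cl_conj x2, y1 * cl_conj y2))"


section \<open>Minkowski space and hyperbolic space\<close>

text \<open>
  Vectors are triples \<open>(T, Z, X)\<close>. Throughout, the parameter \<open>n\<close> is the number of generators,
  so that the ambient space is \<open>\<real>\<^bsup>1,n+2\<^esup>\<close>.
\<close>

type_synonym mvec = "real \<times> real \<times> cl"

definition minkowski :: "nat \<Rightarrow> mvec set" where
  "minkowski n = {(T, Z, X). X \<in> paravectors (n + 1)}"

fun mform :: "mvec \<Rightarrow> mvec \<Rightarrow> real" where
  "mform (T, Z, X) (T', Z', X') = T * T' - Z * Z' - inner X X'"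

fun mink_matrix :: "mvec \<Rightarrow> mat2" where
  "mink_matrix (T, Z, X) =
    ((of_real ((T + Z) / 2), X /\<^sub>R 2), (cl_conj X /\<^sub>R 2, of_real ((T - Z) / 2)))"

definition vec_of_matrix :: "mat2 \<Rightarrow> mvec" where "vec_of_matrix = the_inv mink_matrix"

definition hyp :: "nat \<Rightarrow> mvec set" where
  "hyp n = {x \<in> minkowski n. mform x x = 1 \<and> fst x > 0}"

definition tangent_hyp :: "nat \<Rightarrow> mvec \<Rightarrow> mvec set" where
  "tangent_hyp n q = {u \<in> minkowski n. mform u q = 0}"

text \<open>
  The vector field \<open>V\<close> along the curve \<open>c\<close> is parallel in the submanifold with tangent spaces
  \<open>TS\<close>: its Levi-Civita covariant derivative, which is the tangential part of the derivative in
  the ambient flat space, vanishes.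
\<close>

definition parallel_along :: "(mvec \<Rightarrow> mvec set) \<Rightarrow> (real \<Rightarrow> mvec) \<Rightarrow> (real \<Rightarrow> mvec) \<Rightarrow> bool" where
  "parallel_along TS c V \<longleftrightarrow> (\<exists>V'. \<forall>t. V t \<in> TS (c t) \<and> (V has_vector_derivative V' t) (at t) \<and>
     (\<forall>u \<in> TS (c t). mform (V' t) u = 0))"

text \<open>Geodesics are complete and parametrised by arc length; the hyperbolic metric is
  \<open>- mform\<close> on tangent vectors.\<close>

definition geodesic :: "nat \<Rightarrow> (real \<Rightarrow> mvec) \<Rightarrow> bool" where
  "geodesic n \<gamma> \<longleftrightarrow> (\<exists>v. (\<forall>t. \<gamma> t \<in> hyp n \<and> (\<gamma> has_vector_derivative v t) (at t) \<and>
     mform (v t) (v t) = - 1) \<and> parallel_along (tangent_hyp n) \<gamma> v)"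

definition light_cone :: "nat \<Rightarrow> mvec set" where
  "light_cone n = {p \<in> minkowski n. mform p p = 0 \<and> fst p > 0}"

definition ray :: "mvec \<Rightarrow> mvec set" where "ray p = {c *\<^sub>R p | c. c > 0}"

text \<open>
  Convergence of \<open>\<gamma>\<close> to the ideal point \<open>ray p\<close>, in the projective model \<open>T = 1\<close> of
  hyperbolic space together with its sphere at infinity.
\<close>

definition tends_to_ideal :: "(real \<Rightarrow> mvec) \<Rightarrow> mvec set \<Rightarrow> real filter \<Rightarrow> bool" where
  "tends_to_ideal \<gamma> I F \<longleftrightarrow> (\<exists>p. I = ray p \<and>
     ((\<lambda>t. \<gamma> t /\<^sub>R fst (\<gamma> t)) \<longlongrightarrow> p /\<^sub>R fst p) F)"


section \<open>Decorated horospheres\<close>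

definition horosphere :: "nat \<Rightarrow> mvec \<Rightarrow> mvec set" where
  "horosphere n p = {x \<in> hyp n. mform x p = 1}"

definition horo_vec :: "nat \<Rightarrow> mvec set \<Rightarrow> mvec" where
  "horo_vec n H = (THE p. p \<in> light_cone n \<and> H = horosphere n p)"

definition centre :: "nat \<Rightarrow> mvec set \<Rightarrow> mvec set" where
  "centre n H = ray (horo_vec n H)"

definition tangent_horo :: "nat \<Rightarrow> mvec set \<Rightarrow> mvec \<Rightarrow> mvec set" where
  "tangent_horo n H q = {u \<in> tangent_hyp n q. mform u (horo_vec n H) = 0}"

text \<open>
  An oriented line is represented by its positive half-line, without the origin. A decorated
  horosphere is a pair \<open>(H, D)\<close>, where \<open>D j q\<close> is the \<open>j\<close>-th oriented line at \<open>q\<close>; it is the empty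
  set when \<open>q\<close> is not in \<open>H\<close> or \<open>j\<close> is not in \<open>{1..n}\<close>.
\<close>

type_synonym decorated = "mvec set \<times> (nat \<Rightarrow> mvec \<Rightarrow> mvec set)"

definition Dhat :: "decorated \<Rightarrow> nat \<Rightarrow> mvec \<Rightarrow> mvec" where
  "Dhat HD j q = (THE w. w \<in> snd HD j q \<and> mform w w = - 1)"

definition DHor :: "nat \<Rightarrow> decorated set" where
  "DHor n = {(H, D).
     (\<exists>p \<in> light_cone n. H = horosphere n p) \<and>
     (\<forall>j q. \<not> (j \<in> {1..n} \<and> q \<in> H) \<longrightarrow> D j q = {}) \<and>
     (\<forall>j \<in> {1..n}. \<forall>q \<in> H. \<exists>w \<in> tangent_horo n H q. w \<noteq> 0 \<and> D j q = ray w) \<and>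
     (\<forall>j \<in> {1..n}. \<forall>k \<in> {1..n}. j \<noteq> k \<longrightarrow>
        (\<forall>q \<in> H. \<forall>u \<in> D j q. \<forall>w \<in> D k q. mform u w = 0)) \<and>
     (\<forall>j \<in> {1..n}. \<forall>c :: real \<Rightarrow> mvec. range c \<subseteq> H \<and> c differentiable_on UNIV \<longrightarrow>
        parallel_along (tangent_horo n H) c (\<lambda>t. Dhat (H, D) j (c t)))}"

definition null_vec :: "column \<Rightarrow> mvec" where
  "null_vec \<kappa> = vec_of_matrix (col_dagger_mult \<kappa> \<kappa>)"

definition flag_vec :: "column \<Rightarrow> nat \<Rightarrow> mvec" where
  "flag_vec \<kappa> j = vec_of_matrix
     (col_dagger_mult \<kappa> (col_scale (check_col \<kappa>) (gen j)) +
      col_dagger_mult (col_scale (check_col \<kappa>) (gen j)) \<kappa>)"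

definition Phi :: "nat \<Rightarrow> column \<Rightarrow> decorated" where
  "Phi n \<kappa> = (let p = null_vec \<kappa>; H = horosphere n p in
     (H, \<lambda>j q. if j \<in> {1..n} \<and> q \<in> H
       then tangent_horo n H q \<inter> {a *\<^sub>R p + b *\<^sub>R flag_vec \<kappa> j | a b. b > 0} else {}))"


section \<open>Frames and spin frames\<close>

fun to_uhs :: "mvec \<Rightarrow> real \<times> cl" where
  "to_uhs (T, Z, X) = (1 / (T - Z), X /\<^sub>R (T - Z))"

text \<open>
  The upper half-space model trivialises the tangent bundle of \<open>hyp n\<close>: \<open>coframe n q\<close> is the
  isometry of the tangent space at \<open>q\<close> onto the paravectors of dimension \<open>n + 2\<close> that sends the
  orthonormal basis \<open>z \<partial>\<^sub>z, z \<partial>\<^bsub>x1\<^esub>, \<dots>, z \<partial>\<^bsub>xn\<^esub>, z \<partial>\<^bsub>x0\<^esub>\<close> to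
  \<open>i\<^bsub>n+1\<^esub>, i\<^sub>1, \<dots>, i\<^sub>n, 1\<close>, enumerated as \<open>std_basis n\<close>.
\<close>

definition coframe :: "nat \<Rightarrow> mvec \<Rightarrow> mvec \<Rightarrow> cl" where
  "coframe n q u = (let (dz, dx) = frechet_derivative to_uhs (at q) u in
     (dx + dz *\<^sub>R gen (n + 1)) /\<^sub>R fst (to_uhs q))"

definition std_basis :: "nat \<Rightarrow> nat \<Rightarrow> cl" where
  "std_basis n k = (if k = 0 then gen (n + 1) else if k \<le> n then gen k else 1)"

text \<open>A frame consists of the vectors \<open>f 0, \<dots>, f (n + 1)\<close>.\<close>

type_synonym frame = "nat \<Rightarrow> mvec"

definition positive_frame :: "nat \<Rightarrow> mvec \<Rightarrow> frame \<Rightarrow> bool" where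
  "positive_frame n q f \<longleftrightarrow>
     (\<forall>k \<le> n + 1. f k \<in> tangent_hyp n q) \<and>
     (\<forall>k \<le> n + 1. \<forall>l \<le> n + 1. mform (f k) (f l) = (if k = l then - 1 else 0)) \<and>
     Determinant.det (Matrix.mat (n + 2) (n + 2)
       (\<lambda>(k, l). inner (coframe n q (f l)) (std_basis n k))) > 0"

text \<open>
  As hyperbolic space is contractible, its frame bundle is trivialised by \<open>coframe\<close>, and the spin
  double cover is the trivial principal bundle with fibre \<open>Spin (n + 2)\<close>; \<open>(q, g)\<close> lies over the
  frame that is the image under \<open>sigma g\<close> of the standard one.
\<close>

type_synonym spin_frame = "mvec \<times> cl"

definition SFr :: "nat \<Rightarrow> spin_frame set" where
  "SFr n = hyp n \<times> Spin (n + 2)"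

fun frame_of :: "nat \<Rightarrow> spin_frame \<Rightarrow> frame" where
  "frame_of n (q, g) k = (THE u. u \<in> tangent_hyp n q \<and> coframe n q u = sigma g (std_basis n k))"

definition lifts_frame :: "nat \<Rightarrow> spin_frame \<Rightarrow> mvec \<Rightarrow> frame \<Rightarrow> bool" where
  "lifts_frame n W q f \<longleftrightarrow> W \<in> SFr n \<and> fst W = q \<and> (\<forall>k \<le> n + 1. frame_of n W k = f k)"

text \<open>
  The principal right action of \<open>Spin (n + 2)\<close>. If \<open>f\<close> is the isometry given by the frame under
  \<open>(q, g)\<close>, that is \<open>std_basis n k \<mapsto> frame_of n (q, g) k\<close>, then the frame under
  \<open>spin_act (q, g) s\<close> is \<open>f \<circ> sigma s = (f \<circ> sigma s \<circ> f\<inverse>) \<circ> f\<close>: it is obtained by applying to the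
  frame the rotation of the tangent space which corresponds to \<open>sigma s\<close> when \<open>f\<close> is used to
  identify. For \<open>s\<close> in \<open>Spin (n + 1)\<close>, \<open>sigma s\<close> fixes \<open>i\<^bsub>n+1\<^esub>\<close>, so the first vector of the frame
  is fixed.
\<close>

fun spin_act :: "spin_frame \<Rightarrow> cl \<Rightarrow> spin_frame" where
  "spin_act (q, g) s = (q, g * s)"


section \<open>Spin decorations\<close>

definition N_out :: "nat \<Rightarrow> mvec set \<Rightarrow> mvec \<Rightarrow> mvec" where
  "N_out n H q = (THE N. N \<in> tangent_hyp n q \<and> mform N N = - 1 \<and>
     (\<forall>u \<in> tangent_horo n H q. mform N u = 0) \<and>
     (\<exists>\<gamma>. geodesic n \<gamma> \<and> \<gamma> 0 = q \<and> (\<gamma> has_vector_derivative N) (at 0) \<and>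
       tends_to_ideal \<gamma> (centre n H) at_top))"

definition complete_frame :: "nat \<Rightarrow> decorated \<Rightarrow> mvec \<Rightarrow> mvec \<Rightarrow> frame" where
  "complete_frame n HD q N = (let f = (\<lambda>w k. if k = 0 then N else if k \<le> n then Dhat HD k q else w)
     in f (THE w. positive_frame n q (f w)))"

definition F_out :: "nat \<Rightarrow> decorated \<Rightarrow> mvec \<Rightarrow> frame" where
  "F_out n HD q = complete_frame n HD q (N_out n (fst HD) q)"

definition F_in :: "nat \<Rightarrow> decorated \<Rightarrow> mvec \<Rightarrow> frame" where
  "F_in n HD q = complete_frame n HD q (- N_out n (fst HD) q)"

definition outward_spin_frames :: "nat \<Rightarrow> decorated \<Rightarrow> (mvec \<Rightarrow> spin_frame) set" where
  "outward_spin_frames n HD = {W \<in> extensional (fst HD). continuous_on (fst HD) W \<and>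
     (\<forall>q \<in> fst HD. lifts_frame n (W q) q (F_out n HD q))}"

definition inward_spin_frames :: "nat \<Rightarrow> decorated \<Rightarrow> (mvec \<Rightarrow> spin_frame) set" where
  "inward_spin_frames n HD = {W \<in> extensional (fst HD). continuous_on (fst HD) W \<and>
     (\<forall>q \<in> fst HD. lifts_frame n (W q) q (F_in n HD q))}"

text \<open>The frame rotated by \<open>\<theta>\<close> in the plane of its first and last vectors, from the first
  towards the last.\<close>

definition rotate_frame :: "nat \<Rightarrow> real \<Rightarrow> frame \<Rightarrow> frame" where
  "rotate_frame n \<theta> f = f(0 := cos \<theta> *\<^sub>R f 0 + sin \<theta> *\<^sub>R f (n + 1),
                          n + 1 := cos \<theta> *\<^sub>R f (n + 1) - sin \<theta> *\<^sub>R f 0)"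

definition associated :: "nat \<Rightarrow> decorated \<Rightarrow> (mvec \<Rightarrow> spin_frame) \<Rightarrow> (mvec \<Rightarrow> spin_frame) \<Rightarrow> bool" where
  "associated n HD W_in W_out \<longleftrightarrow> (\<forall>q \<in> fst HD. \<exists>P :: real \<Rightarrow> spin_frame.
     continuous_on {0..pi} P \<and> P 0 = W_out q \<and> P pi = W_in q \<and>
     (\<forall>\<theta> \<in> {0..pi}. lifts_frame n (P \<theta>) q (rotate_frame n \<theta> (F_out n HD q))))"

type_synonym spin_decorated = "decorated \<times> (mvec \<Rightarrow> spin_frame) \<times> (mvec \<Rightarrow> spin_frame)"

definition SHor :: "nat \<Rightarrow> spin_decorated set" where
  "SHor n = {(HD, W_in, W_out). HD \<in> DHor n \<and> W_in \<in> inward_spin_frames n HD \<and>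
     W_out \<in> outward_spin_frames n HD \<and> associated n HD W_in W_out}"

text \<open>
  Continuity of a lift of \<open>Phi\<close> to the double cover \<open>SHor\<close> of \<open>DHor\<close> means that
  the spin frame at \<open>q\<close> on the horosphere of \<open>\<kappa>\<close> depends continuously on \<open>(\<kappa>, q)\<close> jointly.
\<close>

definition continuous_spin_lift :: "nat \<Rightarrow> (column \<Rightarrow> spin_decorated) \<Rightarrow> bool" where
  "continuous_spin_lift n \<Psi> \<longleftrightarrow>
     (\<forall>\<kappa> \<in> SGamma (n + 1). \<Psi> \<kappa> \<in> SHor n \<and> fst (\<Psi> \<kappa>) = Phi n \<kappa>) \<and>
     (let E = {(\<kappa>, q). \<kappa> \<in> SGamma (n + 1) \<and> q \<in> fst (Phi n \<kappa>)} in
        continuous_on E (\<lambda>(\<kappa>, q). fst (snd (\<Psi> \<kappa>)) q) \<and>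
        continuous_on E (\<lambda>(\<kappa>, q). snd (snd (\<Psi> \<kappa>)) q))"


section \<open>Lambda lengths\<close>

definition parallel_spin_frame :: "nat \<Rightarrow> (real \<Rightarrow> mvec) \<Rightarrow> (real \<Rightarrow> spin_frame) \<Rightarrow> bool" where
  "parallel_spin_frame n \<gamma> W \<longleftrightarrow> continuous_on UNIV W \<and>
     (\<forall>t. W t \<in> SFr n \<and> fst (W t) = \<gamma> t) \<and>
     (\<forall>k \<le> n + 1. parallel_along (tangent_hyp n) \<gamma> (\<lambda>t. frame_of n (W t) k))"

fun lambda_length :: "nat \<Rightarrow> spin_decorated \<Rightarrow> spin_decorated \<Rightarrow> cl" where
  "lambda_length n ((H1, D1), W1_in, W1_out) ((H2, D2), W2_in, W2_out) =
     (if centre n H1 = centre n H2 then 0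
      else THE l. \<exists>\<gamma> t1 t2 W s.
        geodesic n \<gamma> \<and> tends_to_ideal \<gamma> (centre n H1) at_bot \<and>
        tends_to_ideal \<gamma> (centre n H2) at_top \<and> \<gamma> t1 \<in> H1 \<and> \<gamma> t2 \<in> H2 \<and>
        parallel_spin_frame n \<gamma> W \<and> W t1 = W1_in (\<gamma> t1) \<and>
        s \<in> Spin (n + 1) \<and> spin_act (W t2) s = W2_out (\<gamma> t2) \<and>
        l = exp ((t2 - t1) / 2) *\<^sub>R s)"

end

theory Submission
  imports Defs
begin

text \<open>
  Add \<open>i\<^bsub>n+1\<^esub>\<close> to make a point \<open>q = (z; x)\<close> of the upper half-space a paravector
  \<open>Q = x + z i\<^bsub>n+1\<^esub>\<close>. For \<open>\<kappa> = (\<xi>, \<eta>)\<close> the element \<open>\<xi> - Q \<eta>\<close>, divided by its norm,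
  belongs to \<open>Spin(n + 2)\<close> and lies over the outward frame at \<open>q\<close> of the horosphere of \<open>\<kappa>\<close>. The
  space of all pairs \<open>(\<kappa>, q)\<close> is connected, so the outward spin frames of a continuous lift are
  \<open>\<epsilon> (\<xi> - Q \<eta>) / |\<xi> - Q \<eta>|\<close> with one sign \<open>\<epsilon>\<close> for all \<open>\<kappa>\<close>, and this sign cancels in the lambda
  length. Rotation to the inward frame is right multiplication by \<open>-i\<^bsub>n+1\<^esub>\<close>, and the inward
  formula is parallel along all geodesics that emanate from the centre. At the points of the
  geodesic between the centres of \<open>\<kappa>\<^sub>1\<close> and \<open>\<kappa>\<^sub>2\<close>, the product of the conjugate of
  \<open>\<xi>\<^sub>1 - Q \<eta>\<^sub>1\<close> with \<open>\<xi>\<^sub>2 - Q \<eta>\<^sub>2\<close> is \<open>-z i\<^bsub>n+1\<^esub> {\<kappa>\<^sub>1, \<kappa>\<^sub>2}\<close>; this identifies the rotation between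
  the two spin frames with the normalised bracket, and the norms account for \<open>e\<^bsup>d/2\<^esup>\<close>.
\<close>

section \<open>Involutions and the inner product of the Clifford algebra\<close>

text \<open>All formulas are verified for arbitrary columns rather than carried over from a standard
  pair by isometries: \<open>coframe\<close> comes from the upper half-space and is not invariant
  under isometries, so equivariance would need the action on spin frames. Direct verification is
  feasible because every column is \<open>(s, 0)\<close> or \<open>(a * s, s)\<close> with a
  paravector \<open>a\<close>, and because products \<open>v * w * v\<close> of paravectors have a
  closed form.

  The geometric notions are definite descriptions, so each identification needs uniqueness as well
  as existence. Vectors are pinned down by orthonormality and orientation, spin frames only up to
  sign. This sign cannot be chosen horosphere by horosphere: replacing \<kappa> by -\<kappa> keeps
  the decorated horosphere but negates \<xi> - Q \<eta>. Connectedness of the space of pairs holds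
  even for n = 0, where \<open>Gamma\<close> is disconnected.

  The exponent d / 2 has this origin: the squared norm of \<xi> - Q \<eta> is z (q|p), with p the
  null vector of the column. Where the geodesic meets the second horosphere, (q|p_2) = 1 while
  (q|p_1) = exp d, and normalising both elements leaves the square root.\<close>

lemma cl_coeff_sum: "cl_coeff (sum f S) A = (\<Sum>s\<in>S. cl_coeff (f s) A)"
  by (induction S rule: infinite_finite_induct) auto

lemma cl_expand:
  assumes "finite S" "{A. cl_coeff x A \<noteq> 0} \<subseteq> S"
  shows "x = (\<Sum>A\<in>S. cl_coeff x A *\<^sub>R cl_basis A)"
proof (rule cl_eqI)
  fix B
  have "cl_coeff (\<Sum>A\<in>S. cl_coeff x A *\<^sub>R cl_basis A) B = (\<Sum>A\<in>S. if A = B then cl_coeff x B else 0)"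
    unfolding cl_coeff_sum by (rule sum.cong) (auto simp: cl_coeff_infinite)
  also have "\<dots> = cl_coeff x B"
    using assms by (auto simp: sum.delta)
  finally show "cl_coeff x B = cl_coeff (\<Sum>A\<in>S. cl_coeff x A *\<^sub>R cl_basis A) B" by simp
qed

text \<open>Finite support makes every element a finite sum of real multiples of
  \<open>cl_basis A\<close>. Scalars are built into the base case, so identities that are additive
  in each argument reduce to basis elements without a separate scaling case.\<close>

lemma cl_induct [case_names basis add]:
  assumes "\<And>c A. finite A \<Longrightarrow> P (c *\<^sub>R cl_basis A)" "\<And>x y. P x \<Longrightarrow> P y \<Longrightarrow> P (x + y)"
  shows "P x"
proof -
  have 0: "P 0" using assms(1)[of "{}" 0] by simp
  have "P (\<Sum>A\<in>S. cl_coeff x A *\<^sub>R cl_basis A)" if "finite S" "\<forall>A\<in>S. finite A" for S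
    using that by (induction S) (auto intro: 0 assms)
  moreover have "\<forall>A\<in>{A. cl_coeff x A \<noteq> 0}. finite A" using cl_coeff_infinite by auto
  ultimately show ?thesis
    using cl_expand[OF cl_coeff_finite order.refl, of x] cl_coeff_finite[of x] by metis
qed

lemma cl_prime_linear [simp]:
  "cl_prime 0 = 0" "cl_prime (x + y) = cl_prime x + cl_prime y" "cl_prime (- x) = - cl_prime x"
  "cl_prime (x - y) = cl_prime x - cl_prime y" "cl_prime (c *\<^sub>R x) = c *\<^sub>R cl_prime x"
  by (auto intro!: cl_eqI simp: cl_prime.rep_eq algebra_simps)

lemma cl_star_linear [simp]:
  "cl_star 0 = 0" "cl_star (x + y) = cl_star x + cl_star y" "cl_star (- x) = - cl_star x"
  "cl_star (x - y) = cl_star x - cl_star y" "cl_star (c *\<^sub>R x) = c *\<^sub>R cl_star x"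
  by (auto intro!: cl_eqI simp: cl_star.rep_eq algebra_simps)

lemma cl_conj_linear [simp]:
  "cl_conj 0 = 0" "cl_conj (x + y) = cl_conj x + cl_conj y" "cl_conj (- x) = - cl_conj x"
  "cl_conj (x - y) = cl_conj x - cl_conj y" "cl_conj (c *\<^sub>R x) = c *\<^sub>R cl_conj x"
  by (auto simp: cl_conj_def)

lemma cl_prime_basis: "cl_prime (cl_basis A) = (-1) ^ card A *\<^sub>R cl_basis A"
  by (auto intro!: cl_eqI simp: cl_prime.rep_eq)

lemma cl_star_basis: "cl_star (cl_basis A) = (-1) ^ (card A * (card A - 1) div 2) *\<^sub>R cl_basis A"
  by (auto intro!: cl_eqI simp: cl_star.rep_eq)

lemma cl_involutions [simp]:
  "cl_prime (cl_prime x) = x" "cl_star (cl_star x) = x" "cl_conj (cl_conj x) = x"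
  by (auto intro!: cl_eqI simp: cl_conj_def cl_prime.rep_eq cl_star.rep_eq uminus_power_if)

lemma cl_star_prime: "cl_star (cl_prime x) = cl_conj x" "cl_prime (cl_star x) = cl_conj x"
  by (auto intro!: cl_eqI simp: cl_conj_def cl_prime.rep_eq cl_star.rep_eq)

lemma cl_conj_compose [simp]:
  "cl_conj (cl_prime x) = cl_star x" "cl_prime (cl_conj x) = cl_star x"
  "cl_conj (cl_star x) = cl_prime x" "cl_star (cl_conj x) = cl_prime x"
  by (auto intro!: cl_eqI simp: cl_conj_def cl_prime.rep_eq cl_star.rep_eq)

lemma cl_involutions_gen [simp]:
  "cl_prime (gen j) = - gen j" "cl_star (gen j) = gen j" "cl_conj (gen j) = - gen j"
  by (auto simp: gen_def cl_conj_def cl_prime_basis cl_star_basis)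

lemma cl_involutions_one [simp]: "cl_prime 1 = 1" "cl_star 1 = 1" "cl_conj 1 = 1"
  by (auto simp: one_cl_def cl_conj_def cl_prime_basis cl_star_basis)

text \<open>The sign of the reversal of \<open>e\<^sub>A\<close> is \<open>inv_sign A A\<close>; in contrast to the closed
  formula this is multiplicative in both arguments with respect to \<open>symdiff\<close>.\<close>

definition inv_sign :: "nat set \<Rightarrow> nat set \<Rightarrow> real" where
  "inv_sign A B = (\<Prod>a\<in>A. \<Prod>b\<in>B. if b < a then -1 else 1)"

lemma inv_sign_square: "inv_sign A B * inv_sign A B = 1"
  by (simp add: inv_sign_def prod.distrib[symmetric] prod.neutral)

lemma inv_sign_symdiff_left:
  assumes "finite A" "finite B" "finite C"
  shows "inv_sign (symdiff A B) C = inv_sign A C * inv_sign B C"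
  unfolding inv_sign_def
  by (rule prod_symdiff) (use assms in \<open>auto simp: prod.distrib[symmetric] intro!: prod.neutral\<close>)

lemma inv_sign_symdiff_right:
  assumes "finite A" "finite B" "finite C"
  shows "inv_sign A (symdiff B C) = inv_sign A B * inv_sign A C"
  unfolding inv_sign_def
  by (subst prod_symdiff) (use assms in \<open>auto simp: prod.distrib[symmetric]\<close>)

lemma cl_sign_eq_inv_sign:
  assumes "finite A" "finite B"
  shows "cl_sign A B = inv_sign A B * (-1) ^ card (A \<inter> B)"
proof -
  have "cl_sign A B = (\<Prod>a\<in>A. \<Prod>b\<in>B. (if b < a then -1 else 1) * (if a = b then -1 else 1))"
    unfolding cl_sign_def by (intro prod.cong) auto
  also have "\<dots> = inv_sign A B * (\<Prod>a\<in>A. \<Prod>b\<in>B. if a = b then -1 else 1)"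
    unfolding inv_sign_def by (simp add: prod.distrib)
  also have "(\<Prod>a\<in>A. \<Prod>b\<in>B. if a = b then -1 else 1) = (\<Prod>a\<in>A. if a \<in> B then -1 else (1::real))"
    using assms by (intro prod.cong) (auto simp: prod.delta)
  also have "\<dots> = (-1) ^ card (A \<inter> B)"
    using assms by (simp add: prod.If_cases Int_def)
  finally show ?thesis .
qed

text \<open>Adjoining a new maximum \<open>b\<close> to a set of size k creates k new inversions,
  one for each old element, and (k + 1) k / 2 = k + k (k - 1) / 2.\<close>

lemma star_sign: "finite A \<Longrightarrow> (-1::real) ^ (card A * (card A - 1) div 2) = inv_sign A A"
proof (induction A rule: finite_linorder_max_induct)
  case empty
  then show ?case by (simp add: inv_sign_def)
next
  case (insert b A)
  then have b: "b \<notin> A" by auto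
  have "(\<Prod>a\<in>A. if a < b then - 1 else 1) = (\<Prod>a\<in>A. -1::real)"
  proof (rule prod.cong[OF refl])
    fix a assume "a \<in> A"
    then show "(if a < b then - 1 else 1) = (-1::real)" using insert.hyps by simp
  qed
  then have 1: "(\<Prod>a\<in>A. if a < b then - 1 else 1) = (-1::real) ^ card A" by simp
  have 2: "(\<Prod>a\<in>A. \<Prod>c\<in>insert b A. if c < a then -1 else 1) = inv_sign A A"
    unfolding inv_sign_def
  proof (rule prod.cong[OF refl])
    fix a assume "a \<in> A"
    then have "\<not> b < a" using insert.hyps(2) less_asym by blast
    then show "(\<Prod>c\<in>insert b A. if c < a then - 1 else 1) = (\<Prod>c\<in>A. if c < a then - 1 else (1::real))"
      using insert.hyps(1) b by simp
  qed
  have "inv_sign (insert b A) (insert b A) = (-1) ^ card A * inv_sign A A"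
    unfolding inv_sign_def[of "insert b A"] using insert b 1 2 by (simp add: prod.insert)
  moreover have "Suc (card A) * card A div 2 = card A + card A * (card A - 1) div 2"
    by (cases "card A") (auto simp: algebra_simps)
  ultimately show ?case using insert b by (simp add: power_add del: mult_Suc)
qed

lemma cl_star_basis': "finite A \<Longrightarrow> cl_star (cl_basis A) = inv_sign A A *\<^sub>R cl_basis A"
  by (simp only: cl_star_basis star_sign)

lemma finite_symdiff: "finite A \<Longrightarrow> finite B \<Longrightarrow> finite (symdiff A B)"
  by (auto simp: symdiff_def)

text \<open>On basis elements both sides are multiples of the same \<open>cl_basis\<close>.
  Expanding \<open>inv_sign\<close> of \<open>symdiff A B\<close> against itself gives four factors;
  the one for A, B cancels against the one in \<open>cl_sign A B\<close>, and the one for B, A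
  survives as the sign of the reversed product.\<close>

lemma cl_star_mult: "cl_star (x * y) = cl_star y * cl_star x"
proof (induction x rule: cl_induct)
  case (basis c A)
  show ?case
  proof (induction y rule: cl_induct)
    case (basis d B)
    note fin = \<open>finite A\<close> \<open>finite B\<close>
    have "cl_sign A B * inv_sign (symdiff A B) (symdiff A B) =
        (inv_sign A B * inv_sign A B) * inv_sign A A * inv_sign B B * (inv_sign B A * (-1) ^ card (A \<inter> B))"
      using fin by (simp add: inv_sign_symdiff_left inv_sign_symdiff_right finite_symdiff cl_sign_eq_inv_sign)
    also have "\<dots> = inv_sign A A * inv_sign B B * cl_sign B A"
      using fin by (simp add: inv_sign_square cl_sign_eq_inv_sign Int_commute)
    finally show ?case using fin
      by (simp add: cl_basis_times cl_star_basis' finite_symdiff symdiff_commute[of B A] mult_ac)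
  qed (auto simp: algebra_simps)
qed (simp add: algebra_simps)

lemma prime_sign_symdiff:
  assumes "finite A" "finite B"
  shows "(-1::real) ^ card (symdiff A B) = (-1) ^ card A * (-1) ^ card B"
  using prod_symdiff[OF assms, of "\<lambda>_. -1"] by simp

lemma cl_prime_mult: "cl_prime (x * y) = cl_prime x * cl_prime y"
proof (induction x rule: cl_induct)
  case (basis c A)
  show ?case
  proof (induction y rule: cl_induct)
    case (basis d B)
    then show ?case using \<open>finite A\<close>
      by (simp add: cl_basis_times cl_prime_basis finite_symdiff prime_sign_symdiff mult_ac)
  qed (auto simp: algebra_simps)
qed (simp add: algebra_simps)

lemma cl_conj_mult: "cl_conj (x * y) = cl_conj y * cl_conj x"
  by (simp add: cl_conj_def cl_prime_mult cl_star_mult)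

lemma cl_Re_linear [simp]:
  "cl_Re 0 = 0" "cl_Re 1 = 1" "cl_Re (x + y) = cl_Re x + cl_Re y" "cl_Re (- x) = - cl_Re x"
  "cl_Re (x - y) = cl_Re x - cl_Re y" "cl_Re (c *\<^sub>R x) = c * cl_Re x" "cl_Re (of_real r) = r"
  by (auto simp: cl_Re_def one_cl_def of_real_def)

text \<open>Squaring a basis element and conjugating it produce the same sign, so each basis element
  times its own conjugate is 1, and only diagonal terms reach the coefficient of 1.\<close>

lemma cl_Re_times_conj: "cl_Re (x * cl_conj y) = inner x y"
proof -
  have *: "cl_sign A A * ((-1) ^ (card A * (card A - 1) div 2) * ((-1) ^ card A * c)) = c" if "finite A" for A c
  proof -
    have "cl_sign A A * ((-1) ^ (card A * (card A - 1) div 2) * ((-1) ^ card A * c)) =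
        (inv_sign A A * inv_sign A A) * (((-1) ^ card A * (-1) ^ card A) * c)"
      using that by (simp only: star_sign cl_sign_eq_inv_sign Int_absorb mult_ac)
    also have "\<dots> = c"
      by (simp add: inv_sign_square power_mult_distrib[symmetric])
    finally show ?thesis .
  qed
  have "cl_coeff (x * cl_conj y) {} =
      (\<Sum>A | cl_coeff x A \<noteq> 0. cl_sign A A * cl_coeff x A * cl_coeff (cl_conj y) A)"
    by (simp add: cl_coeff_times_supset[OF cl_coeff_finite order.refl])
  also have "\<dots> = (\<Sum>A | cl_coeff x A \<noteq> 0. cl_coeff x A * cl_coeff y A)"
  proof (rule sum.cong[OF refl])
    fix A assume "A \<in> {A. cl_coeff x A \<noteq> 0}"
    then have "finite A" using cl_coeff_infinite by auto
    then show "cl_sign A A * cl_coeff x A * cl_coeff (cl_conj y) A = cl_coeff x A * cl_coeff y A"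
      using *[of A "cl_coeff y A"] by (simp add: cl_conj_def cl_prime.rep_eq cl_star.rep_eq mult_ac)
  qed
  finally show ?thesis by (simp add: cl_Re_def inner_cl_def)
qed

lemma inner_involutions [simp]:
  fixes x y :: cl
  shows "inner (cl_prime x) (cl_prime y) = inner x y" "inner (cl_star x) (cl_star y) = inner x y"
    "inner (cl_conj x) (cl_conj y) = inner x y"
proof -
  have *: "(-1) ^ k * a * ((-1) ^ k * b) = a * (b :: real)" for k :: nat and a b
    by (simp add: mult.assoc mult.left_commute power_mult_distrib[symmetric])
  have p: "inner (cl_prime x) (cl_prime y) = inner x y" for x y
    unfolding inner_cl_def by (rule sum.cong) (auto simp: cl_prime.rep_eq *)
  have s: "inner (cl_star x) (cl_star y) = inner x y" for x y
    unfolding inner_cl_def by (rule sum.cong) (auto simp: cl_star.rep_eq *)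
  show "inner (cl_prime x) (cl_prime y) = inner x y" "inner (cl_star x) (cl_star y) = inner x y"
    "inner (cl_conj x) (cl_conj y) = inner x y"
    using p s by (simp_all add: cl_conj_def)
qed

lemma cl_N_eq_inner: "cl_N x = inner x x"
  by (simp add: cl_N_def cl_Re_times_conj)

lemma inner_cl_basis: "finite A \<Longrightarrow> finite B \<Longrightarrow> inner (cl_basis A) (cl_basis B) = (if A = B then 1 else 0)"
  by (subst inner_cl_supset[of "{A}"]) auto

lemma inner_gen: "inner (gen j) (gen k) = (if j = k then 1 else 0)"
  by (simp add: gen_def inner_cl_basis)

lemma inner_gen_one [simp]: "inner (gen j) 1 = 0" "inner 1 (gen j) = 0" "inner (1::cl) 1 = 1" "cl_Re (gen j) = 0"
  by (simp_all add: gen_def one_cl_def inner_cl_basis cl_Re_def)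

text \<open>The subalgebra on i_1, ..., i_(m-1), in the indexing of \<open>paravectors\<close>. It
  serves two purposes: i_j with j >= m passes through it at the cost of \<open>cl_prime\<close>, and
  it is finite-dimensional, so that continuity can be checked on finitely many coefficients although
  \<open>cl\<close> is infinite-dimensional.\<close>

definition clsub :: "nat \<Rightarrow> cl set" where
  "clsub m = {x. \<forall>A. cl_coeff x A \<noteq> 0 \<longrightarrow> A \<subseteq> {1..<m}}"

lemma clsub_of_real [simp]: "0 \<in> clsub m" "1 \<in> clsub m" "of_real r \<in> clsub m"
  by (auto simp: clsub_def one_cl_def of_real_def split: if_splits)

lemma clsub_linear:
  "x \<in> clsub m \<Longrightarrow> y \<in> clsub m \<Longrightarrow> x + y \<in> clsub m"
  "x \<in> clsub m \<Longrightarrow> y \<in> clsub m \<Longrightarrow> x - y \<in> clsub m"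
  "x \<in> clsub m \<Longrightarrow> - x \<in> clsub m" "x \<in> clsub m \<Longrightarrow> c *\<^sub>R x \<in> clsub m"
  unfolding clsub_def by (simp_all, metis add.right_neutral, metis diff_zero)

lemma clsub_involutions:
  "x \<in> clsub m \<Longrightarrow> cl_prime x \<in> clsub m" "x \<in> clsub m \<Longrightarrow> cl_star x \<in> clsub m"
  "x \<in> clsub m \<Longrightarrow> cl_conj x \<in> clsub m"
  by (auto simp: clsub_def cl_conj_def cl_prime.rep_eq cl_star.rep_eq)

lemma clsub_mult: assumes "x \<in> clsub m" "y \<in> clsub m" shows "x * y \<in> clsub m"
proof -
  have "C \<subseteq> {1..<m}" if "cl_coeff (x * y) C \<noteq> 0" for C
  proof -
    have "(\<Sum>A | cl_coeff x A \<noteq> 0. cl_sign A (symdiff A C) * cl_coeff x A * cl_coeff y (symdiff A C)) \<noteq> 0"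
      using that cl_coeff_times_supset[OF cl_coeff_finite order.refl, of x y C] by simp
    then obtain A where "A \<in> {A. cl_coeff x A \<noteq> 0}"
      "cl_sign A (symdiff A C) * cl_coeff x A * cl_coeff y (symdiff A C) \<noteq> 0"
      by (rule sum.not_neutral_contains_not_neutral)
    then have "A \<subseteq> {1..<m}" "symdiff A C \<subseteq> {1..<m}" using assms by (auto simp: clsub_def)
    from symdiff_mono[OF this] show ?thesis by simp
  qed
  then show ?thesis by (simp add: clsub_def)
qed

lemma clsub_mono: "m \<le> k \<Longrightarrow> clsub m \<subseteq> clsub k"
proof
  fix x assume "m \<le> k" "x \<in> clsub m"
  then have "A \<subseteq> {1..<k}" if "cl_coeff x A \<noteq> 0" for A
    using that order.trans[of A "{1..<m}" "{1..<k}"] unfolding clsub_def by simp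
  then show "x \<in> clsub k" by (simp add: clsub_def)
qed

lemma clsub_induct [consumes 1, case_names basis add]:
  assumes "x \<in> clsub m" "\<And>c A. A \<subseteq> {1..<m} \<Longrightarrow> P (c *\<^sub>R cl_basis A)" "\<And>x y. P x \<Longrightarrow> P y \<Longrightarrow> P (x + y)"
  shows "P x"
proof -
  have 0: "P 0" using assms(2)[of "{}" 0] by simp
  have "P (\<Sum>A\<in>S. cl_coeff x A *\<^sub>R cl_basis A)" if "finite S" "\<forall>A\<in>S. A \<subseteq> {1..<m}" for S
    using that by (induction S) (auto intro: 0 assms[unfolded One_nat_def])
  moreover have "\<forall>A\<in>{A. cl_coeff x A \<noteq> 0}. A \<subseteq> {1..<m}" using assms(1) by (auto simp: clsub_def)
  ultimately show ?thesis
    using cl_expand[OF cl_coeff_finite order.refl, of x] cl_coeff_finite[of x] by metis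
qed

lemma gen_times_basis:
  assumes "finite A" "j \<notin> A"
  shows "gen j * cl_basis A = (-1) ^ card A *\<^sub>R (cl_basis A * gen j)"
proof -
  have "cl_sign {j} A * cl_sign A {j} = (\<Prod>a\<in>A. (if a \<le> j then -1 else 1) * (if j \<le> a then -1 else 1))"
    unfolding cl_sign_def by (simp add: prod.distrib)
  also have "\<dots> = (\<Prod>a\<in>A. -1)" using assms by (intro prod.cong) auto
  finally have "cl_sign {j} A * cl_sign A {j} = (-1) ^ card A" by simp
  moreover have "cl_sign A {j} * cl_sign A {j} = 1"
    unfolding cl_sign_def by (auto simp: prod.distrib[symmetric] intro!: prod.neutral)
  ultimately have "cl_sign {j} A = (-1) ^ card A * cl_sign A {j}"
    by (metis mult.assoc mult.commute mult_1)
  then show ?thesis using assms by (simp add: gen_def cl_basis_times symdiff_commute)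
qed

text \<open>Each generator of the subalgebra anticommutes with \<open>gen j\<close>, which produces
  the grade involution. With m = j = n + 1 this moves the vertical direction of the upper half-space
  through the entries of columns.\<close>

lemma gen_times_clsub:
  assumes "y \<in> clsub m" "m \<le> j"
  shows "gen j * y = cl_prime y * gen j"
  using assms(1)
proof (induction rule: clsub_induct)
  case (basis c A)
  then have "finite A" "j \<notin> A" using assms(2) finite_subset by auto
  then show ?case by (simp add: gen_times_basis cl_prime_basis)
qed (simp add: algebra_simps)

section \<open>Paravectors, the paravector group and the spin group\<close>

lemma subspace_paravectors: "subspace (paravectors m)"
  by (simp add: paravectors_def)

lemma paravectors_iff:
  "x \<in> paravectors m \<longleftrightarrow> (\<forall>A. cl_coeff x A \<noteq> 0 \<longrightarrow> A = {} \<or> (\<exists>j\<in>{1..<m}. A = {j}))" (is "_ \<longleftrightarrow> ?R x")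
proof
  assume "x \<in> paravectors m"
  then show "?R x" unfolding paravectors_def
  proof (induction rule: span_induct)
    case base
    show ?case unfolding subspace_def by (simp, metis add.right_neutral)
  next
    case (step x)
    then show ?case by (auto simp: gen_def one_cl_def split: if_splits)
  qed
next
  assume R: "?R x"
  have "(\<Sum>A | cl_coeff x A \<noteq> 0. cl_coeff x A *\<^sub>R cl_basis A) \<in> paravectors m"
    unfolding paravectors_def
  proof (intro span_sum span_scale)
    fix A assume "A \<in> {A. cl_coeff x A \<noteq> 0}"
    then have "A = {} \<or> (\<exists>j\<in>{1..<m}. A = {j})" using R by blast
    then show "cl_basis A \<in> span (insert 1 (gen ` {1..<m}))"
      by (intro span_base) (auto simp: gen_def one_cl_def)
  qed
  then show "x \<in> paravectors m" using cl_expand[OF cl_coeff_finite order.refl, of x] by simp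
qed

lemma paravectors_linear:
  "0 \<in> paravectors m" "1 \<in> paravectors m" "of_real r \<in> paravectors m"
  "x \<in> paravectors m \<Longrightarrow> y \<in> paravectors m \<Longrightarrow> x + y \<in> paravectors m"
  "x \<in> paravectors m \<Longrightarrow> y \<in> paravectors m \<Longrightarrow> x - y \<in> paravectors m"
  "x \<in> paravectors m \<Longrightarrow> - x \<in> paravectors m" "x \<in> paravectors m \<Longrightarrow> c *\<^sub>R x \<in> paravectors m"
proof -
  have 1: "1 \<in> paravectors m" by (auto simp: paravectors_def intro: span_base)
  then show "1 \<in> paravectors m" "of_real r \<in> paravectors m"
    using subspace_scale[OF subspace_paravectors] by (auto simp: of_real_def)
qed (auto intro: subspace_paravectors subspace_0 subspace_add subspace_diff subspace_neg subspace_scale)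

lemma gen_in_paravectors: "1 \<le> j \<Longrightarrow> j < m \<Longrightarrow> gen j \<in> paravectors m"
  by (auto simp: paravectors_def intro: span_base)

lemma paravectors_mono: "m \<le> k \<Longrightarrow> paravectors m \<subseteq> paravectors k"
  unfolding paravectors_def by (intro span_mono) auto

lemma paravectors_clsub: "paravectors m \<subseteq> clsub m"
  by (fastforce simp: paravectors_iff clsub_def)

lemma paravector_star: "v \<in> paravectors m \<Longrightarrow> cl_star v = v"
  by (rule cl_eqI) (fastforce simp: cl_star.rep_eq paravectors_iff)

lemma paravector_prime: "v \<in> paravectors m \<Longrightarrow> cl_prime v = cl_conj v"
  using cl_conj_compose(2)[of v] by (metis cl_involutions(1) cl_star_prime(2) paravector_star)

lemma paravector_conj: "v \<in> paravectors m \<Longrightarrow> cl_conj v \<in> paravectors m"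
  by (auto simp: paravectors_iff cl_conj_def cl_star.rep_eq cl_prime.rep_eq)

lemma cl_times_of_real: "x * of_real r = r *\<^sub>R x" "of_real r * x = r *\<^sub>R x" for x :: cl
  by (simp_all add: of_real_def)

text \<open>The identity is bilinear and symmetric, so it suffices to know it on 1 and the
  generators, where it is the Clifford relations. The span induction runs in one variable and then,
  with the roles exchanged, in the other.\<close>

lemma paravector_polar:
  assumes "v \<in> paravectors m" "w \<in> paravectors m"
  shows "v * cl_conj w + w * cl_conj v = of_real (2 * inner v w)"
proof -
  let ?B = "insert 1 (gen ` {1..<m})" and ?P = "\<lambda>v w. v * cl_conj w + w * cl_conj v = of_real (2 * inner v w)"
  have sub: "subspace {v. ?P v w}" for w
  proof -
    have "c *\<^sub>R v * cl_conj w + w * cl_conj (c *\<^sub>R v) = c *\<^sub>R (v * cl_conj w + w * cl_conj v)" for c v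
      by (simp add: scaleR_right_distrib)
    then show ?thesis
      unfolding subspace_def of_real_def
      by (auto simp: algebra_simps inner_simps) (simp add: scaleR_right_distrib[symmetric])
  qed
  have sym: "?P v w = ?P w v" for v w by (simp add: add.commute inner_commute)
  have b: "?P b c" if "b \<in> ?B" "c \<in> ?B" for b c
    using that by (auto simp: gen_square inner_gen) (metis gen_anticommute ab_left_minus)
  have c: "?P v c" if "c \<in> ?B" for c
    using assms(1)[unfolded paravectors_def]
  proof (rule span_induct[where P = "\<lambda>v. ?P v c"])
    show "?P x c" if "x \<in> ?B" for x by (rule b[OF that \<open>c \<in> ?B\<close>])
  qed (rule sub)
  have "?P w v"
    using assms(2)[unfolded paravectors_def]
  proof (rule span_induct[where P = "\<lambda>w. ?P w v"])
    show "?P x v" if "x \<in> ?B" for x using c[OF that] by (rule sym[THEN iffD1])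
  qed (rule sub)
  then show ?thesis by (rule sym[THEN iffD1])
qed

lemma paravector_norm:
  assumes "v \<in> paravectors m"
  shows "v * cl_conj v = of_real (inner v v)" "cl_conj v * v = of_real (inner v v)"
proof -
  have "v * cl_conj v = of_real (inner v v)" if "v \<in> paravectors m" for v
  proof -
    have "2 *\<^sub>R (v * cl_conj v) = 2 *\<^sub>R of_real (inner v v)"
      using paravector_polar[OF that that] by (simp add: scaleR_2[symmetric] scaleR_conv_of_real)
    then show ?thesis by simp
  qed
  from this[OF assms] this[OF paravector_conj[OF assms]]
  show "v * cl_conj v = of_real (inner v v)" "cl_conj v * v = of_real (inner v v)" by simp_all
qed

text \<open>Up to the factor -|v|^2 the right-hand side is the reflection along \<open>v\<close>
  applied to the conjugate of \<open>w\<close>. This is why \<open>sigma\<close> of a paravector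
  preserves paravectors, and it gives the frame computations a closed form.\<close>

lemma paravector_sandwich:
  assumes "v \<in> paravectors m" "w \<in> paravectors m"
  shows "v * w * v = (2 * inner v (cl_conj w)) *\<^sub>R v - inner v v *\<^sub>R cl_conj w"
proof -
  have "v * w + cl_conj w * cl_conj v = of_real (2 * inner v (cl_conj w))"
    using paravector_polar[OF assms(1) paravector_conj[OF assms(2)]] by simp
  then have "v * w = of_real (2 * inner v (cl_conj w)) - cl_conj w * cl_conj v"
    by (simp add: eq_diff_eq)
  then have "v * w * v = (of_real (2 * inner v (cl_conj w)) - cl_conj w * cl_conj v) * v"
    by (simp only:)
  then show ?thesis
    by (simp only: left_diff_distrib mult.assoc paravector_norm(2)[OF assms(1)] cl_times_of_real)
qed

text \<open>The induction carries an unspecified nonzero scalar: products and inverses only need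
  both norms to be the same real number. That it is \<open>inner x x\<close> follows at the end by
  taking real parts.\<close>

lemma Gamma_norm:
  assumes "x \<in> Gamma m"
  shows "x * cl_conj x = of_real (inner x x)" "cl_conj x * x = of_real (inner x x)" "x \<noteq> 0"
proof -
  have "\<exists>r. r \<noteq> 0 \<and> x * cl_conj x = of_real r \<and> cl_conj x * x = of_real r" using assms
  proof induction
    case one
    show ?case by (intro exI[of _ 1]) simp
  next
    case (gen v)
    then show ?case by (intro exI[of _ "inner v v"]) (simp add: paravector_norm)
  next
    case (mult x y)
    then obtain r s where r: "r \<noteq> 0" "x * cl_conj x = of_real r" "cl_conj x * x = of_real r"
      and s: "s \<noteq> 0" "y * cl_conj y = of_real s" "cl_conj y * y = of_real s" by blast
    have "x * y * cl_conj (x * y) = x * (y * cl_conj y) * cl_conj x"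
      by (simp add: cl_conj_mult mult.assoc)
    also have "\<dots> = of_real (s * r)"
      by (simp add: s r of_real_def)
    finally have 1: "x * y * cl_conj (x * y) = of_real (s * r)" .
    have "cl_conj (x * y) * (x * y) = cl_conj y * (cl_conj x * x) * y"
      by (simp add: cl_conj_mult mult.assoc)
    also have "\<dots> = of_real (s * r)"
      by (simp add: s r of_real_def)
    finally show ?case using 1 r s by (intro exI[of _ "s * r"]) simp
  next
    case (inv x y)
    then obtain r where r: "r \<noteq> 0" "x * cl_conj x = of_real r" "cl_conj x * x = of_real r" by blast
    have "r *\<^sub>R y = cl_conj x * (x * y)" using r(3) by (simp add: mult.assoc[symmetric] scaleR_conv_of_real)
    then have "(1 / r) *\<^sub>R (r *\<^sub>R y) = (1 / r) *\<^sub>R cl_conj x" using \<open>x * y = 1\<close> by simp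
    then have y: "y = (1 / r) *\<^sub>R cl_conj x" using r(1) by simp
    show ?case using r by (intro exI[of _ "1 / r"]) (simp add: y of_real_def)
  qed
  then obtain r where r: "r \<noteq> 0" "x * cl_conj x = of_real r" "cl_conj x * x = of_real r" by blast
  have "inner x x = r" using cl_Re_times_conj[of x x] r by simp
  then show "x * cl_conj x = of_real (inner x x)" "cl_conj x * x = of_real (inner x x)" "x \<noteq> 0" using r by auto
qed

lemma Gamma_inner_pos: "x \<in> Gamma m \<Longrightarrow> inner x x > 0"
  using Gamma_norm(3) by simp

text \<open>The inverse rule of \<open>Gamma\<close> leaves the inverse implicit. Writing it as a
  multiple of the conjugate lets inductions transfer properties that are stable under conjugation
  and scaling.\<close>

lemma Gamma_inverse_eq:
  assumes "x \<in> Gamma m" "x * y = 1"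
  shows "y = (1 / inner x x) *\<^sub>R cl_conj x"
proof -
  have "inner x x *\<^sub>R y = cl_conj x * (x * y)"
    using Gamma_norm(2)[OF assms(1)] by (simp add: mult.assoc[symmetric] scaleR_conv_of_real)
  then have "(1 / inner x x) *\<^sub>R (inner x x *\<^sub>R y) = (1 / inner x x) *\<^sub>R cl_conj x" using assms by simp
  then show ?thesis using Gamma_norm(3)[OF assms(1)] by simp
qed

lemma Gamma_scale: assumes "x \<in> Gamma m" "c \<noteq> 0" shows "c *\<^sub>R x \<in> Gamma m"
proof -
  have "of_real c \<in> Gamma m" using assms paravectors_linear(3) by (intro Gamma.gen) auto
  then show ?thesis using Gamma.mult[OF _ assms(1)] by (simp add: scaleR_conv_of_real)
qed

lemma Gamma_conj: assumes "x \<in> Gamma m" shows "cl_conj x \<in> Gamma m"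
proof -
  have "x * ((1 / inner x x) *\<^sub>R cl_conj x) = 1" "((1 / inner x x) *\<^sub>R cl_conj x) * x = 1"
    using Gamma_norm[OF assms] by (simp_all add: of_real_def)
  then have "(1 / inner x x) *\<^sub>R cl_conj x \<in> Gamma m" using Gamma.inv assms by blast
  from Gamma_scale[OF this, of "inner x x"] show ?thesis using Gamma_norm[OF assms] by simp
qed

lemma Gamma_prime: "x \<in> Gamma m \<Longrightarrow> cl_prime x \<in> Gamma m"
proof (induction rule: Gamma.induct)
  case (gen v)
  then show ?case using paravector_prime[of v m] paravector_conj[of v m]
    by (metis Gamma.gen cl_involutions(1) cl_prime_linear(1))
next
  case (inv x y)
  then show ?case using Gamma.inv[of "cl_prime x" m "cl_prime y"]
    by (metis cl_involutions_one(1) cl_prime_mult)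
qed (auto intro: Gamma.intros simp: cl_prime_mult)

lemma Gamma_star: "x \<in> Gamma m \<Longrightarrow> cl_star x \<in> Gamma m"
  using Gamma_prime[OF Gamma_conj[of x m]] by simp

lemma Gamma_mono: assumes "m \<le> k" shows "x \<in> Gamma m \<Longrightarrow> x \<in> Gamma k"
proof (induction rule: Gamma.induct)
  case (gen v)
  then show ?case using paravectors_mono[OF assms] by (auto intro: Gamma.gen)
qed (auto intro: Gamma.intros)

lemma Gamma_clsub: "x \<in> Gamma m \<Longrightarrow> x \<in> clsub m"
proof (induction rule: Gamma.induct)
  case (inv x y)
  then show ?case using Gamma_inverse_eq[of x m y] clsub_linear(4) clsub_involutions(3) by metis
qed (use paravectors_clsub in \<open>auto intro: clsub_mult\<close>)

section \<open>The twisted action of the paravector group and its kernel\<close>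

lemma sigma_linear [simp]:
  "sigma s (v + w) = sigma s v + sigma s w" "sigma s (v - w) = sigma s v - sigma s w"
  "sigma s (c *\<^sub>R v) = c *\<^sub>R sigma s v" "sigma s (- v) = - sigma s v" "sigma s 0 = 0"
  by (simp_all add: sigma_def algebra_simps)

lemma linear_sigma: "linear (sigma s)"
  by (rule linearI) simp_all

lemma sigma_mult: "sigma (s * t) v = sigma s (sigma t v)"
  by (simp add: sigma_def cl_star_mult mult.assoc)

lemma sigma_scale: "sigma (c *\<^sub>R s) v = (c * c) *\<^sub>R sigma s v"
  by (simp add: sigma_def)

lemma sigma_one [simp]: "sigma 1 v = v" "sigma (- s) v = sigma s v"
  by (simp_all add: sigma_def)

lemma sigma_paravector:
  assumes "v \<in> paravectors m" "w \<in> paravectors m"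
  shows "sigma v w \<in> paravectors m"
  using paravector_sandwich[OF assms] paravector_star[OF assms(1)] paravector_conj[OF assms(2)] assms
  by (simp add: sigma_def paravectors_linear)

text \<open>The conjugate is included because the inverse of an element is a multiple of its
  conjugate, so the inverse rule exchanges the two halves of the claim.\<close>

lemma sigma_Gamma_both:
  "s \<in> Gamma m \<Longrightarrow> \<forall>w\<in>paravectors m. sigma s w \<in> paravectors m \<and> sigma (cl_conj s) w \<in> paravectors m"
proof (induction rule: Gamma.induct)
  case (gen v)
  then show ?case by (simp add: sigma_paravector paravector_conj)
next
  case (mult x y)
  then show ?case by (simp add: cl_conj_mult sigma_mult)
next
  case (inv x y)
  then show ?case using Gamma_inverse_eq[of x m y] by (simp add: sigma_scale paravectors_linear)
qed auto

lemma sigma_Gamma: "s \<in> Gamma m \<Longrightarrow> w \<in> paravectors m \<Longrightarrow> sigma s w \<in> paravectors m"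
  using sigma_Gamma_both by blast

text \<open>Under the real part the two factors \<open>s\<close> meet as
  \<open>s * cl_conj s\<close>, which is a real number: multiplication by a group element is a
  similarity.\<close>

lemma inner_mult_right_Gamma:
  assumes "s \<in> Gamma m"
  shows "inner (x * s) (y * s) = inner s s * inner x y"
proof -
  have "inner (x * s) (y * s) = cl_Re (x * (s * cl_conj s) * cl_conj y)"
    by (simp add: cl_Re_times_conj[symmetric] cl_conj_mult mult.assoc)
  also have "\<dots> = inner s s * inner x y"
    by (simp add: Gamma_norm[OF assms] of_real_def cl_Re_times_conj)
  finally show ?thesis .
qed

lemma inner_mult_left_Gamma:
  assumes "s \<in> Gamma m"
  shows "inner (s * x) (s * y) = inner s s * inner x y"
  using inner_mult_right_Gamma[OF Gamma_conj[OF assms], of "cl_conj x" "cl_conj y"]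
  by (metis cl_conj_mult inner_involutions(3))

lemma inner_sigma:
  assumes "s \<in> Gamma m"
  shows "inner (sigma s x) (sigma s y) = (inner s s)\<^sup>2 * inner x y"
  unfolding sigma_def
  by (simp add: inner_mult_right_Gamma[OF Gamma_star[OF assms]] inner_mult_left_Gamma[OF assms] power2_eq_square)

lemma Spin_iff: "s \<in> Spin m \<longleftrightarrow> s \<in> Gamma m \<and> inner s s = 1"
  by (simp add: Spin_def cl_N_eq_inner)

lemma Spin_mult: "s \<in> Spin m \<Longrightarrow> t \<in> Spin m \<Longrightarrow> s * t \<in> Spin m"
  by (auto simp: Spin_iff inner_mult_left_Gamma intro: Gamma.mult)

lemma Spin_conj: "s \<in> Spin m \<Longrightarrow> cl_conj s \<in> Spin m"
  by (simp add: Spin_iff Gamma_conj)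

lemma Spin_uminus: "s \<in> Spin m \<Longrightarrow> - s \<in> Spin m"
  using Gamma_scale[of s m "-1"] by (simp add: Spin_iff)

lemma Spin_inverse: "s \<in> Spin m \<Longrightarrow> s * cl_conj s = 1" "s \<in> Spin m \<Longrightarrow> cl_conj s * s = 1"
  by (auto simp: Spin_iff Gamma_norm)

lemma Gamma_normalize: "x \<in> Gamma m \<Longrightarrow> (1 / norm x) *\<^sub>R x \<in> Spin m"
  using Gamma_scale[of x m "1 / norm x"] Gamma_norm(3)[of x m]
  by (simp add: Spin_iff power2_norm_eq_inner[symmetric] power2_eq_square)

lemma cl_coeff_times_basis:
  assumes "finite A"
  shows "cl_coeff (x * cl_basis A) C = cl_sign (symdiff A C) A * cl_coeff x (symdiff A C)"
proof (induction x rule: cl_induct)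
  case (basis c B)
  have "symdiff A C = B \<longleftrightarrow> C = symdiff B A" by (metis symdiff_simps(4) symdiff_commute)
  then show ?case using basis assms by (auto simp: cl_basis_times finite_symdiff)
qed (simp add: algebra_simps)

text \<open>An even element that commutes with all generators is real; elements of the kernel are even
  because both \<open>s\<^sup>*\<close> and the conjugate are inverse to \<open>s\<close>.\<close>

lemma sigma_kernel:
  assumes s: "s \<in> Spin m" and stab: "\<And>v. v \<in> paravectors m \<Longrightarrow> sigma s v = v"
  shows "s = 1 \<or> s = -1"
proof -
  have "s * cl_star s = 1" using stab[OF paravectors_linear(2)] by (simp add: sigma_def)
  then have star: "cl_star s = cl_conj s"
    using Spin_inverse(2)[OF s] by (metis mult.assoc mult.left_neutral mult.right_neutral)
  then have "cl_prime s = s" by (metis cl_conj_def cl_involutions(2))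
  then have even: "even (card A)" if "cl_coeff s A \<noteq> 0" for A
    using that by (auto simp: uminus_power_if cl_prime.rep_eq dest!: arg_cong[of _ _ "\<lambda>x. cl_coeff x A"] split: if_splits)
  have comm: "s * gen j = gen j * s" if "j \<in> {1..<m}" for j
  proof -
    have "s * gen j * cl_conj s = gen j" using stab[OF gen_in_paravectors] that star by (simp add: sigma_def)
    then have "s * gen j * (cl_conj s * s) = gen j * s" by (simp add: mult.assoc[symmetric])
    then show ?thesis by (simp add: Spin_inverse[OF s])
  qed
  have no: "j \<notin> A" if A: "cl_coeff s A \<noteq> 0" and j: "j \<in> {1..<m}" for A j
  proof
    assume jA: "j \<in> A"
    have fin: "finite A" using A cl_coeff_infinite by blast
    \<comment> \<open>At \<open>symdiff {j} A\<close> the two products show the signs of moving i_j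
      into e_A from the left and from the right. As A contains j and has even size, i_j meets an odd
      number of other factors, so these signs would have to differ.\<close>
    have "cl_coeff (gen j * s) (symdiff {j} A) = cl_coeff (s * gen j) (symdiff {j} A)"
      using comm[OF j] by simp
    then have eq: "cl_sign {j} A = cl_sign A {j}"
      using A by (simp add: gen_def cl_coeff_basis_times cl_coeff_times_basis)
    have "cl_sign {j} A * cl_sign A {j} = (\<Prod>a\<in>A. (if a \<le> j then -1 else 1) * (if j \<le> a then -1 else 1))"
      unfolding cl_sign_def by (simp add: prod.distrib)
    also have "\<dots> = (\<Prod>a\<in>A - {j}. (if a \<le> j then -1 else 1) * (if j \<le> a then -1 else 1))"
      using fin jA by (subst prod.remove[of A j]) auto
    also have "\<dots> = (\<Prod>a\<in>A - {j}. -1)" by (intro prod.cong) auto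
    also have "\<dots> = (-1) ^ (card A - 1)" using fin jA by simp
    also have "\<dots> = -1"
    proof -
      have "card A > 0" using fin jA by (auto simp: card_gt_0_iff)
      then have "odd (card A - 1)" using even[OF A] by simp
      then show ?thesis by simp
    qed
    finally have "cl_sign A {j} * cl_sign A {j} = -1" using eq by simp
    then show False
      using zero_le_square[of "cl_sign A {j}"] by linarith
  qed
  have "A = {}" if "cl_coeff s A \<noteq> 0" for A
  proof -
    have "A \<subseteq> {1..<m}" using s that Gamma_clsub by (auto simp: Spin_iff clsub_def)
    then show ?thesis using no[OF that] by blast
  qed
  then have "s = of_real (cl_coeff s {})"
    by (intro cl_eqI) (auto simp: of_real_def one_cl_def)
  then obtain r where r: "s = of_real r" by blast
  have "r * r = 1" using s by (simp add: r Spin_iff of_real_def)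
  then show ?thesis using r by (auto simp: square_eq_1_iff)
qed

lemma sigma_eq_imp:
  assumes g: "g \<in> Spin m" and h: "h \<in> Spin m"
    and eq: "\<And>v. v \<in> paravectors m \<Longrightarrow> sigma g v = sigma h v"
  shows "g = h \<or> g = - h"
proof -
  have "sigma (cl_conj h * g) v = v" if "v \<in> paravectors m" for v
    using eq[OF that] Spin_inverse(2)[OF h] sigma_mult[of "cl_conj h" h v] by (simp add: sigma_mult)
  then have "cl_conj h * g = 1 \<or> cl_conj h * g = -1"
    using sigma_kernel[OF Spin_mult[OF Spin_conj[OF h] g]] by blast
  moreover have "g = h * (cl_conj h * g)" using Spin_inverse(1)[OF h] by (simp add: mult.assoc[symmetric])
  ultimately show ?thesis by auto
qed

section \<open>Orthonormal expansion of paravectors of dimension n + 2\<close>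

lemma std_basis_paravector: "std_basis n k \<in> paravectors (n + 2)"
  by (auto simp: std_basis_def intro: gen_in_paravectors paravectors_linear)

lemma std_basis_orthonormal:
  "k \<le> n + 1 \<Longrightarrow> l \<le> n + 1 \<Longrightarrow> inner (std_basis n k) (std_basis n l) = (if k = l then 1 else 0)"
  by (auto simp: std_basis_def inner_gen)

lemma paravectors_std_basis: "paravectors (n + 2) = span (std_basis n ` {..n + 1})"
proof -
  have "insert 1 (gen ` {1..<n + 2}) = std_basis n ` {..n + 1}"
  proof
    show "insert 1 (gen ` {1..<n + 2}) \<subseteq> std_basis n ` {..n + 1}"
    proof
      fix x assume "x \<in> insert 1 (gen ` {1..<n + 2})"
      then consider "x = 1" | j where "x = gen j" "1 \<le> j" "j \<le> n" | "x = gen (n + 1)"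
        by (auto simp: less_Suc_eq_le le_Suc_eq)
      then show "x \<in> std_basis n ` {..n + 1}"
      proof cases
        case 1 then show ?thesis by (intro image_eqI[of _ _ "n + 1"]) (auto simp: std_basis_def)
      next
        case (2 j) then show ?thesis by (intro image_eqI[of _ _ j]) (auto simp: std_basis_def)
      next
        case 3 then show ?thesis by (intro image_eqI[of _ _ 0]) (auto simp: std_basis_def)
      qed
    qed
  qed (auto simp: std_basis_def)
  then show ?thesis by (simp add: paravectors_def)
qed

lemma sigma_eq_on_std_basis:
  assumes "\<And>k. k \<le> n + 1 \<Longrightarrow> sigma g (std_basis n k) = sigma h (std_basis n k)" "v \<in> paravectors (n + 2)"
  shows "sigma g v = sigma h v"
  using assms(2) unfolding paravectors_std_basis
  by (rule linear_eq_on_span[OF linear_sigma linear_sigma, rotated]) (use assms(1) in auto)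

lemma paravector_expand:
  assumes "v \<in> paravectors (n + 2)"
  shows "v = (\<Sum>k\<le>n + 1. inner v (std_basis n k) *\<^sub>R std_basis n k)"
proof -
  have "linear (\<lambda>v. \<Sum>k\<le>n + 1. inner v (std_basis n k) *\<^sub>R std_basis n k)"
    by (rule linearI) (simp_all add: inner_add_left scaleR_left_distrib sum.distrib scaleR_sum_right del: sum.atMost_Suc)
  then show ?thesis
  proof (rule linear_eq_on_span[OF linear_id[unfolded id_def] _ _ assms[unfolded paravectors_std_basis]])
    fix b assume "b \<in> std_basis n ` {..n + 1}"
    then obtain l where l: "l \<le> n + 1" "b = std_basis n l" by auto
    have "(\<Sum>k\<le>n + 1. inner b (std_basis n k) *\<^sub>R std_basis n k) = (\<Sum>k\<le>n + 1. if k = l then b else 0)"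
      using l by (intro sum.cong) (auto simp: std_basis_orthonormal)
    then show "b = (\<Sum>k\<le>n + 1. inner b (std_basis n k) *\<^sub>R std_basis n k)" using l by simp
  qed
qed

subsection \<open>Continuity\<close>

text \<open>On an infinite-dimensional space a linear functional needs a bound: one squared
  coefficient is at most the sum of all of them.\<close>

lemma bounded_linear_cl_coeff: "bounded_linear (\<lambda>x. cl_coeff x A)"
proof (rule bounded_linear_intro[of _ 1])
  fix x
  show "norm (cl_coeff x A) \<le> norm x * 1"
  proof (cases "cl_coeff x A = 0")
    case False
    have "(cl_coeff x A)\<^sup>2 \<le> (\<Sum>A | cl_coeff x A \<noteq> 0. cl_coeff x A * cl_coeff x A)"
      unfolding power2_eq_square
      by (rule member_le_sum) (use False in \<open>auto simp: cl_coeff_finite\<close>)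
    then have "(cl_coeff x A)\<^sup>2 \<le> (norm x)\<^sup>2" by (simp add: power2_norm_eq_inner inner_cl_def)
    then show ?thesis by (simp add: abs_le_square_iff[symmetric])
  qed simp
qed simp_all

lemma continuous_on_clI:
  assumes "\<And>s. s \<in> S \<Longrightarrow> f s \<in> clsub m"
    and "\<And>A. A \<subseteq> {1..<m} \<Longrightarrow> continuous_on S (\<lambda>s. cl_coeff (f s) A)"
  shows "continuous_on S f"
proof -
  have "continuous_on S (\<lambda>s. \<Sum>A\<in>Pow {1..<m}. cl_coeff (f s) A *\<^sub>R cl_basis A)"
    using assms(2) by (intro continuous_intros) auto
  moreover have "f s = (\<Sum>A\<in>Pow {1..<m}. cl_coeff (f s) A *\<^sub>R cl_basis A)" if "s \<in> S" for s
    using assms(1)[OF that] by (intro cl_expand) (auto simp: clsub_def)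
  ultimately show ?thesis by (metis (no_types, lifting) continuous_on_cong)
qed

lemma continuous_on_cl_mult:
  assumes "\<And>s. s \<in> S \<Longrightarrow> f s \<in> clsub m" "\<And>s. s \<in> S \<Longrightarrow> g s \<in> clsub m"
    and "continuous_on S f" "continuous_on S g"
  shows "continuous_on S (\<lambda>s. f s * g s)"
proof (rule continuous_on_clI[where m = m])
  fix C
  have "continuous_on S (\<lambda>s. \<Sum>A\<in>Pow {1..<m}. cl_sign A (symdiff A C) * cl_coeff (f s) A * cl_coeff (g s) (symdiff A C))"
    using assms(3,4) by (intro continuous_intros bounded_linear.continuous_on[OF bounded_linear_cl_coeff])
  moreover have "cl_coeff (f s * g s) C = (\<Sum>A\<in>Pow {1..<m}. cl_sign A (symdiff A C) * cl_coeff (f s) A * cl_coeff (g s) (symdiff A C))"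
    if "s \<in> S" for s
    using assms(1)[OF that] by (intro cl_coeff_times_supset) (auto simp: clsub_def)
  ultimately show "continuous_on S (\<lambda>s. cl_coeff (f s * g s) C)" by (metis (no_types, lifting) continuous_on_cong)
qed (use assms clsub_mult in auto)

text \<open>\<open>parallel_along\<close> only asks for a derivative in the ambient type; this keeps
  the acceleration of a geodesic in Minkowski space. Membership means that certain coefficients
  vanish, and a coefficient that is constantly zero has derivative zero.\<close>

lemma paravectors_has_vector_derivative:
  assumes "\<And>t. f t \<in> paravectors m" "(f has_vector_derivative f') (at t)"
  shows "f' \<in> paravectors m"
  unfolding paravectors_iff
proof (intro allI impI)
  fix A assume A: "cl_coeff f' A \<noteq> 0"
  have d: "((\<lambda>t. cl_coeff (f t) A) has_vector_derivative cl_coeff f' A) (at t)"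
    by (rule bounded_linear.has_vector_derivative[OF bounded_linear_cl_coeff assms(2)])
  show "A = {} \<or> (\<exists>j\<in>{1..<m}. A = {j})"
  proof (rule ccontr)
    assume "\<not> ?thesis"
    then have "(\<lambda>t. cl_coeff (f t) A) = (\<lambda>_. 0)" using assms(1) unfolding paravectors_iff by blast
    then show False using d A vector_derivative_unique_at[OF d] by (metis has_vector_derivative_const)
  qed
qed

text \<open>The pairing \<open>inner (f s) (g s)\<close> is continuous with values in {1, -1}, hence
  constant. This takes the place of path lifting in the double cover: two continuous lifts of the
  same frames differ by a single sign.\<close>

lemma connected_sign_constant:
  fixes f g :: "'a :: topological_space \<Rightarrow> cl"
  assumes "connected S" "continuous_on S f" "continuous_on S g"
    and "\<And>s. s \<in> S \<Longrightarrow> inner (g s) (g s) = 1" "\<And>s. s \<in> S \<Longrightarrow> f s = g s \<or> f s = - g s"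
  shows "(\<forall>s\<in>S. f s = g s) \<or> (\<forall>s\<in>S. f s = - g s)"
proof -
  let ?h = "\<lambda>s. inner (f s) (g s)"
  have h: "?h s = 1 \<or> ?h s = -1" if "s \<in> S" for s using assms(4,5)[OF that] by fastforce
  have "connected (?h ` S)" using assms by (intro connected_continuous_image continuous_intros)
  moreover have "finite (?h ` S)"
  proof (rule finite_subset)
    show "?h ` S \<subseteq> {1, -1}" using h by blast
  qed simp
  ultimately have "?h ` S = {} \<or> (\<exists>c. ?h ` S = {c})" by (rule connected_finite_iff_sing[THEN iffD1])
  then obtain c where c: "\<And>s. s \<in> S \<Longrightarrow> ?h s = c" by blast
  have "f s = inner (f s) (g s) *\<^sub>R g s" if "s \<in> S" for s
    using assms(4,5)[OF that] by fastforce
  then have *: "f s = c *\<^sub>R g s" if "s \<in> S" for s using c that by simp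
  show ?thesis
  proof (cases "S = {}")
    case False
    then have "c = 1 \<or> c = -1" using h c by blast
    then show ?thesis using * by auto
  qed simp
qed

section \<open>Minkowski space, the coframe and null vectors\<close>

lemma mform_inner: "mform u v = fst u * fst v - inner (snd u) (snd v)"
  by (cases u; cases v) (auto simp: inner_prod_def)

lemma mform_commute: "mform u v = mform v u"
  by (simp add: mform_inner inner_commute mult.commute)

lemma mform_linear [simp]:
  "mform (u + v) w = mform u w + mform v w" "mform w (u + v) = mform w u + mform w v"
  "mform (u - v) w = mform u w - mform v w" "mform w (u - v) = mform w u - mform w v"
  "mform (- u) w = - mform u w" "mform w (- u) = - mform w u"
  "mform (c *\<^sub>R u) w = c * mform u w" "mform w (c *\<^sub>R u) = c * mform w u"
  "mform 0 w = 0" "mform w 0 = 0"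
  by (simp_all add: mform_inner inner_simps algebra_simps)

lemma bounded_bilinear_mform: "bounded_bilinear mform"
proof
  have "norm (mform u v) \<le> norm u * norm v * 2" for u v
  proof -
    have "\<bar>fst u * fst v\<bar> \<le> norm u * norm v"
      using norm_fst_le[of "fst u" "snd u"] norm_fst_le[of "fst v" "snd v"] by (simp add: abs_mult mult_mono)
    moreover have "\<bar>inner (snd u) (snd v)\<bar> \<le> norm (snd u) * norm (snd v)" by (rule Cauchy_Schwarz_ineq2)
    moreover have "norm (snd u) * norm (snd v) \<le> norm u * norm v"
      by (intro mult_mono) (use norm_snd_le[of "snd u" "fst u"] norm_snd_le[of "snd v" "fst v"] in auto)
    ultimately show ?thesis by (simp add: mform_inner)
  qed
  then show "\<exists>K. \<forall>a b. norm (mform a b) \<le> norm a * norm b * K" by blast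
qed simp_all

lemmas mform_has_vector_derivative = bounded_bilinear.has_vector_derivative[OF bounded_bilinear_mform]
lemmas continuous_on_mform = bounded_bilinear.continuous_on[OF bounded_bilinear_mform]

lemma minkowski_iff: "u \<in> minkowski n \<longleftrightarrow> snd (snd u) \<in> paravectors (n + 1)"
  by (cases u) (auto simp: minkowski_def)

lemma minkowski_linear:
  "u \<in> minkowski n \<Longrightarrow> v \<in> minkowski n \<Longrightarrow> u + v \<in> minkowski n"
  "u \<in> minkowski n \<Longrightarrow> v \<in> minkowski n \<Longrightarrow> u - v \<in> minkowski n"
  "u \<in> minkowski n \<Longrightarrow> c *\<^sub>R u \<in> minkowski n" "u \<in> minkowski n \<Longrightarrow> - u \<in> minkowski n" "0 \<in> minkowski n"
  by (auto simp: minkowski_iff paravectors_linear)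

lemma tangent_hyp_iff: "u \<in> tangent_hyp n q \<longleftrightarrow> u \<in> minkowski n \<and> mform u q = 0"
  by (simp add: tangent_hyp_def)

lemma tangent_hyp_linear:
  "u \<in> tangent_hyp n q \<Longrightarrow> v \<in> tangent_hyp n q \<Longrightarrow> u + v \<in> tangent_hyp n q"
  "u \<in> tangent_hyp n q \<Longrightarrow> v \<in> tangent_hyp n q \<Longrightarrow> u - v \<in> tangent_hyp n q"
  "u \<in> tangent_hyp n q \<Longrightarrow> c *\<^sub>R u \<in> tangent_hyp n q" "u \<in> tangent_hyp n q \<Longrightarrow> - u \<in> tangent_hyp n q"
  "0 \<in> tangent_hyp n q"
  by (auto simp: tangent_hyp_iff minkowski_linear)

lemma hypD:
  assumes "q \<in> hyp n"
  shows "q \<in> minkowski n" "mform q q = 1" "fst q > 0" "norm (snd q) < fst q"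
proof -
  show "q \<in> minkowski n" "mform q q = 1" "fst q > 0" using assms by (auto simp: hyp_def)
  then have "(norm (snd q))\<^sup>2 < (fst q)\<^sup>2" by (simp add: mform_inner power2_norm_eq_inner) (simp add: power2_eq_square)
  then show "norm (snd q) < fst q" using \<open>fst q > 0\<close> by (simp add: power2_less_imp_less)
qed

text \<open>On hyperbolic space T - Z is 1 / z, whence the name; on all vectors it is a linear
  light-cone coordinate, with T + Z as the other one.\<close>

definition height_inv :: "mvec \<Rightarrow> real" where "height_inv q = fst q - fst (snd q)"

lemma height_inv_pos: "q \<in> hyp n \<Longrightarrow> height_inv q > 0"
  using hypD(4)[of q n] norm_fst_le[of "fst (snd q)" "snd (snd q)"] by (simp add: height_inv_def)

lemma height_inv_linear [simp]:
  "height_inv (u + v) = height_inv u + height_inv v" "height_inv (u - v) = height_inv u - height_inv v"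
  "height_inv (c *\<^sub>R u) = c * height_inv u" "height_inv (- u) = - height_inv u"
  by (simp_all add: height_inv_def algebra_simps)

lemma mform_light: 
  "mform u v = (height_inv u * (fst v + fst (snd v)) + height_inv v * (fst u + fst (snd u))) / 2
    - inner (snd (snd u)) (snd (snd v))"
  by (simp add: mform_inner height_inv_def inner_prod_def field_simps)

lemma hyp_light: "q \<in> hyp n \<Longrightarrow> height_inv q * (fst q + fst (snd q)) = 1 + inner (snd (snd q)) (snd (snd q))"
  using hypD(2)[of q n] by (simp add: mform_light)

text \<open>The closed form of \<open>coframe\<close>, obtained by differentiating
  \<open>to_uhs\<close>. It is linear in \<open>u\<close> and defined for arbitrary vectors, so it
  can be evaluated separately on null vectors and on \<open>q\<close> itself.\<close>

definition cof :: "nat \<Rightarrow> mvec \<Rightarrow> mvec \<Rightarrow> cl" where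
  "cof n q u = snd (snd u) - (height_inv u / height_inv q) *\<^sub>R (snd (snd q) + gen (n + 1))"

lemma to_uhs_has_derivative:
  assumes "height_inv q \<noteq> 0"
  shows "(to_uhs has_derivative (\<lambda>u. (- (height_inv u) / (height_inv q)\<^sup>2,
    (1 / height_inv q) *\<^sub>R snd (snd u) - (height_inv u / (height_inv q)\<^sup>2) *\<^sub>R snd (snd q)))) (at q)"
proof -
  have eq: "to_uhs = (\<lambda>q. (1 / height_inv q, (1 / height_inv q) *\<^sub>R snd (snd q)))"
    by (auto simp: fun_eq_iff height_inv_def inverse_eq_divide)
  have h: "(height_inv has_derivative height_inv) (at q)"
    unfolding height_inv_def[abs_def] by (auto intro!: derivative_eq_intros)
  have d: "((\<lambda>q. 1 / height_inv q) has_derivative (\<lambda>u. - (height_inv u) / (height_inv q)\<^sup>2)) (at q)"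
    using assms by (auto intro!: derivative_eq_intros h simp: power2_eq_square field_simps)
  have s: "((\<lambda>q. snd (snd q)) has_derivative (\<lambda>u. snd (snd u))) (at q)"
    by (auto intro!: derivative_eq_intros)
  show ?thesis
    unfolding eq
    by (rule has_derivative_eq_rhs[OF has_derivative_Pair[OF d has_derivative_scaleR[OF d s]]])
      (auto simp: fun_eq_iff)
qed

lemma coframe_eq_cof:
  assumes "q \<in> hyp n"
  shows "coframe n q u = cof n q u"
proof -
  have r: "height_inv q > 0" using height_inv_pos[OF assms] .
  have f: "fst (to_uhs q) = 1 / height_inv q" by (cases q) (simp add: height_inv_def)
  have "coframe n q u = height_inv q *\<^sub>R ((1 / height_inv q) *\<^sub>R snd (snd u) - (height_inv u / (height_inv q)\<^sup>2) *\<^sub>R snd (snd q)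
      + (- (height_inv u) / (height_inv q)\<^sup>2) *\<^sub>R gen (n + 1))"
    using r unfolding coframe_def f
    by (subst frechet_derivative_at[OF to_uhs_has_derivative, symmetric]) auto
  also have "\<dots> = cof n q u"
    using r by (simp add: cof_def scaleR_right_distrib scaleR_right_diff_distrib power2_eq_square)
  finally show ?thesis .
qed

lemma cof_linear [simp]:
  "cof n q (u + v) = cof n q u + cof n q v" "cof n q (u - v) = cof n q u - cof n q v"
  "cof n q (c *\<^sub>R u) = c *\<^sub>R cof n q u" "cof n q (- u) = - cof n q u"
  by (simp_all add: cof_def scaleR_right_distrib scaleR_right_diff_distrib scaleR_left_distrib
    scaleR_left_diff_distrib add_divide_distrib diff_divide_distrib algebra_simps)

lemma inner_gen_paravector: assumes "v \<in> paravectors m" "m \<le> j" shows "inner (gen j) v = 0" "inner v (gen j) = 0"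
proof -
  have "inner (gen j) v = cl_coeff v {j}"
    unfolding gen_def by (subst inner_cl_supset[of "{{j}}"]) auto
  moreover have "cl_coeff v {j} = 0" using assms by (fastforce simp: paravectors_iff)
  ultimately show "inner (gen j) v = 0" by simp
  then show "inner v (gen j) = 0" by (simp add: inner_commute)
qed

lemma inner_gen_self [simp]: "inner (gen j) (gen j) = 1"
  by (simp add: inner_gen)

lemma paravectors_Suc_I: "v \<in> paravectors (n + 1) \<Longrightarrow> v \<in> paravectors (n + 2)"
  using paravectors_mono[of "n + 1" "n + 2"] by auto

lemma cof_paravector:
  assumes "q \<in> hyp n" "u \<in> minkowski n"
  shows "cof n q u \<in> paravectors (n + 2)"
  unfolding cof_def using assms(2) hypD(1)[OF assms(1)] unfolding minkowski_iff
  by (intro paravectors_linear gen_in_paravectors paravectors_Suc_I) simp_all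

text \<open>Tangency and the equation of the hyperboloid express all products with \<open>?X\<close>
  through light-cone coordinates; after substitution the terms combine to the form on
  \<open>u\<close> and \<open>v\<close>.\<close>

lemma cof_isometry:
  assumes q: "q \<in> hyp n" and u: "u \<in> tangent_hyp n q" and v: "v \<in> tangent_hyp n q"
  shows "inner (cof n q u) (cof n q v) = - mform u v"
proof -
  let ?r = "height_inv q" and ?X = "snd (snd q)" and ?U = "snd (snd u)" and ?V = "snd (snd v)"
  have r: "?r > 0" using height_inv_pos[OF q] .
  have para: "?X \<in> paravectors (n + 1)" "?U \<in> paravectors (n + 1)" "?V \<in> paravectors (n + 1)"
    using hypD(1)[OF q] u v by (auto simp: tangent_hyp_iff minkowski_iff)
  note g = inner_gen_paravector[OF para(1), of "n + 1", simplified] inner_gen_paravector[OF para(2), of "n + 1", simplified]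
    inner_gen_paravector[OF para(3), of "n + 1", simplified]
  have X: "inner ?X ?X = ?r * (fst q + fst (snd q)) - 1" using hyp_light[OF q] by simp
  have U: "inner ?U ?X = (height_inv u * (fst q + fst (snd q)) + ?r * (fst u + fst (snd u))) / 2"
    using u by (simp add: tangent_hyp_iff mform_light)
  have V: "inner ?X ?V = (height_inv v * (fst q + fst (snd q)) + ?r * (fst v + fst (snd v))) / 2"
    using v by (simp add: tangent_hyp_iff mform_light inner_commute)
  have "inner (cof n q u) (cof n q v) = inner ?U ?V - height_inv v / ?r * inner ?U ?X
      - height_inv u / ?r * inner ?X ?V + height_inv u / ?r * (height_inv v / ?r) * (inner ?X ?X + 1)"
    unfolding cof_def by (simp add: inner_simps g) (use r in \<open>simp add: field_simps\<close>)
  also have "\<dots> = - mform u v"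
    unfolding U V X mform_light[of u v] using r by (simp add: field_simps)
  finally show ?thesis .
qed

lemma cof_eq_0_imp:
  assumes q: "q \<in> hyp n" and u: "u \<in> tangent_hyp n q" and 0: "cof n q u = 0"
  shows "u = 0"
proof -
  have r: "height_inv q > 0" using height_inv_pos[OF q] .
  have para: "snd (snd q) \<in> paravectors (n + 1)" "snd (snd u) \<in> paravectors (n + 1)"
    using hypD(1)[OF q] u by (auto simp: tangent_hyp_iff minkowski_iff)
  have "inner (cof n q u) (gen (n + 1)) = - (height_inv u / height_inv q)"
    unfolding cof_def using inner_gen_paravector[OF para(1), of "n + 1"] inner_gen_paravector[OF para(2), of "n + 1"]
    by (simp add: inner_simps)
  then have h: "height_inv u = 0" using 0 r by simp
  then have U: "snd (snd u) = 0" using 0 by (simp add: cof_def)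
  have "height_inv q * (fst u + fst (snd u)) = 0"
    using u h U by (simp add: tangent_hyp_iff mform_light)
  then show ?thesis using r h U by (auto simp: height_inv_def prod_eq_iff)
qed

lemma cof_inj:
  assumes "q \<in> hyp n" "u \<in> tangent_hyp n q" "v \<in> tangent_hyp n q" "cof n q u = cof n q v"
  shows "u = v"
  using cof_eq_0_imp[OF assms(1) tangent_hyp_linear(2)[OF assms(2,3)]] assms(4) by simp

lemma tangent_null_eq_0:
  assumes "q \<in> hyp n" "u \<in> tangent_hyp n q" "mform u u = 0"
  shows "u = 0"
  using cof_isometry[OF assms(1,2,2)] assms(3) cof_eq_0_imp[OF assms(1,2)] by simp

lemma paravector_split:
  assumes "U \<in> paravectors (n + 2)"
  obtains c V where "V \<in> paravectors (n + 1)" "U = V + c *\<^sub>R gen (n + 1)"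
proof -
  have "insert 1 (gen ` {1..<n + 2}) = insert (gen (n + 1)) (insert 1 (gen ` {1..<n + 1}))"
    by (auto simp: less_Suc_eq)
  then have "U \<in> span (insert (gen (n + 1)) (insert 1 (gen ` {1..<n + 1})))"
    using assms by (simp add: paravectors_def)
  then obtain c where "U - c *\<^sub>R gen (n + 1) \<in> paravectors (n + 1)"
    unfolding paravectors_def span_insert[of "gen (n + 1)"] by blast
  then show ?thesis by (intro that[of "U - c *\<^sub>R gen (n + 1)" c]) auto
qed

lemma cof_surj:
  assumes q: "q \<in> hyp n" and U: "U \<in> paravectors (n + 2)"
  shows "\<exists>u \<in> tangent_hyp n q. cof n q u = U"
proof -
  let ?r = "height_inv q" and ?X = "snd (snd q)"
  obtain c V where V: "V \<in> paravectors (n + 1)" and UV: "U = V + c *\<^sub>R gen (n + 1)"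
    using paravector_split[OF U] .
  have r: "?r > 0" using height_inv_pos[OF q] .
  define W where "W = V - c *\<^sub>R ?X"
  \<comment> \<open>The coefficient of i_(n+1) in \<open>cof\<close> forces T - Z = - c / z;
    \<open>e\<close> is the value of T + Z that makes the vector tangent.\<close>
  define e where "e = (2 * inner W ?X + c * ?r * (fst q + fst (snd q))) / ?r"
  define u where "u = ((e - c * ?r) / 2, (e + c * ?r) / 2, W)"
  have h: "height_inv u = - c * ?r" and e: "fst u + fst (snd u) = e" and W: "snd (snd u) = W"
    by (auto simp: u_def height_inv_def field_simps)
  have "?X \<in> paravectors (n + 1)" using hypD(1)[OF q] by (simp add: minkowski_iff)
  then have "u \<in> minkowski n" unfolding minkowski_iff W W_def using V by (intro paravectors_linear)
  moreover have "mform u q = 0"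
    unfolding mform_light h e W using r by (simp add: e_def field_simps)
  moreover have "cof n q u = U"
    unfolding cof_def h W using r by (simp add: W_def UV scaleR_right_distrib)
  ultimately show ?thesis by (auto simp: tangent_hyp_iff)
qed

subsection \<open>Frames under spin frames\<close>

lemma frame_of_eqI:
  assumes "q \<in> hyp n" "u \<in> tangent_hyp n q" "cof n q u = sigma g (std_basis n k)"
  shows "frame_of n (q, g) k = u"
proof -
  have "(THE u. u \<in> tangent_hyp n q \<and> coframe n q u = sigma g (std_basis n k)) = u"
    by (rule the_equality) (use assms cof_inj in \<open>auto simp: coframe_eq_cof\<close>)
  then show ?thesis by simp
qed

lemma frame_of_props:
  assumes "q \<in> hyp n" "g \<in> Spin (n + 2)"
  shows "frame_of n (q, g) k \<in> tangent_hyp n q" "cof n q (frame_of n (q, g) k) = sigma g (std_basis n k)"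
proof -
  have "sigma g (std_basis n k) \<in> paravectors (n + 2)"
    using assms std_basis_paravector by (intro sigma_Gamma) (auto simp: Spin_iff)
  then obtain u where "u \<in> tangent_hyp n q" "cof n q u = sigma g (std_basis n k)"
    using cof_surj[OF assms(1)] by blast
  then show "frame_of n (q, g) k \<in> tangent_hyp n q" "cof n q (frame_of n (q, g) k) = sigma g (std_basis n k)"
    using frame_of_eqI[OF assms(1)] by auto
qed

declare frame_of.simps [simp del]

lemma inner_sigma_Spin: "g \<in> Spin m \<Longrightarrow> inner (sigma g x) (sigma g y) = inner x y"
  using inner_sigma[of g m x y] by (simp add: Spin_iff)

lemma frame_of_orthonormal:
  assumes "q \<in> hyp n" "g \<in> Spin (n + 2)" "k \<le> n + 1" "l \<le> n + 1"
  shows "mform (frame_of n (q, g) k) (frame_of n (q, g) l) = (if k = l then -1 else 0)"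
  using cof_isometry[OF assms(1) frame_of_props(1)[OF assms(1,2)] frame_of_props(1)[OF assms(1,2)], of k l]
    std_basis_orthonormal[OF assms(3,4)] inner_sigma_Spin[OF assms(2)]
  by (auto simp: frame_of_props(2)[OF assms(1,2)])

lemma sigma_Spin_surj:
  assumes "g \<in> Spin m" "v \<in> paravectors m"
  obtains w where "w \<in> paravectors m" "v = sigma g w"
proof
  show "sigma (cl_conj g) v \<in> paravectors m"
    using assms Spin_conj[OF assms(1)] by (intro sigma_Gamma) (auto simp: Spin_iff)
  show "v = sigma g (sigma (cl_conj g) v)"
    by (simp add: sigma_mult[symmetric] Spin_inverse[OF assms(1)])
qed

lemma tangent_eq_0_of_frame:
  assumes q: "q \<in> hyp n" and g: "g \<in> Spin (n + 2)" and u: "u \<in> tangent_hyp n q"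
    and 0: "\<And>k. k \<le> n + 1 \<Longrightarrow> mform u (frame_of n (q, g) k) = 0"
  shows "u = 0"
proof -
  have "cof n q u \<in> paravectors (n + 2)" using cof_paravector[OF q] u by (simp add: tangent_hyp_iff)
  then obtain w where w: "w \<in> paravectors (n + 2)" "cof n q u = sigma g w"
    using sigma_Spin_surj[OF g] by blast
  have "inner w (std_basis n k) = 0" if "k \<le> n + 1" for k
  proof -
    have "inner (sigma g w) (sigma g (std_basis n k)) = 0"
      using cof_isometry[OF q u frame_of_props(1)[OF q g], of k] 0[OF that]
      by (simp add: frame_of_props(2)[OF q g] w(2))
    then show ?thesis by (simp add: inner_sigma_Spin[OF g])
  qed
  then have "w = 0" using paravector_expand[OF w(1)] by (simp del: sum.atMost_Suc)
  then show ?thesis using cof_eq_0_imp[OF q u] w(2) by simp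
qed

lemma spin_frame_unique:
  assumes "q \<in> hyp n" "g \<in> Spin (n + 2)" "h \<in> Spin (n + 2)"
    and "\<And>k. k \<le> n + 1 \<Longrightarrow> frame_of n (q, g) k = frame_of n (q, h) k"
  shows "g = h \<or> g = - h"
proof (rule sigma_eq_imp[OF assms(2,3)])
  fix v assume v: "v \<in> paravectors (n + 2)"
  show "sigma g v = sigma h v"
  proof (rule sigma_eq_on_std_basis[OF _ v])
    fix k assume "k \<le> n + 1"
    then show "sigma g (std_basis n k) = sigma h (std_basis n k)"
      using assms(4)[of k] frame_of_props(2)[OF assms(1,2), of k] frame_of_props(2)[OF assms(1,3), of k] by simp
  qed
qed

subsection \<open>The light cone\<close>

lemma light_coneD:
  assumes "p \<in> light_cone n"
  shows "p \<in> minkowski n" "mform p p = 0" "fst p > 0" "norm (snd p) = fst p"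
proof -
  show "p \<in> minkowski n" "mform p p = 0" "fst p > 0" using assms by (auto simp: light_cone_def)
  then have "(norm (snd p))\<^sup>2 = (fst p)\<^sup>2" by (simp add: mform_inner power2_norm_eq_inner) (simp add: power2_eq_square)
  then show "norm (snd p) = fst p" using \<open>fst p > 0\<close> by (simp add: power2_eq_iff_nonneg)
qed

lemma mform_hyp_light_pos:
  assumes "q \<in> hyp n" "p \<in> light_cone n"
  shows "mform q p > 0"
proof -
  have "inner (snd q) (snd p) \<le> norm (snd q) * fst p"
    using norm_cauchy_schwarz[of "snd q" "snd p"] light_coneD(4)[OF assms(2)] by simp
  also have "\<dots> < fst q * fst p"
    using hypD[OF assms(1)] light_coneD(3)[OF assms(2)] by simp
  finally show ?thesis by (simp add: mform_inner)
qed

text \<open>Cauchy-Schwarz for the space parts, whose norms equal the time components; the equality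
  case makes the vectors proportional.\<close>

lemma mform_light_light:
  assumes "p \<in> light_cone n" "p' \<in> light_cone n"
  shows "mform p p' \<ge> 0" "mform p p' = 0 \<Longrightarrow> p' = (fst p' / fst p) *\<^sub>R p"
proof -
  note p = light_coneD[OF assms(1)] light_coneD[OF assms(2)]
  show "mform p p' \<ge> 0"
    using norm_cauchy_schwarz[of "snd p" "snd p'"] p by (simp add: mform_inner)
  assume "mform p p' = 0"
  then have "inner (snd p) (snd p') = norm (snd p) * norm (snd p')" using p by (simp add: mform_inner)
  then have "fst p *\<^sub>R snd p' = fst p' *\<^sub>R snd p" using norm_cauchy_schwarz_eq p by metis
  then have "(1 / fst p) *\<^sub>R (fst p *\<^sub>R snd p') = (1 / fst p) *\<^sub>R (fst p' *\<^sub>R snd p)" by simp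
  then have "snd p' = (fst p' / fst p) *\<^sub>R snd p" using p by simp
  then show "p' = (fst p' / fst p) *\<^sub>R p" using p by (simp add: prod_eq_iff)
qed

text \<open>Pairing with a point of hyperbolic space decides the sign of T: a null vector with T <=
  0 cannot pair positively with it.\<close>

lemma light_coneI:
  assumes q: "q \<in> hyp n" and a: "a \<in> minkowski n" "mform a a = 0" "mform a q > 0"
  shows "a \<in> light_cone n"
proof -
  have "(norm (snd a))\<^sup>2 = (fst a)\<^sup>2" using a by (simp add: mform_inner power2_norm_eq_inner) (simp add: power2_eq_square)
  then have "norm (snd a) = fst a \<or> norm (snd a) = - fst a" by (simp add: power2_eq_iff)
  then have n: "norm (snd a) = \<bar>fst a\<bar>" using norm_ge_zero[of "snd a"] by linarith
  have "fst a > 0"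
  proof (rule ccontr)
    assume *: "\<not> fst a > 0"
    have "inner (snd a) (snd q) \<ge> - (norm (snd a) * norm (snd q))"
      using Cauchy_Schwarz_ineq2[of "snd a" "snd q"] by linarith
    moreover have "norm (snd a) * norm (snd q) \<le> (- fst a) * fst q"
      using * n hypD(4)[OF q] by (intro mult_mono) auto
    ultimately show False using a(3) by (simp add: mform_inner)
  qed
  then show ?thesis using a by (simp add: light_cone_def)
qed

section \<open>The spin frame of a column\<close>

definition uhs_point :: "nat \<Rightarrow> mvec \<Rightarrow> cl" where
  "uhs_point n q = (1 / height_inv q) *\<^sub>R (snd (snd q) + gen (n + 1))"

text \<open>If the matrix \<open>A\<close> with first column \<open>\<kappa>\<close> acts on the upper half-space, then \<open>col_eval n \<kappa> q\<close>
  is, up to the reversal \<open>cl_star\<close>, the inverse of the automorphy factor of \<open>A\<close> at the preimage of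
  \<open>q\<close>. So \<open>spin_of n \<kappa>\<close> is the push-forward by \<open>A\<close> of the standard spin frame.\<close>

definition col_eval :: "nat \<Rightarrow> column \<Rightarrow> mvec \<Rightarrow> cl" where
  "col_eval n \<kappa> q = fst \<kappa> - uhs_point n q * snd \<kappa>"

definition spin_of :: "nat \<Rightarrow> column \<Rightarrow> mvec \<Rightarrow> cl" where
  "spin_of n \<kappa> q = (1 / norm (col_eval n \<kappa> q)) *\<^sub>R col_eval n \<kappa> q"

lemma hyp_paravector: "q \<in> hyp n \<Longrightarrow> snd (snd q) \<in> paravectors (n + 1)"
  using hypD(1) by (simp add: minkowski_iff)

lemma uhs_point_paravector: "q \<in> hyp n \<Longrightarrow> uhs_point n q \<in> paravectors (n + 2)"
  unfolding uhs_point_def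
  by (intro paravectors_linear gen_in_paravectors paravectors_Suc_I hyp_paravector) simp_all

lemma cof_uhs_point: "cof n q u = snd (snd u) - height_inv u *\<^sub>R uhs_point n q"
  by (simp add: cof_def uhs_point_def)

lemma inner_uhs_point:
  assumes "q \<in> hyp n"
  shows "inner (uhs_point n q) (uhs_point n q) = (fst q + fst (snd q)) / height_inv q"
    "v \<in> paravectors (n + 1) \<Longrightarrow> inner (uhs_point n q) v = inner (snd (snd q)) v / height_inv q"
    "inner (uhs_point n q) (gen (n + 1)) = 1 / height_inv q"
proof -
  note g = inner_gen_paravector[OF hyp_paravector[OF assms], of "n + 1", simplified]
  have "inner (uhs_point n q) (uhs_point n q) = (inner (snd (snd q)) (snd (snd q)) + 1) / (height_inv q * height_inv q)"
    by (simp add: uhs_point_def inner_simps g add_divide_distrib)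
  also have "\<dots> = (height_inv q * (fst q + fst (snd q))) / (height_inv q * height_inv q)"
    using hyp_light[OF assms] by (simp add: add.commute)
  finally show "inner (uhs_point n q) (uhs_point n q) = (fst q + fst (snd q)) / height_inv q"
    using height_inv_pos[OF assms] by simp
  show "inner (uhs_point n q) v = inner (snd (snd q)) v / height_inv q" if "v \<in> paravectors (n + 1)"
    using inner_gen_paravector[OF that, of "n + 1"] by (simp add: uhs_point_def inner_simps)
  show "inner (uhs_point n q) (gen (n + 1)) = 1 / height_inv q"
    using g by (simp add: uhs_point_def inner_simps)
qed

section \<open>Columns and their null vectors\<close>

lemma Gamma0_norm:
  assumes "x \<in> Gamma0 m"
  shows "x * cl_conj x = of_real (inner x x)" "cl_conj x * x = of_real (inner x x)"
  using assms by (auto simp: Gamma0_def Gamma_norm)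

lemma Gamma0_clsub: "x \<in> Gamma0 m \<Longrightarrow> x \<in> clsub m"
  by (auto simp: Gamma0_def Gamma_clsub)

text \<open>For nonzero \<eta>, \<open>a\<close> is \<xi> times the inverse of \<eta>. Geometrically
  it is the centre of the horosphere as a boundary point of the upper half-space; the other case is
  the centre at infinity.\<close>

lemma SGamma_cases:
  assumes "\<kappa> \<in> SGamma m"
  obtains s where "s \<in> Gamma m" "\<kappa> = (s, 0)"
  | a s where "a \<in> paravectors m" "s \<in> Gamma m" "\<kappa> = (a * s, s)"
proof -
  obtain x y where k: "\<kappa> = (x, y)" "x \<in> Gamma0 m" "y \<in> Gamma0 m" "(x, y) \<noteq> (0, 0)" "x * cl_conj y \<in> paravectors m"
    using assms by (auto simp: SGamma_def)
  show ?thesis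
  proof (cases "y = 0")
    case True
    then show ?thesis using k that(1)[of x] by (auto simp: Gamma0_def)
  next
    case False
    then have y: "y \<in> Gamma m" using k by (simp add: Gamma0_def)
    define a where "a = (1 / inner y y) *\<^sub>R (x * cl_conj y)"
    have "a * y = x" using Gamma_norm[OF y] by (simp add: a_def mult.assoc cl_times_of_real)
    moreover have "a \<in> paravectors m" unfolding a_def using k by (intro paravectors_linear)
    ultimately show ?thesis using that(2)[of a y] k(1) y by simp
  qed
qed

lemma SGammaI1: "s \<in> Gamma m \<Longrightarrow> (s, 0) \<in> SGamma m"
  using Gamma_norm(3) by (auto simp: SGamma_def Gamma0_def paravectors_linear)

lemma inj_mink_matrix: "inj mink_matrix"
proof (rule injI)
  fix u v assume "mink_matrix u = mink_matrix v"
  then show "u = v" by (cases u; cases v) (auto simp: of_real_eq_iff simp del: of_real_add of_real_diff of_real_divide)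
qed

lemma vec_of_matrix_eqI: "mink_matrix v = M \<Longrightarrow> vec_of_matrix M = v"
  unfolding vec_of_matrix_def using the_inv_f_f[OF inj_mink_matrix] by blast

lemma null_vec_eq:
  assumes "(x, y) \<in> SGamma m"
  shows "null_vec (x, y) = (inner x x + inner y y, inner x x - inner y y, 2 *\<^sub>R (x * cl_conj y))"
proof -
  have "x \<in> Gamma0 m" "y \<in> Gamma0 m" using assms by (auto simp: SGamma_def)
  note n = Gamma0_norm(1)[OF this(1)] Gamma0_norm(1)[OF this(2)]
  show ?thesis
    unfolding null_vec_def
    by (rule vec_of_matrix_eqI) (simp add: n cl_conj_mult del: of_real_add of_real_diff of_real_divide)
qed

lemma null_vec_special:
  assumes "s \<in> Gamma m"
  shows "null_vec (s, 0) = inner s s *\<^sub>R (1, 1, 0)"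
    "a \<in> paravectors m \<Longrightarrow> (a * s, s) \<in> SGamma m"
    "a \<in> paravectors m \<Longrightarrow> null_vec (a * s, s) = inner s s *\<^sub>R (inner a a + 1, inner a a - 1, 2 *\<^sub>R a)"
proof -
  show "null_vec (s, 0) = inner s s *\<^sub>R (1, 1, 0)"
    using null_vec_eq[OF SGammaI1[OF assms]] by simp
  assume a: "a \<in> paravectors m"
  have as: "a * s * cl_conj s = inner s s *\<^sub>R a"
    by (simp add: mult.assoc Gamma_norm[OF assms] cl_times_of_real)
  have "a * s \<in> Gamma0 m"
    using a assms by (cases "a = 0") (auto simp: Gamma0_def intro: Gamma.intros)
  then show k: "(a * s, s) \<in> SGamma m"
    using a assms Gamma_norm(3)[OF assms] by (auto simp: SGamma_def Gamma0_def as paravectors_linear)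
  have "inner (a * s) (a * s) = inner s s * inner a a" by (rule inner_mult_right_Gamma[OF assms])
  then show "null_vec (a * s, s) = inner s s *\<^sub>R (inner a a + 1, inner a a - 1, 2 *\<^sub>R a)"
    using null_vec_eq[OF k] by (simp add: as distrib_left right_diff_distrib mult.commute)
qed

lemma null_vec_light_cone:
  assumes "\<kappa> \<in> SGamma (n + 1)"
  shows "null_vec \<kappa> \<in> light_cone n"
  using assms
proof (cases rule: SGamma_cases)
  case (1 s)
  then show ?thesis using Gamma_inner_pos[of s]
    by (simp add: null_vec_special light_cone_def minkowski_iff paravectors_linear)
next
  case (2 a s)
  then show ?thesis using Gamma_inner_pos[of s "n + 1"]
    by (auto simp: null_vec_special light_cone_def minkowski_iff paravectors_linear inner_simps algebra_simps
      intro!: mult_pos_pos add_pos_nonneg)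
qed

text \<open>For \<open>(a * s, s)\<close> the value is (a - Q) s, a product of group elements unless
  a = Q, and this is excluded by the norm since (q|p) > 0. The squared norm is z (q|p), hence z on
  the horosphere itself.\<close>

lemma
  assumes k: "\<kappa> \<in> SGamma (n + 1)" and q: "q \<in> hyp n"
  shows inner_col_eval: "inner (col_eval n \<kappa> q) (col_eval n \<kappa> q) = mform q (null_vec \<kappa>) / height_inv q"
    and col_eval_Gamma: "col_eval n \<kappa> q \<in> Gamma (n + 2)"
proof -
  note r = height_inv_pos[OF q] and Q = uhs_point_paravector[OF q]
  have "inner (col_eval n \<kappa> q) (col_eval n \<kappa> q) = mform q (null_vec \<kappa>) / height_inv q
      \<and> col_eval n \<kappa> q \<in> Gamma (n + 2)"
    using k
  proof (cases rule: SGamma_cases)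
    case (1 s)
    have "s \<in> Gamma (n + 2)" using Gamma_mono[of "n + 1" "n + 2"] 1 by simp
    then show ?thesis using 1 r
      by (simp add: col_eval_def null_vec_special mform_light height_inv_def)
  next
    case (2 a s)
    let ?b = "a - uhs_point n q"
    have y: "col_eval n \<kappa> q = ?b * s" by (simp add: col_eval_def 2 algebra_simps)
    have m1: "inner ?b ?b = inner a a - 2 * (inner (snd (snd q)) a / height_inv q) + (fst q + fst (snd q)) / height_inv q"
      using inner_uhs_point(1,2)[OF q] 2(1) by (simp add: inner_simps inner_commute[of a "uhs_point n q"])
    have m2: "mform q (inner a a + 1, inner a a - 1, 2 *\<^sub>R a)
        = height_inv q * inner a a + (fst q + fst (snd q)) - 2 * inner (snd (snd q)) a"
      by (simp add: mform_inner inner_prod_def height_inv_def algebra_simps)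
    have b: "inner ?b ?b = mform q (inner a a + 1, inner a a - 1, 2 *\<^sub>R a) / height_inv q"
      unfolding m1 m2 using r by (simp add: field_simps)
    have pos: "mform q (null_vec \<kappa>) > 0" by (rule mform_hyp_light_pos[OF q null_vec_light_cone[OF k]])
    have eq: "inner (?b * s) (?b * s) = mform q (null_vec \<kappa>) / height_inv q"
      using inner_mult_right_Gamma[OF 2(2), of ?b ?b] b 2 by (simp only: null_vec_special mform_linear times_divide_eq_right)
    then have "?b \<noteq> 0" using pos r by auto
    moreover have "?b \<in> paravectors (n + 2)" using Q paravectors_Suc_I[OF 2(1)] by (intro paravectors_linear)
    ultimately have "?b * s \<in> Gamma (n + 2)"
      using Gamma_mono[of "n + 1" "n + 2" s] 2 by (intro Gamma.mult[OF Gamma.gen]) auto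
    then show ?thesis using y eq by simp
  qed
  then show "inner (col_eval n \<kappa> q) (col_eval n \<kappa> q) = mform q (null_vec \<kappa>) / height_inv q"
    "col_eval n \<kappa> q \<in> Gamma (n + 2)" by auto
qed

lemma spin_of_Spin: "\<kappa> \<in> SGamma (n + 1) \<Longrightarrow> q \<in> hyp n \<Longrightarrow> spin_of n \<kappa> q \<in> Spin (n + 2)"
  unfolding spin_of_def by (intro Gamma_normalize col_eval_Gamma)

lemma sigma_spin_of:
  "sigma (spin_of n \<kappa> q) V = (1 / inner (col_eval n \<kappa> q) (col_eval n \<kappa> q)) *\<^sub>R sigma (col_eval n \<kappa> q) V"
  by (simp add: spin_of_def sigma_scale power2_norm_eq_inner[symmetric] power2_eq_square)

text \<open>The entries of the column let i_(n+1) pass as in \<open>gen_times_clsub\<close>, but Q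
  contains i_(n+1) itself, and \<open>?i * ?Q\<close> differs from \<open>cl_conj ?Q * ?i\<close> by
  -2 z. This defect is the last term; it becomes the share of the null vector in the normal
  direction.\<close>

lemma gen_times_star_col_eval:
  assumes k: "\<kappa> \<in> SGamma (n + 1)" and q: "q \<in> hyp n"
  shows "gen (n + 1) * cl_star (col_eval n \<kappa> q)
    = cl_conj (col_eval n \<kappa> q) * gen (n + 1) + (2 / height_inv q) *\<^sub>R cl_conj (snd \<kappa>)"
proof -
  let ?i = "gen (n + 1)" and ?Q = "uhs_point n q" and ?X = "snd (snd q)"
  have c: "fst \<kappa> \<in> clsub (n + 1)" "snd \<kappa> \<in> clsub (n + 1)"
    using k Gamma0_clsub by (auto simp: SGamma_def)
  have comm: "?i * cl_star x = cl_conj x * ?i" if "x \<in> clsub (n + 1)" for x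
    using gen_times_clsub[OF clsub_involutions(2)[OF that], of "n + 1"] by (simp add: cl_star_prime)
  have X: "?i * ?X = cl_conj ?X * ?i"
    using gen_times_clsub[of ?X "n + 1" "n + 1"] hyp_paravector[OF q] paravectors_clsub
    by (auto simp: paravector_prime)
  have iQ: "?i * ?Q = cl_conj ?Q * ?i - (2 / height_inv q) *\<^sub>R 1"
  proof -
    have "?i * ?Q = (1 / height_inv q) *\<^sub>R (cl_conj ?X * ?i - 1)"
      by (simp only: uhs_point_def mult_scaleR_right distrib_left X gen_square) simp
    also have "\<dots> = (1 / height_inv q) *\<^sub>R (cl_conj ?X * ?i + 1 - 2 *\<^sub>R 1)"
      by (simp add: scaleR_2)
    also have "\<dots> = (1 / height_inv q) *\<^sub>R (cl_conj ?X * ?i + 1) - (2 / height_inv q) *\<^sub>R 1"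
      by (simp add: scaleR_right_diff_distrib)
    also have "(1 / height_inv q) *\<^sub>R (cl_conj ?X * ?i + 1) = cl_conj ?Q * ?i"
      by (simp add: uhs_point_def left_diff_distrib gen_square)
    finally show ?thesis .
  qed
  have "?i * cl_star (col_eval n \<kappa> q) = cl_conj (fst \<kappa>) * ?i - cl_conj (snd \<kappa>) * (?i * ?Q)"
    using comm[OF c(1)] comm[OF c(2)] paravector_star[OF uhs_point_paravector[OF q]]
    by (simp add: col_eval_def cl_star_mult right_diff_distrib mult.assoc[symmetric])
  also have "\<dots> = cl_conj (col_eval n \<kappa> q) * ?i + (2 / height_inv q) *\<^sub>R cl_conj (snd \<kappa>)"
    unfolding iQ by (simp add: col_eval_def cl_conj_mult algebra_simps)
  finally show ?thesis .
qed

text \<open>The vector \<open>u\<close> is the unit tangent at \<open>q\<close> towards the centre.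
  With y the value of \<open>col_eval\<close>, \<open>cof\<close> sends the null vector to 2 y times
  the conjugate of \<eta>, and \<open>q\<close> to -i_(n+1); these are the two terms that
  \<open>gen_times_star_col_eval\<close> gives for the image of i_(n+1).\<close>

lemma normal_frame_vector:
  assumes k: "\<kappa> \<in> SGamma (n + 1)" and q: "q \<in> hyp n"
  defines "u \<equiv> (1 / mform q (null_vec \<kappa>)) *\<^sub>R null_vec \<kappa> - q"
  shows "u \<in> tangent_hyp n q" "cof n q u = sigma (spin_of n \<kappa> q) (gen (n + 1))"
proof -
  let ?y = "col_eval n \<kappa> q" and ?p = "null_vec \<kappa>" and ?i = "gen (n + 1)"
  note p = light_coneD[OF null_vec_light_cone[OF k]] and r = height_inv_pos[OF q] and hq = hypD[OF q]
  have pos: "mform q ?p > 0" by (rule mform_hyp_light_pos[OF q null_vec_light_cone[OF k]])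
  show "u \<in> tangent_hyp n q"
    using p hq pos by (simp add: u_def tangent_hyp_iff minkowski_linear mform_commute[of ?p q])
  obtain x y where xy: "\<kappa> = (x, y)" by (cases \<kappa>)
  have y0: "y \<in> Gamma0 (n + 1)" using k by (auto simp: SGamma_def xy)
  have "cof n q ?p = 2 *\<^sub>R (?y * cl_conj y)"
    using null_vec_eq[of x y "n + 1"] k Gamma0_norm(1)[OF y0]
    by (simp add: xy cof_uhs_point col_eval_def height_inv_def left_diff_distrib mult.assoc cl_times_of_real
      scaleR_right_diff_distrib)
  moreover have "cof n q q = - ?i"
    using r by (simp add: cof_def)
  ultimately have "cof n q u = (2 / mform q ?p) *\<^sub>R (?y * cl_conj y) + ?i"
    by (simp add: u_def)
  moreover have "sigma ?y ?i = inner ?y ?y *\<^sub>R ?i + (2 / height_inv q) *\<^sub>R (?y * cl_conj y)"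
  proof -
    have "sigma ?y ?i = ?y * (?i * cl_star ?y)" by (simp add: sigma_def mult.assoc)
    also have "\<dots> = (?y * cl_conj ?y) * ?i + (2 / height_inv q) *\<^sub>R (?y * cl_conj y)"
      unfolding gen_times_star_col_eval[OF k q] by (simp add: xy distrib_left mult.assoc)
    finally show ?thesis using Gamma_norm(1)[OF col_eval_Gamma[OF k q]] by (simp add: cl_times_of_real)
  qed
  ultimately show "cof n q u = sigma (spin_of n \<kappa> q) ?i"
    using pos r unfolding sigma_spin_of by (simp add: inner_col_eval[OF k q] scaleR_right_distrib)
qed

text \<open>Modulo the null vector, the frame vectors tangent to the horospheres about a fixed centre do
  not depend on the point.\<close>

lemma tangential_frame_vector:
  assumes k: "\<kappa> \<in> SGamma (n + 1)" and V: "V \<in> paravectors (n + 1)"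
  obtains L where "L \<in> minkowski n"
    "\<And>q. q \<in> hyp n \<Longrightarrow> \<exists>\<rho>. L + \<rho> *\<^sub>R null_vec \<kappa> \<in> tangent_hyp n q \<and>
      cof n q (L + \<rho> *\<^sub>R null_vec \<kappa>) = sigma (spin_of n \<kappa> q) V"
    "\<And>j. V = gen j \<Longrightarrow> \<exists>c c'. c > 0 \<and> flag_vec \<kappa> j = c *\<^sub>R L + c' *\<^sub>R null_vec \<kappa>"
  using k
proof (cases rule: SGamma_cases)
  case (1 s)
  note s = Gamma_inner_pos[OF 1(1)]
  define U where "U = sigma s V"
  have U: "U \<in> paravectors (n + 1)" using sigma_Gamma[OF 1(1) V] by (simp add: U_def)
  let ?L = "(0, 0, (1 / inner s s) *\<^sub>R U)"
  show thesis
  proof (rule that[of ?L])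
    show "?L \<in> minkowski n" using U by (simp add: minkowski_iff paravectors_linear)
  next
    fix q assume q: "q \<in> hyp n"
    note r = height_inv_pos[OF q]
    \<comment> \<open>The solution of (L + \<rho> p|q) = 0. Adding multiples of p does not change
      the coframe value here, as p has T = Z and X = 0.\<close>
    let ?\<rho> = "inner U (snd (snd q)) / (inner s s * inner s s * height_inv q)"
    let ?u = "?L + ?\<rho> *\<^sub>R null_vec \<kappa>"
    have "?u \<in> minkowski n" using U light_coneD(1)[OF null_vec_light_cone[OF k]]
      by (intro minkowski_linear) (simp_all add: minkowski_iff paravectors_linear)
    moreover have "mform ?u q = 0"
    proof -
      have "mform (1, 1, 0) q = height_inv q" "mform ?L q = - (inner U (snd (snd q)) / inner s s)"
        by (simp_all add: mform_inner inner_prod_def height_inv_def)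
      then show ?thesis using s r unfolding 1(2) null_vec_special[OF 1(1)] mform_linear by simp
    qed
    moreover have "cof n q ?u = sigma (spin_of n \<kappa> q) V"
      unfolding sigma_spin_of by (simp add: 1(2) null_vec_special[OF 1(1)] cof_uhs_point col_eval_def U_def height_inv_def)
    ultimately show "\<exists>\<rho>. ?L + \<rho> *\<^sub>R null_vec \<kappa> \<in> tangent_hyp n q \<and>
        cof n q (?L + \<rho> *\<^sub>R null_vec \<kappa>) = sigma (spin_of n \<kappa> q) V"
      by (auto simp: tangent_hyp_iff)
  next
    fix j assume j: "V = gen j"
    have "flag_vec \<kappa> j = (0, 0, 2 *\<^sub>R U)"
      unfolding flag_vec_def
      by (rule vec_of_matrix_eqI) (simp add: 1(2) cl_conj_mult cl_star_mult U_def sigma_def j cl_star_prime mult.assoc)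
    also have "\<dots> = (2 * inner s s) *\<^sub>R ?L + 0 *\<^sub>R null_vec \<kappa>" using s by (simp add: zero_prod_def)
    finally show "\<exists>c c'. c > 0 \<and> flag_vec \<kappa> j = c *\<^sub>R ?L + c' *\<^sub>R null_vec \<kappa>" using s
      by (intro exI[of _ "2 * inner s s"] exI[of _ 0]) simp
  qed
next
  case (2 a s)
  note s = Gamma_inner_pos[OF 2(2)]
  define U where "U = sigma s V"
  have U: "U \<in> paravectors (n + 1)" using sigma_Gamma[OF 2(2) V] by (simp add: U_def)
  note cU = paravector_conj[OF U]
  note sandwich = paravector_sandwich[OF 2(1) U]
  let ?h = "inner a (cl_conj U)"
  \<comment> \<open>The last entry is the term with \<open>cl_conj U\<close> in the sandwich formula
    for (a - Q) U (a - Q); the other term is a multiple of a - Q, to which the coframe value of the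
    null vector is proportional. The equal entries T and Z do not affect the coframe value and make
    L orthogonal to the null vector.\<close>
  let ?L = "(1 / inner s s) *\<^sub>R (- ?h, - ?h, - cl_conj U)"
  show thesis
  proof (rule that[of ?L])
    show "?L \<in> minkowski n" using cU by (simp add: minkowski_iff paravectors_linear)
  next
    fix q assume q: "q \<in> hyp n"
    note r = height_inv_pos[OF q]
    let ?b = "a - uhs_point n q"
    have b: "?b \<in> paravectors (n + 2)"
      using uhs_point_paravector[OF q] paravectors_Suc_I[OF 2(1)] by (intro paravectors_linear)
    have y: "col_eval n \<kappa> q = ?b * s" by (simp add: col_eval_def 2 algebra_simps)
    have yy: "inner (col_eval n \<kappa> q) (col_eval n \<kappa> q) = inner s s * inner ?b ?b"
      unfolding y by (rule inner_mult_right_Gamma[OF 2(2)])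
    have b0: "inner ?b ?b > 0"
      using Gamma_inner_pos[OF col_eval_Gamma[OF k q]] yy s by (simp add: zero_less_mult_iff)
    have pq: "mform (null_vec \<kappa>) q = inner s s * inner ?b ?b * height_inv q"
      using inner_col_eval[OF k q] yy r by (simp add: mform_commute[of _ q])
    have bU: "inner ?b (cl_conj U) = ?h - inner (snd (snd q)) (cl_conj U) / height_inv q"
      using inner_uhs_point(2)[OF q cU] by (simp add: inner_simps)
    \<comment> \<open>Found by matching the multiple of \<open>?b\<close> in the sandwich formula;
      tangency is then checked.\<close>
    let ?\<rho> = "inner ?b (cl_conj U) / (inner s s * inner s s * inner ?b ?b)"
    let ?u = "?L + ?\<rho> *\<^sub>R null_vec \<kappa>"
    have "?u \<in> minkowski n"
      using cU light_coneD(1)[OF null_vec_light_cone[OF k]]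
      by (intro minkowski_linear) (simp_all add: minkowski_iff paravectors_linear)
    moreover have "mform ?u q = 0"
    proof -
      have "mform (- ?h, - ?h, - cl_conj U) q = - height_inv q * inner ?b (cl_conj U)"
      proof -
        have "mform (- ?h, - ?h, - cl_conj U) q = inner (snd (snd q)) (cl_conj U) - height_inv q * ?h"
          by (simp add: mform_inner inner_prod_def height_inv_def algebra_simps inner_commute)
        then show ?thesis unfolding bU using r by (simp add: right_diff_distrib)
      qed
      then show ?thesis unfolding mform_linear pq using s b0 r by (simp add: field_simps)
    qed
    moreover have "cof n q ?u = sigma (spin_of n \<kappa> q) V"
    proof -
      have "sigma (col_eval n \<kappa> q) V = ?b * U * ?b"
        unfolding y sigma_mult U_def[symmetric] by (simp only: sigma_def paravector_star[OF b])
      also have "\<dots> = (2 * inner ?b (cl_conj U)) *\<^sub>R ?b - inner ?b ?b *\<^sub>R cl_conj U"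
        by (rule paravector_sandwich[OF b paravectors_Suc_I[OF U]])
      finally have 1: "sigma (spin_of n \<kappa> q) V =
          (2 * inner ?b (cl_conj U) / (inner s s * inner ?b ?b)) *\<^sub>R ?b - (1 / inner s s) *\<^sub>R cl_conj U"
        unfolding sigma_spin_of yy using s b0 by (simp add: scaleR_right_diff_distrib mult.commute)
      have "cof n q (null_vec \<kappa>) = (2 * inner s s) *\<^sub>R ?b"
        unfolding 2(3) null_vec_special(3)[OF 2(2,1)] cof_linear
        by (simp add: cof_uhs_point height_inv_def scaleR_right_diff_distrib mult.commute)
      moreover have "cof n q (- ?h, - ?h, - cl_conj U) = - cl_conj U"
        by (simp add: cof_uhs_point height_inv_def)
      ultimately show ?thesis unfolding cof_linear 1 using s by (simp add: mult.commute)
    qed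
    ultimately show "\<exists>\<rho>. ?L + \<rho> *\<^sub>R null_vec \<kappa> \<in> tangent_hyp n q \<and>
        cof n q (?L + \<rho> *\<^sub>R null_vec \<kappa>) = sigma (spin_of n \<kappa> q) V"
      by (auto simp: tangent_hyp_iff)
  next
    fix j assume j: "V = gen j"
    \<comment> \<open>By polarisation the diagonal of the flag matrix is -2 \<open>?h\<close>, 2
      \<open>?h\<close>; this gives T = 0 and Z = -4 \<open>?h\<close> below.\<close>
    have a1: "a * U + cl_conj U * cl_conj a = of_real (2 * ?h)"
      using paravector_polar[OF 2(1) cU] by simp
    have a2: "U * a + cl_conj a * cl_conj U = of_real (2 * ?h)"
      using paravector_polar[OF U paravector_conj[OF 2(1)]] inner_involutions(3)[of a "cl_conj U"]
      by (simp add: inner_commute)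
    have c: "cl_conj U = - (cl_prime s * gen j * cl_conj s)"
      by (simp add: U_def sigma_def j cl_conj_mult mult.assoc)
    have e: "s * (gen j * cl_star s) = U" by (simp add: U_def sigma_def j mult.assoc)
    have e': "cl_prime s * (gen j * cl_conj s) = - cl_conj U" by (simp add: c mult.assoc)
    have e2: "s * (gen j * (cl_star s * x)) = U * x" for x using e by (metis mult.assoc)
    have e2': "cl_prime s * (gen j * (cl_conj s * x)) = - cl_conj U * x" for x using e' by (metis mult.assoc)
    note st = paravector_star[OF 2(1)] paravector_prime[OF 2(1)]
    have "flag_vec \<kappa> j = (0, - (4 * ?h), 2 *\<^sub>R (a * U * a - cl_conj U))"
      unfolding flag_vec_def
    proof (rule vec_of_matrix_eqI)
      have "col_dagger_mult \<kappa> (col_scale (check_col \<kappa>) (gen j)) + col_dagger_mult (col_scale (check_col \<kappa>) (gen j)) \<kappa>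
        = ((- (a * U + cl_conj U * cl_conj a), a * U * a - cl_conj U),
           (cl_conj a * cl_conj U * cl_conj a - U, U * a + cl_conj a * cl_conj U))"
        by (simp add: 2(3) cl_conj_mult cl_prime_mult mult.assoc e e' e2 e2' st)
      then show "mink_matrix (0, - (4 * ?h), 2 *\<^sub>R (a * U * a - cl_conj U)) =
          col_dagger_mult \<kappa> (col_scale (check_col \<kappa>) (gen j)) + col_dagger_mult (col_scale (check_col \<kappa>) (gen j)) \<kappa>"
        unfolding a1 a2 by (simp add: cl_conj_mult mult.assoc)
    qed
    \<comment> \<open>The sandwich formula turns the X part into a combination of \<open>a\<close>
      and \<open>cl_conj U\<close>. The coefficient of \<open>a\<close> must come from the null
      vector, that of \<open>cl_conj U\<close> from L.\<close>
    also have "\<dots> = (2 * inner s s * (1 + inner a a)) *\<^sub>R ?L + (2 * ?h / inner s s) *\<^sub>R null_vec \<kappa>"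
      unfolding 2(3) null_vec_special(3)[OF 2(2,1)] sandwich using s
      by (simp add: algebra_simps add_divide_distrib diff_divide_distrib)
    finally show "\<exists>c c'. c > 0 \<and> flag_vec \<kappa> j = c *\<^sub>R ?L + c' *\<^sub>R null_vec \<kappa>"
      using s by (intro exI[of _ "2 * inner s s * (1 + inner a a)"] exI[of _ "2 * ?h / inner s s"] conjI)
        (auto intro!: mult_pos_pos add_pos_nonneg)
  qed
qed

section \<open>Horospheres and geodesics\<close>

lemma horosphere_iff: "q \<in> horosphere n p \<longleftrightarrow> q \<in> hyp n \<and> mform q p = 1"
  by (simp add: horosphere_def)

text \<open>Since p is null and (r|p) = 1, adding c p changes the quadratic form by exactly 2 c, so
  one correction reaches the hyperboloid. The result is on the upper sheet because points of the
  lower sheet pair negatively with p. In effect the horosphere is the affine hyperplane (r|p) = 1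
  modulo p.\<close>

lemma horosphere_correct:
  assumes p: "p \<in> light_cone n" and r: "r \<in> minkowski n" "mform r p = 1"
  shows "r + ((1 - mform r r) / 2) *\<^sub>R p \<in> horosphere n p" (is "?x \<in> _")
proof -
  note pD = light_coneD[OF p]
  have x: "?x \<in> minkowski n" using pD r by (intro minkowski_linear)
  have xp: "mform ?x p = 1" using pD r by simp
  have xx: "mform ?x ?x = 1" 
  proof -
    have "mform (r + c *\<^sub>R p) (r + c *\<^sub>R p) = mform r r + 2 * c * mform r p + c * c * mform p p" for c
      by (simp add: mform_commute[of p r] algebra_simps)
    note eq = this[of "(1 - mform r r) / 2"]
    show ?thesis unfolding eq r(2) pD(2) by (simp add: field_simps)
  qed
  obtain x where [simp]: "?x = x" by simp
  have "fst x > 0"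
  proof (rule ccontr)
    assume neg: "\<not> fst x > 0"
    have "fst x \<noteq> 0"
    proof
      assume "fst x = 0"
      then have "mform x x = - inner (snd x) (snd x)" by (simp add: mform_inner)
      then show False using xx inner_ge_zero[of "snd x"] by simp
    qed
    then have "- x \<in> hyp n" using neg x xx minkowski_linear(4)[OF x] unfolding hyp_def by simp
    then have "mform (- x) p > 0" using mform_hyp_light_pos p by blast
    then show False using xp by simp
  qed
  then show ?thesis using x xx xp by (simp add: horosphere_def hyp_def)
qed

text \<open>The vector (1 / T, 0, 0), with T the time component of p, pairs to 1 with p. It is
  chosen for its explicit continuous dependence on p, which yields a continuous section of the
  pointed horospheres.\<close>

definition horo_point :: "mvec \<Rightarrow> mvec" where
  "horo_point p = (1 / fst p, 0, 0) + ((1 - (1 / fst p)\<^sup>2) / 2) *\<^sub>R p"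

lemma horo_point: "p \<in> light_cone n \<Longrightarrow> horo_point p \<in> horosphere n p"
  using horosphere_correct[of p n "(1 / fst p, 0, 0)"] light_coneD(3)[of p n]
  by (simp add: horo_point_def mform_inner inner_prod_def minkowski_iff paravectors_linear power2_eq_square)

lemma tangential_frame_orthogonal:
  assumes k: "\<kappa> \<in> SGamma (n + 1)" and q: "q \<in> horosphere n (null_vec \<kappa>)"
  shows "frame_of n (q, spin_of n \<kappa> q) 0 = null_vec \<kappa> - q"
    "1 \<le> j \<Longrightarrow> j \<le> n + 1 \<Longrightarrow> mform (frame_of n (q, spin_of n \<kappa> q) j) (null_vec \<kappa>) = 0"
proof -
  have qh: "q \<in> hyp n" and qp: "mform q (null_vec \<kappa>) = 1" using q by (auto simp: horosphere_iff)
  note nf = normal_frame_vector[OF k qh, unfolded qp, simplified]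
  show 0: "frame_of n (q, spin_of n \<kappa> q) 0 = null_vec \<kappa> - q"
    using nf by (intro frame_of_eqI[OF qh]) (auto simp: std_basis_def)
  assume j: "1 \<le> j" "j \<le> n + 1"
  note g = spin_of_Spin[OF k qh]
  have "mform (frame_of n (q, spin_of n \<kappa> q) j) (null_vec \<kappa> - q) = 0"
    using frame_of_orthonormal[OF qh g j(2), of 0] j 0 by simp
  moreover have "mform (frame_of n (q, spin_of n \<kappa> q) j) q = 0"
    using frame_of_props(1)[OF qh g, of j] by (simp add: tangent_hyp_iff)
  ultimately show "mform (frame_of n (q, spin_of n \<kappa> q) j) (null_vec \<kappa>) = 0" by simp
qed

text \<open>Two horospheres that are equal as sets share the points \<open>q\<close> and \<open>q \<plusminus> u + p / 2\<close>, for a unit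
  vector \<open>u\<close> tangent to them at \<open>q\<close>.\<close>

lemma horo_vec_null_vec:
  assumes k: "\<kappa> \<in> SGamma (n + 1)"
  shows "horo_vec n (horosphere n (null_vec \<kappa>)) = null_vec \<kappa>"
  unfolding horo_vec_def
proof (rule the_equality)
  let ?p = "null_vec \<kappa>"
  note p = null_vec_light_cone[OF k]
  show "?p \<in> light_cone n \<and> horosphere n ?p = horosphere n ?p" using p by simp
  fix p' assume "p' \<in> light_cone n \<and> horosphere n ?p = horosphere n p'"
  then have p': "p' \<in> light_cone n" and eq: "horosphere n ?p = horosphere n p'" by auto
  define q where "q = horo_point ?p"
  have q: "q \<in> horosphere n ?p" using horo_point[OF p] by (simp add: q_def)
  then have qh: "q \<in> hyp n" and qp: "mform q ?p = 1" by (auto simp: horosphere_iff)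
  note g = spin_of_Spin[OF k qh]
  \<comment> \<open>The last frame vector is tangent to the horosphere and exists also for n =
    0.\<close>
  define u where "u = frame_of n (q, spin_of n \<kappa> q) (n + 1)"
  have u: "u \<in> tangent_hyp n q" "mform u u = -1" "mform u ?p = 0"
    using frame_of_props(1)[OF qh g] frame_of_orthonormal[OF qh g, of "n + 1" "n + 1"]
      tangential_frame_orthogonal(2)[OF k q, of "n + 1"] by (auto simp: u_def)
  have uq: "mform u q = 0" "mform q u = 0" using u(1) by (auto simp: tangent_hyp_iff mform_commute[of q u])
  have qq: "mform q q = 1" using hypD(2)[OF qh] .
  have mink: "u \<in> minkowski n" "q \<in> minkowski n" using u(1) hypD(1)[OF qh] by (auto simp: tangent_hyp_iff)
  \<comment> \<open>The quadratic form of q + u is 1 - 1 = 0, hence the coefficient 1 / 2.\<close>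
  have 1: "q + u + (1 / 2) *\<^sub>R ?p \<in> horosphere n ?p"
    using horosphere_correct[OF p minkowski_linear(1)[OF mink(2,1)]] uq qq u(2,3) qp by simp
  have 2: "q - u + (1 / 2) *\<^sub>R ?p \<in> horosphere n ?p"
    using horosphere_correct[OF p minkowski_linear(2)[OF mink(2,1)]] uq qq u(2,3) qp by simp
  have qp': "mform q p' = 1" using q eq by (simp add: horosphere_iff)
  \<comment> \<open>The sum of the two equations is 2 (q|p') + (p|p') = 2, and (q|p') = 1; so (p|p')
    = 0 and the null vectors are proportional.\<close>
  have "mform (q + u + (1 / 2) *\<^sub>R ?p) p' = 1" "mform (q - u + (1 / 2) *\<^sub>R ?p) p' = 1"
    using 1 2 unfolding eq by (simp_all only: horosphere_iff)
  then have "mform ?p p' = 0" using qp' by simp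
  then have c: "p' = (fst p' / fst ?p) *\<^sub>R ?p" by (rule mform_light_light(2)[OF p p'])
  then have "fst p' / fst ?p = 1" using qp' qp by (metis mform_linear(8) mult.right_neutral)
  then show "p' = ?p" using c by simp
qed

lemma fst_Phi [simp]: "fst (Phi n \<kappa>) = horosphere n (null_vec \<kappa>)"
  by (simp add: Phi_def Let_def)

lemma centre_null_vec:
  "\<kappa> \<in> SGamma (n + 1) \<Longrightarrow> centre n (horosphere n (null_vec \<kappa>)) = ray (null_vec \<kappa>)"
  by (simp add: centre_def horo_vec_null_vec)

text \<open>The acceleration is normal to the hyperboloid, and differentiating (v|\<gamma>) = 0
  shows that its pairing with \<gamma> is 1; thus the second derivative of \<gamma> is \<gamma>. The
  null vectors A and B point to the ends at t = +infinity and t = -infinity.\<close>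

lemma geodesic_exp:
  assumes "geodesic n \<gamma>"
  obtains A B where "A \<in> light_cone n" "B \<in> light_cone n" "mform A B = 1 / 2"
    "\<And>t. \<gamma> t = exp t *\<^sub>R A + exp (- t) *\<^sub>R B"
    "\<And>t. (\<gamma> has_vector_derivative (exp t *\<^sub>R A - exp (- t) *\<^sub>R B)) (at t)"
proof -
  obtain v v' where h: "\<And>t. \<gamma> t \<in> hyp n" and d: "\<And>t. (\<gamma> has_vector_derivative v t) (at t)"
    and vv: "\<And>t. mform (v t) (v t) = -1" and vt: "\<And>t. v t \<in> tangent_hyp n (\<gamma> t)"
    and d': "\<And>t. (v has_vector_derivative v' t) (at t)"
    and par: "\<And>t u. u \<in> tangent_hyp n (\<gamma> t) \<Longrightarrow> mform (v' t) u = 0"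
    using assms unfolding geodesic_def parallel_along_def by blast
  have snd2: "bounded_linear (\<lambda>u :: mvec. snd (snd u))"
    using bounded_linear_compose[OF bounded_linear_snd bounded_linear_snd] .
  have v'm: "v' t \<in> minkowski n" for t
    unfolding minkowski_iff
  proof (rule paravectors_has_vector_derivative)
    show "snd (snd (v t)) \<in> paravectors (n + 1)" for t
      using vt[of t] by (simp add: tangent_hyp_iff minkowski_iff)
    show "((\<lambda>t. snd (snd (v t))) has_vector_derivative snd (snd (v' t))) (at t)"
      by (rule bounded_linear.has_vector_derivative[OF snd2 d'])
  qed
  have v'\<gamma>: "mform (v' t) (\<gamma> t) = 1" for t
  proof -
    have "((\<lambda>t. mform (v t) (\<gamma> t)) has_vector_derivative (mform (v t) (v t) + mform (v' t) (\<gamma> t))) (at t)"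
      by (rule mform_has_vector_derivative[OF d' d])
    moreover have "(\<lambda>t. mform (v t) (\<gamma> t)) = (\<lambda>t. 0)" using vt by (auto simp: tangent_hyp_iff)
    ultimately have "((\<lambda>t. 0) has_vector_derivative (mform (v t) (v t) + mform (v' t) (\<gamma> t))) (at t)" by simp
    then have "mform (v t) (v t) + mform (v' t) (\<gamma> t) = 0"
      by (rule vector_derivative_unique_at[OF _ has_vector_derivative_const])
    then show ?thesis using vv[of t] by simp
  qed
  have v': "v' t = \<gamma> t" for t
  proof -
    \<comment> \<open>The difference is tangent, hence orthogonal to \<gamma> and, by parallelism,
      to \<open>v'\<close>. So it is orthogonal to itself, and the form is definite on tangent
      spaces.\<close>
    have w: "v' t - \<gamma> t \<in> tangent_hyp n (\<gamma> t)"
      using v'm[of t] hypD(1,2)[OF h[of t]] v'\<gamma>[of t] by (simp add: tangent_hyp_iff minkowski_linear)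
    then have "mform (\<gamma> t) (v' t - \<gamma> t) = 0"
      by (simp only: tangent_hyp_iff mform_commute[of "\<gamma> t" "v' t - \<gamma> t"])
    then have "mform (v' t - \<gamma> t) (v' t - \<gamma> t) = 0"
      using par[OF w] by (simp only: mform_linear(3)[of "v' t" "\<gamma> t" "v' t - \<gamma> t"])
    then show ?thesis using tangent_null_eq_0[OF h w] by simp
  qed
  \<comment> \<open>For e = 1 and e = -1 the combination \<gamma> + e v has derivative e times
    itself; undoing this exponential growth leaves a constant.\<close>
  have const: "\<exists>c. \<forall>t. exp (- e * t) *\<^sub>R (\<gamma> t + e *\<^sub>R v t) = c" if "e * e = 1" for e :: real
  proof -
    have "((\<lambda>t. exp (- e * t) *\<^sub>R (\<gamma> t + e *\<^sub>R v t)) has_vector_derivative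
        (exp (- e * t) *\<^sub>R (v t + e *\<^sub>R \<gamma> t) + (- e * exp (- e * t)) *\<^sub>R (\<gamma> t + e *\<^sub>R v t))) (at t)" for t
      by (rule derivative_eq_intros d d'[unfolded v'] DERIV_exp refl | simp)+
    moreover have "exp (- e * t) *\<^sub>R (v t + e *\<^sub>R \<gamma> t) + (- e * exp (- e * t)) *\<^sub>R (\<gamma> t + e *\<^sub>R v t) = 0" for t
      using that by (simp add: algebra_simps)
    ultimately have 0: "((\<lambda>t. exp (- e * t) *\<^sub>R (\<gamma> t + e *\<^sub>R v t)) has_vector_derivative 0) (at t)" for t by simp
    obtain c where "\<And>t. t \<in> UNIV \<Longrightarrow> exp (- e * t) *\<^sub>R (\<gamma> t + e *\<^sub>R v t) = c"
      by (rule has_vector_derivative_zero_constant[OF convex_UNIV 0]) blast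
    then show ?thesis by blast
  qed
  obtain a where a: "\<And>t. exp (- t) *\<^sub>R (\<gamma> t + v t) = a" using const[of 1] by auto
  obtain b where b: "\<And>t. exp t *\<^sub>R (\<gamma> t - v t) = b" using const[of "-1"] by auto
  have a': "\<gamma> t + v t = exp t *\<^sub>R a" and b': "\<gamma> t - v t = exp (- t) *\<^sub>R b" for t
    using a[of t, symmetric] b[of t, symmetric] by (simp_all add: exp_minus)
  define A B where "A = (1 / 2) *\<^sub>R a" and "B = (1 / 2) *\<^sub>R b"
  have \<gamma>: "\<gamma> t = exp t *\<^sub>R A + exp (- t) *\<^sub>R B" for t
  proof -
    have "exp t *\<^sub>R A + exp (- t) *\<^sub>R B = (1 / 2) *\<^sub>R ((\<gamma> t + v t) + (\<gamma> t - v t))"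
      unfolding a' b' by (simp add: A_def B_def scaleR_right_distrib mult.commute)
    also have "(\<gamma> t + v t) + (\<gamma> t - v t) = 2 *\<^sub>R \<gamma> t" by (simp add: scaleR_2)
    finally show ?thesis by simp
  qed
  have v: "v t = exp t *\<^sub>R A - exp (- t) *\<^sub>R B" for t
  proof -
    have "exp t *\<^sub>R A - exp (- t) *\<^sub>R B = (1 / 2) *\<^sub>R ((\<gamma> t + v t) - (\<gamma> t - v t))"
      unfolding a' b' by (simp add: A_def B_def scaleR_right_diff_distrib mult.commute)
    also have "(\<gamma> t + v t) - (\<gamma> t - v t) = 2 *\<^sub>R v t" by (simp add: scaleR_2)
    finally show ?thesis by simp
  qed
  have A0: "A = (1 / 2) *\<^sub>R (\<gamma> 0 + v 0)" and B0: "B = (1 / 2) *\<^sub>R (\<gamma> 0 - v 0)"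
    using a[of 0] b[of 0] by (simp_all add: A_def B_def)
  have m: "\<gamma> 0 \<in> minkowski n" "v 0 \<in> minkowski n" using hypD(1)[OF h] vt by (auto simp: tangent_hyp_iff)
  have f: "mform (\<gamma> 0) (\<gamma> 0) = 1" "mform (v 0) (v 0) = -1" "mform (v 0) (\<gamma> 0) = 0" "mform (\<gamma> 0) (v 0) = 0"
    using hypD(2)[OF h] vv vt[of 0] by (auto simp: tangent_hyp_iff mform_commute[of "\<gamma> 0" "v 0"])
  have A: "A \<in> light_cone n" by (rule light_coneI[OF h[of 0]]) (auto simp: A0 m f minkowski_linear)
  have B: "B \<in> light_cone n" by (rule light_coneI[OF h[of 0]]) (auto simp: B0 m f minkowski_linear)
  have "mform A B = 1 / 2" by (simp add: A0 B0 f)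
  then show thesis by (rule that[OF A B _ \<gamma> d[unfolded v]])
qed

text \<open>The converse construction. For null A and B the quadratic form of \<gamma> is 2 (A|B),
  which explains the normalisation 1 / 2.\<close>

lemma exp_geodesic:
  assumes A: "A \<in> light_cone n" and B: "B \<in> light_cone n" and AB: "mform A B = 1 / 2"
  defines "\<gamma> \<equiv> \<lambda>t. exp t *\<^sub>R A + exp (- t) *\<^sub>R B"
  shows "\<gamma> t \<in> hyp n" "geodesic n \<gamma>"
    "exp t *\<^sub>R A - exp (- t) *\<^sub>R B \<in> tangent_hyp n (\<gamma> t)"
    "(\<gamma> has_vector_derivative (exp t *\<^sub>R A - exp (- t) *\<^sub>R B)) (at t)"
    "((\<lambda>t. exp t *\<^sub>R A - exp (- t) *\<^sub>R B) has_vector_derivative \<gamma> t) (at t)"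
proof -
  note a = light_coneD[OF A] and b = light_coneD[OF B]
  have BA: "mform B A = 1 / 2" using AB by (simp add: mform_commute)
  have e: "exp t * exp (- t) = (1::real)" "exp (- t) * exp t = (1::real)" for t by (simp_all add: exp_minus)
  show h: "\<gamma> t \<in> hyp n" for t
    using a b by (simp add: hyp_def \<gamma>_def minkowski_linear AB BA e mult.left_commute[of _ "exp _"] add_pos_pos)
  show tan: "exp t *\<^sub>R A - exp (- t) *\<^sub>R B \<in> tangent_hyp n (\<gamma> t)" for t
    using a b by (simp add: tangent_hyp_iff \<gamma>_def minkowski_linear AB BA e)
  show d: "(\<gamma> has_vector_derivative (exp t *\<^sub>R A - exp (- t) *\<^sub>R B)) (at t)" for t
    unfolding \<gamma>_def by (rule derivative_eq_intros DERIV_exp refl | simp)+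
  show d': "((\<lambda>t. exp t *\<^sub>R A - exp (- t) *\<^sub>R B) has_vector_derivative \<gamma> t) (at t)" for t
    unfolding \<gamma>_def by (rule derivative_eq_intros DERIV_exp refl | simp)+
  have "mform (exp t *\<^sub>R A - exp (- t) *\<^sub>R B) (exp t *\<^sub>R A - exp (- t) *\<^sub>R B) = -1" for t
    using a b by (simp add: AB BA e)
  then show "geodesic n \<gamma>"
    unfolding geodesic_def parallel_along_def
    by (intro exI[of _ "\<lambda>t. exp t *\<^sub>R A - exp (- t) *\<^sub>R B"] conjI allI exI[of _ \<gamma>] ballI)
      (use h d d' tan in \<open>auto simp: tangent_hyp_iff mform_commute\<close>)
qed

lemma ray_self: "p \<in> ray p"
  unfolding ray_def by (rule CollectI, rule exI[of _ 1]) simp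

lemma ray_scale: assumes "c > 0" shows "ray (c *\<^sub>R p) = ray p"
proof -
  have sub: "ray (c *\<^sub>R p) \<subseteq> ray p" if "c > 0" for c p
  proof
    fix x assume "x \<in> ray (c *\<^sub>R p)"
    then obtain d where "d > 0" "x = (d * c) *\<^sub>R p" unfolding ray_def by auto
    then show "x \<in> ray p" unfolding ray_def using that mult_pos_pos by blast
  qed
  have "ray p = ray ((1 / c) *\<^sub>R (c *\<^sub>R p))" using assms by simp
  also have "\<dots> \<subseteq> ray (c *\<^sub>R p)" using assms by (intro sub) simp
  finally show ?thesis using sub[OF assms] by blast
qed

lemma exp_tendsto_forward:
  fixes A B :: mvec
  assumes "fst A > 0"
  shows "((\<lambda>t. (exp t *\<^sub>R A + exp (- t) *\<^sub>R B) /\<^sub>R fst (exp t *\<^sub>R A + exp (- t) *\<^sub>R B)) \<longlongrightarrow> A /\<^sub>R fst A) at_top"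
proof -
  have 0: "((\<lambda>t::real. exp (- (2 * t))) \<longlongrightarrow> 0) at_top" 
    by (intro filterlim_compose[OF exp_at_bot] filterlim_uminus_at_bot[THEN iffD2])
      (simp add: filterlim_tendsto_pos_mult_at_top[OF tendsto_const] filterlim_ident)
  have "((\<lambda>t. (A + exp (- (2 * t)) *\<^sub>R B) /\<^sub>R fst (A + exp (- (2 * t)) *\<^sub>R B)) \<longlongrightarrow> (A + 0 *\<^sub>R B) /\<^sub>R fst (A + 0 *\<^sub>R B)) at_top"
  proof -
    have l: "((\<lambda>t. A + exp (- (2 * t)) *\<^sub>R B) \<longlongrightarrow> A + 0 *\<^sub>R B) at_top"
      by (rule tendsto_add[OF tendsto_const tendsto_scaleR[OF 0 tendsto_const]])
    show ?thesis
      by (rule tendsto_scaleR[OF tendsto_inverse[OF tendsto_fst[OF l]] l]) (use assms in simp)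
  qed
  moreover have "(exp t *\<^sub>R A + exp (- t) *\<^sub>R B) /\<^sub>R fst (exp t *\<^sub>R A + exp (- t) *\<^sub>R B)
      = (A + exp (- (2 * t)) *\<^sub>R B) /\<^sub>R fst (A + exp (- (2 * t)) *\<^sub>R B)" for t
  proof -
    have "exp t *\<^sub>R A + exp (- t) *\<^sub>R B = exp t *\<^sub>R (A + exp (- (2 * t)) *\<^sub>R B)"
      by (simp add: scaleR_right_distrib mult_exp_exp)
    then show ?thesis by (simp only: fst_scaleR real_scaleR_def inverse_mult_distrib scaleR_scaleR) simp
  qed
  ultimately show ?thesis by simp
qed

lemma tends_to_ideal_ray:
  assumes lim: "((\<lambda>t. \<gamma> t /\<^sub>R fst (\<gamma> t)) \<longlongrightarrow> A /\<^sub>R fst A) F" and F: "F \<noteq> bot"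
    and A: "A \<in> light_cone n" and p: "p \<in> light_cone n"
  shows "tends_to_ideal \<gamma> (ray p) F \<longleftrightarrow> (\<exists>c > 0. A = c *\<^sub>R p)"
proof
  assume "tends_to_ideal \<gamma> (ray p) F"
  then obtain p' where r: "ray p = ray p'" and l: "((\<lambda>t. \<gamma> t /\<^sub>R fst (\<gamma> t)) \<longlongrightarrow> p' /\<^sub>R fst p') F"
    unfolding tends_to_ideal_def by blast
  have "p' \<in> ray p" using r ray_self[of p'] by simp
  then obtain c where c: "c > 0" "p' = c *\<^sub>R p" unfolding ray_def by blast
  have "A /\<^sub>R fst A = p' /\<^sub>R fst p'" by (rule tendsto_unique[OF F lim l])
  then have "fst A *\<^sub>R (A /\<^sub>R fst A) = fst A *\<^sub>R (p' /\<^sub>R fst p')" by simp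
  then have "A = (fst A / fst p) *\<^sub>R p"
    using c light_coneD(3)[OF A] light_coneD(3)[OF p] by (simp add: field_simps)
  then show "\<exists>c > 0. A = c *\<^sub>R p" using light_coneD(3)[OF A] light_coneD(3)[OF p] by (meson divide_pos_pos)
next
  assume "\<exists>c > 0. A = c *\<^sub>R p"
  then show "tends_to_ideal \<gamma> (ray p) F"
    unfolding tends_to_ideal_def using lim ray_scale by metis
qed

lemma exp_tends_to_ideal:
  assumes A: "A \<in> light_cone n" and B: "B \<in> light_cone n" and p: "p \<in> light_cone n"
    and \<gamma>: "\<And>t. \<gamma> t = exp t *\<^sub>R A + exp (- t) *\<^sub>R B"
  shows "tends_to_ideal \<gamma> (ray p) at_top \<longleftrightarrow> (\<exists>c > 0. A = c *\<^sub>R p)"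
    "tends_to_ideal \<gamma> (ray p) at_bot \<longleftrightarrow> (\<exists>c > 0. B = c *\<^sub>R p)"
proof -
  show "tends_to_ideal \<gamma> (ray p) at_top \<longleftrightarrow> (\<exists>c > 0. A = c *\<^sub>R p)"
    using exp_tendsto_forward[OF light_coneD(3)[OF A], of B]
    by (intro tends_to_ideal_ray[OF _ _ A p]) (simp_all add: \<gamma>)
  have "((\<lambda>t. \<gamma> (- t) /\<^sub>R fst (\<gamma> (- t))) \<longlongrightarrow> B /\<^sub>R fst B) at_top"
    using exp_tendsto_forward[OF light_coneD(3)[OF B], of A] by (simp add: \<gamma> add.commute)
  then have "((\<lambda>t. \<gamma> t /\<^sub>R fst (\<gamma> t)) \<longlongrightarrow> B /\<^sub>R fst B) at_bot"
    unfolding filterlim_at_bot_mirror .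
  then show "tends_to_ideal \<gamma> (ray p) at_bot \<longleftrightarrow> (\<exists>c > 0. B = c *\<^sub>R p)"
    by (intro tends_to_ideal_ray[OF _ _ B p]) simp_all
qed

text \<open>Existence comes from the geodesic with A = p / 2 and B = q - p / 2. For uniqueness, a
  geodesic towards the centre has A = c p; from N = A - B and q = A + B follows N = 2 c p - q, and
  (N|N) = -1 forces 2 c = 1.\<close>

lemma N_out_eq:
  assumes k: "\<kappa> \<in> SGamma (n + 1)" and q: "q \<in> horosphere n (null_vec \<kappa>)"
  shows "N_out n (horosphere n (null_vec \<kappa>)) q = null_vec \<kappa> - q"
  unfolding N_out_def centre_null_vec[OF k] tangent_horo_def horo_vec_null_vec[OF k]
proof (rule the_equality)
  let ?p = "null_vec \<kappa>"
  note p = null_vec_light_cone[OF k] 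
  have qh: "q \<in> hyp n" and qp: "mform q ?p = 1" using q by (auto simp: horosphere_iff)
  note pD = light_coneD[OF p] and qD = hypD[OF qh]
  have pq: "mform ?p q = 1" using qp by (simp add: mform_commute)
  let ?A = "(1 / 2) *\<^sub>R ?p" and ?B = "q - (1 / 2) *\<^sub>R ?p"
  have A: "?A \<in> light_cone n" by (rule light_coneI[OF qh]) (auto simp: pD minkowski_linear pq)
  have B: "?B \<in> light_cone n" by (rule light_coneI[OF qh]) (auto simp: pD qD minkowski_linear pq qp)
  have AB: "mform ?A ?B = 1 / 2" using pD pq by simp
  note g = exp_geodesic[OF A B AB]
  let ?\<gamma> = "\<lambda>t. exp t *\<^sub>R ?A + exp (- t) *\<^sub>R ?B"
  have "tends_to_ideal ?\<gamma> (ray ?p) at_top"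
    unfolding exp_tends_to_ideal(1)[OF A B p refl] by (intro exI[of _ "1 / 2"]) simp
  moreover have "?\<gamma> 0 = q" by simp
  moreover have "(?\<gamma> has_vector_derivative (?p - q)) (at 0)"
  proof -
    have eq: "exp 0 *\<^sub>R ?A - exp (- 0) *\<^sub>R ?B = ?p - q"
    proof -
      have "?A + ?A = ?p" by (simp flip: scaleR_left_distrib)
      moreover have "?A - (q - ?A) = (?A + ?A) - q" by (simp only: algebra_simps)
      ultimately show ?thesis by simp
    qed
    show ?thesis using g(4)[of 0] unfolding eq .
  qed
  moreover have "geodesic n ?\<gamma>" by (rule g(2))
  ultimately have "\<exists>\<gamma>. geodesic n \<gamma> \<and> \<gamma> 0 = q \<and> (\<gamma> has_vector_derivative (?p - q)) (at 0) \<and> tends_to_ideal \<gamma> (ray ?p) at_top"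
    by blast
  moreover have "?p - q \<in> tangent_hyp n q" using pD qD pq by (simp add: tangent_hyp_iff minkowski_linear)
  moreover have "mform (?p - q) (?p - q) = -1" using pD qD pq qp by simp
  moreover have "mform (?p - q) u = 0" if "u \<in> {u \<in> tangent_hyp n q. mform u ?p = 0}" for u
    using that by (simp add: tangent_hyp_iff mform_commute[of q u] mform_commute[of ?p u])
  ultimately show "?p - q \<in> tangent_hyp n q \<and> mform (?p - q) (?p - q) = - 1 \<and>
      (\<forall>u\<in>{u \<in> tangent_hyp n q. mform u ?p = 0}. mform (?p - q) u = 0) \<and>
      (\<exists>\<gamma>. geodesic n \<gamma> \<and> \<gamma> 0 = q \<and> (\<gamma> has_vector_derivative (?p - q)) (at 0) \<and> tends_to_ideal \<gamma> (ray ?p) at_top)"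
    by blast
  fix N
  assume N: "N \<in> tangent_hyp n q \<and> mform N N = - 1 \<and>
      (\<forall>u\<in>{u \<in> tangent_hyp n q. mform u ?p = 0}. mform N u = 0) \<and>
      (\<exists>\<gamma>. geodesic n \<gamma> \<and> \<gamma> 0 = q \<and> (\<gamma> has_vector_derivative N) (at 0) \<and> tends_to_ideal \<gamma> (ray ?p) at_top)"
  then obtain \<gamma> where \<gamma>: "geodesic n \<gamma>" "\<gamma> 0 = q" "(\<gamma> has_vector_derivative N) (at 0)" "tends_to_ideal \<gamma> (ray ?p) at_top"
    by blast
  obtain A B where AB: "A \<in> light_cone n" "B \<in> light_cone n" "\<And>t. \<gamma> t = exp t *\<^sub>R A + exp (- t) *\<^sub>R B"
    "\<And>t. (\<gamma> has_vector_derivative (exp t *\<^sub>R A - exp (- t) *\<^sub>R B)) (at t)"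
    using geodesic_exp[OF \<gamma>(1)] by metis
  obtain c where c: "A = c *\<^sub>R ?p" using \<gamma>(4) exp_tends_to_ideal(1)[OF AB(1,2) p AB(3)] by blast
  have "N = A - B" using vector_derivative_unique_at[OF \<gamma>(3) AB(4)] by simp
  moreover have "q = A + B" using \<gamma>(2) AB(3)[of 0] by simp
  ultimately have "N = (A + A) - q" by simp
  moreover have "A + A = (2 * c) *\<^sub>R ?p" by (simp add: c flip: scaleR_left_distrib)
  ultimately have Nq: "N = (2 * c) *\<^sub>R ?p - q" by simp
  have "mform N N = -1" using N by blast
  then have "2 * c = 1" unfolding Nq using pD qD pq qp by simp
  then show "N = ?p - q" using Nq by simp
qed

section \<open>Connectedness of the space of pointed horospheres\<close>

lemma continuous_on_clsub_linear:
  assumes "continuous_on S f" "\<And>s. s \<in> S \<Longrightarrow> f s \<in> clsub m"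
  shows "continuous_on S (\<lambda>s. cl_star (f s))" "continuous_on S (\<lambda>s. cl_conj (f s))"
  using assms clsub_involutions
  by (auto intro!: continuous_on_clI[where m = m] continuous_intros
    bounded_linear.continuous_on[OF bounded_linear_cl_coeff assms(1)]
    simp: cl_star.rep_eq cl_prime.rep_eq cl_conj_def)

lemma SGamma_clsub: "\<kappa> \<in> SGamma m \<Longrightarrow> fst \<kappa> \<in> clsub m \<and> snd \<kappa> \<in> clsub m"
  by (auto simp: SGamma_def Gamma0_clsub)

lemma SGamma_scale:
  assumes "\<kappa> \<in> SGamma m" "s \<in> Gamma m"
  shows "(fst \<kappa> * s, snd \<kappa> * s) \<in> SGamma m"
proof -
  have s: "s * cl_conj s = of_real (inner s s)" by (rule Gamma_norm[OF assms(2)])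
  have 0: "x * s = 0 \<longleftrightarrow> x = 0" for x
  proof
    assume "x * s = 0"
    then have "x * (s * cl_conj s) = 0" by (simp add: mult.assoc[symmetric])
    then show "x = 0" using Gamma_norm(3)[OF assms(2)] by (simp add: s cl_times_of_real)
  qed simp
  have "fst \<kappa> * s * cl_conj (snd \<kappa> * s) = inner s s *\<^sub>R (fst \<kappa> * cl_conj (snd \<kappa>))"
  proof -
    have "fst \<kappa> * s * cl_conj (snd \<kappa> * s) = fst \<kappa> * (s * cl_conj s) * cl_conj (snd \<kappa>)"
      by (simp add: cl_conj_mult mult.assoc)
    then show ?thesis by (simp add: s cl_times_of_real)
  qed
  moreover have "x * s \<in> Gamma0 m" if "x \<in> Gamma0 m" for x
    using that assms(2) by (auto simp: Gamma0_def intro: Gamma.mult)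
  ultimately show ?thesis
    using assms(1) 0 by (auto simp: SGamma_def paravectors_linear)
qed

text \<open>Columns of a paravector and a real number form a vector space without its origin, in
  which paths can be written down by polynomial formulas.\<close>

lemma SGamma_paravectors:
  assumes "v \<in> paravectors m" "(v, c) \<noteq> (0, 0)"
  shows "(v, c *\<^sub>R 1) \<in> SGamma m"
proof -
  have G: "w \<in> paravectors m \<Longrightarrow> w \<in> Gamma0 m" for w
    by (cases "w = 0") (auto simp: Gamma0_def intro: Gamma.gen)
  show ?thesis
    using assms G[OF assms(1)] G[OF paravectors_linear(7)[OF paravectors_linear(2)]]
    by (auto simp: SGamma_def paravectors_linear)
qed

lemma connected_component_path:
  assumes "continuous_on {0..1::real} g" "g ` {0..1} \<subseteq> S"
  shows "connected_component S (g 0) (g 1)"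
  using assms connected_continuous_image[OF assms(1)]
  unfolding connected_component_def by (intro exI[of _ "g ` {0..1}"]) auto

text \<open>The group acts on columns by right multiplication, so paths for nonzero paravectors
  suffice: their translates reach products and inverses, and \<open>(a * s, s)\<close> is a
  translate of \<open>(a, 1)\<close>.\<close>

lemma connected_SGamma: "connected (SGamma m)"
proof -
  let ?c = "connected_component (SGamma m)"
  have scale: "?c (fst \<kappa> * s, snd \<kappa> * s) (fst \<kappa>' * s, snd \<kappa>' * s)" if "?c \<kappa> \<kappa>'" "s \<in> Gamma m" for \<kappa> \<kappa>' s
  proof -
    obtain T where T: "connected T" "T \<subseteq> SGamma m" "\<kappa> \<in> T" "\<kappa>' \<in> T"
      using \<open>?c \<kappa> \<kappa>'\<close> unfolding connected_component_def by blast
    let ?f = "\<lambda>\<kappa>. (fst \<kappa> * s, snd \<kappa> * s)"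
    have "continuous_on T ?f"
      by (intro continuous_on_Pair continuous_on_cl_mult[where m = m] continuous_intros)
        (use T(2) SGamma_clsub Gamma_clsub that(2) in blast)+
    then have "connected (?f ` T)" using T(1) by (rule connected_continuous_image)
    moreover have "?f ` T \<subseteq> SGamma m" using T(2) SGamma_scale that(2) by blast
    ultimately show ?thesis using T(3,4) unfolding connected_component_def by blast
  qed
  have para: "?c (1, 0) (v, 0)" if "v \<in> paravectors m" "v \<noteq> 0" for v
  proof -
    \<comment> \<open>The second entry keeps the path off the origin when the segment from 1 to
      \<open>v\<close> passes through 0, as it does for negative real \<open>v\<close>. For m = 1
      the group consists of the nonzero reals, and no path inside it would do.\<close>
    let ?g = "\<lambda>t. ((1 - t) *\<^sub>R 1 + t *\<^sub>R v, (t * (1 - t)) *\<^sub>R (1 :: cl))"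
    have "?g t \<in> SGamma m" for t
      using that by (intro SGamma_paravectors paravectors_linear) auto
    moreover have "continuous_on {0..1} ?g" by (intro continuous_intros)
    ultimately have "?c (?g 0) (?g 1)" by (intro connected_component_path) auto
    then show ?thesis by simp
  qed
  have Gamma: "?c (1, 0) (s, 0)" if "s \<in> Gamma m" for s
    using that
  proof induction
    case one
    then show ?case using SGammaI1[OF Gamma.one] by simp
  next
    case (mult x y)
    then have "?c (y, 0) (x * y, 0)" using scale[OF mult.IH(1), of y] by simp
    then show ?case using mult.IH(2) connected_component_trans by metis
  next
    case (inv x y)
    then have "y \<in> Gamma m" using Gamma.inv by blast
    from scale[OF inv.IH this] have "?c (y, 0) (1, 0)" using inv by simp
    then show ?case by (rule connected_component_sym)
  qed (use para in auto)
  have "?c (1, 0) \<kappa>" if "\<kappa> \<in> SGamma m" for \<kappa>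
    using that
  proof (cases rule: SGamma_cases)
    case (1 s)
    then show ?thesis using Gamma by simp
  next
    case (2 a s)
    let ?g = "\<lambda>t. ((1 - t) *\<^sub>R 1 + t *\<^sub>R a, t *\<^sub>R (1 :: cl))"
    have "?g t \<in> SGamma m" for t
      using 2 by (intro SGamma_paravectors paravectors_linear) auto
    moreover have "continuous_on {0..1} ?g" by (intro continuous_intros)
    ultimately have "?c (?g 0) (?g 1)" by (intro connected_component_path) auto
    then have "?c (1, 0) (a, 1)" by simp
    from scale[OF this 2(2)] have "?c (s, 0) \<kappa>" using 2 by simp
    then show ?thesis using Gamma[OF 2(2)] connected_component_trans by metis
  qed
  then show ?thesis
    unfolding connected_iff_connected_component
    using connected_component_trans connected_component_sym by metis
qed

definition pointed_horospheres :: "nat \<Rightarrow> (column \<times> mvec) set" where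
  "pointed_horospheres n = {(\<kappa>, q). \<kappa> \<in> SGamma (n + 1) \<and> q \<in> horosphere n (null_vec \<kappa>)}"

text \<open>A connected base with a continuous section and connected fibres. Within one horosphere,
  the chord between two points is pushed back along p by \<open>horosphere_correct\<close>.\<close>

lemma connected_pointed_horospheres: "connected (pointed_horospheres n)"
proof -
  let ?E = "pointed_horospheres n"
  let ?c = "connected_component ?E"
  let ?s = "\<lambda>\<kappa>. (\<kappa>, horo_point (null_vec \<kappa>))"
  have cont: "continuous_on (SGamma (n + 1)) null_vec"
  proof -
    have "continuous_on (SGamma (n + 1)) (\<lambda>\<kappa>. (inner (fst \<kappa>) (fst \<kappa>) + inner (snd \<kappa>) (snd \<kappa>),
        inner (fst \<kappa>) (fst \<kappa>) - inner (snd \<kappa>) (snd \<kappa>), 2 *\<^sub>R (fst \<kappa> * cl_conj (snd \<kappa>))))"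
      by (intro continuous_intros continuous_on_cl_mult[where m = "n + 1"] continuous_on_clsub_linear[where m = "n + 1"])
        (use SGamma_clsub clsub_involutions in blast)+
    moreover have "null_vec \<kappa> = (inner (fst \<kappa>) (fst \<kappa>) + inner (snd \<kappa>) (snd \<kappa>),
        inner (fst \<kappa>) (fst \<kappa>) - inner (snd \<kappa>) (snd \<kappa>), 2 *\<^sub>R (fst \<kappa> * cl_conj (snd \<kappa>)))"
      if "\<kappa> \<in> SGamma (n + 1)" for \<kappa>
      using null_vec_eq[of "fst \<kappa>" "snd \<kappa>"] that by simp
    ultimately show ?thesis by (simp cong: continuous_on_cong)
  qed
  have pos: "fst (null_vec \<kappa>) \<noteq> 0" if "\<kappa> \<in> SGamma (n + 1)" for \<kappa>
    using light_coneD(3)[OF null_vec_light_cone[OF that]] by simp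
  have sE: "?s \<kappa> \<in> ?E" if "\<kappa> \<in> SGamma (n + 1)" for \<kappa>
    using horo_point[OF null_vec_light_cone[OF that]] that by (simp add: pointed_horospheres_def)
  have "continuous_on (SGamma (n + 1)) ?s"
    unfolding horo_point_def by (intro continuous_intros cont) (simp_all add: pos)
  then have "connected (?s ` SGamma (n + 1))" using connected_SGamma by (rule connected_continuous_image)
  moreover have "?s ` SGamma (n + 1) \<subseteq> ?E" by (intro image_subsetI sE)
  ultimately have sec: "?c (?s \<kappa>) (?s \<kappa>')" if "\<kappa> \<in> SGamma (n + 1)" "\<kappa>' \<in> SGamma (n + 1)" for \<kappa> \<kappa>'
    unfolding connected_component_def using that by blast
  have fib: "?c (\<kappa>, q) (\<kappa>, q')" if E: "(\<kappa>, q) \<in> ?E" "(\<kappa>, q') \<in> ?E" for \<kappa> q q'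
  proof -
    let ?p = "null_vec \<kappa>"
    let ?r = "\<lambda>t. (1 - t) *\<^sub>R q + t *\<^sub>R q'"
    let ?g = "\<lambda>t. (\<kappa>, ?r t + ((1 - mform (?r t) (?r t)) / 2) *\<^sub>R ?p)"
    have k: "\<kappa> \<in> SGamma (n + 1)" and q: "q \<in> hyp n" "q' \<in> hyp n" "mform q ?p = 1" "mform q' ?p = 1"
      using E by (auto simp: pointed_horospheres_def horosphere_iff)
    have "?r t + ((1 - mform (?r t) (?r t)) / 2) *\<^sub>R ?p \<in> horosphere n ?p" for t
      using q hypD(1)[OF q(1)] hypD(1)[OF q(2)]
      by (intro horosphere_correct null_vec_light_cone k minkowski_linear) auto
    then have "?g ` {0..1} \<subseteq> ?E" using k by (auto simp: pointed_horospheres_def)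
    moreover have "continuous_on {0..1} ?g"
      by (intro continuous_intros continuous_on_mform) simp
    ultimately have "?c (?g 0) (?g 1)" by (intro connected_component_path) auto
    then show ?thesis using hypD(2)[OF q(1)] hypD(2)[OF q(2)] by simp
  qed
  have "?c (\<kappa>, q) (\<kappa>', q')" if E: "(\<kappa>, q) \<in> ?E" "(\<kappa>', q') \<in> ?E" for \<kappa> q \<kappa>' q'
  proof -
    have k: "\<kappa> \<in> SGamma (n + 1)" "\<kappa>' \<in> SGamma (n + 1)" using E by (auto simp: pointed_horospheres_def)
    have s: "?s \<kappa> \<in> ?E" "?s \<kappa>' \<in> ?E" using sE k by blast+
    show ?thesis
      by (rule connected_component_trans[OF fib[OF E(1) s(1)] connected_component_trans[OF sec[OF k] fib[OF s(2) E(2)]]])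
  qed
  then show ?thesis unfolding connected_iff_connected_component by auto
qed

lemma continuous_on_uhs_point:
  assumes "continuous_on S q" "\<And>s. s \<in> S \<Longrightarrow> q s \<in> hyp n"
  shows "continuous_on S (\<lambda>s. uhs_point n (q s))"
proof -
  have "height_inv (q s) \<noteq> 0" if "s \<in> S" for s using height_inv_pos[OF assms(2)[OF that]] by simp
  then show ?thesis
    unfolding uhs_point_def height_inv_def by (intro continuous_intros assms) blast
qed

lemma continuous_on_spin_of:
  assumes "continuous_on S k" "continuous_on S q" "\<And>s. s \<in> S \<Longrightarrow> q s \<in> hyp n" "\<And>s. s \<in> S \<Longrightarrow> k s \<in> SGamma (n + 1)"
  shows "continuous_on S (\<lambda>s. spin_of n (k s) (q s))"
proof -
  have c: "snd (k s) \<in> clsub (n + 2)" "uhs_point n (q s) \<in> clsub (n + 2)" if "s \<in> S" for s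
    using SGamma_clsub[OF assms(4)[OF that]] clsub_mono[of "n + 1" "n + 2"] paravectors_clsub[of "n + 2"]
      uhs_point_paravector[OF assms(3)[OF that]] by auto
  have y: "continuous_on S (\<lambda>s. col_eval n (k s) (q s))"
    unfolding col_eval_def
    by (intro continuous_intros continuous_on_cl_mult[where m = "n + 2"] continuous_on_uhs_point assms) (use c in auto)
  have "norm (col_eval n (k s) (q s)) \<noteq> 0" if "s \<in> S" for s
    using Gamma_norm(3)[OF col_eval_Gamma[OF assms(4,3)[OF that]]] by simp
  then show ?thesis unfolding spin_of_def by (intro continuous_intros y) blast
qed

section \<open>The frames of decorated horospheres\<close>

definition frame_det :: "nat \<Rightarrow> (nat \<Rightarrow> cl) \<Rightarrow> real" where
  "frame_det n v = Determinant.det (Matrix.mat (n + 2) (n + 2) (\<lambda>(k, l). inner (v l) (std_basis n k)))"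

text \<open>The Leibniz formula; continuity and the sign change under negation of the last vector
  are read off from it.\<close>

lemma frame_det_sum:
  "frame_det n v = (\<Sum>p | p permutes {0..<n + 2}. signof p * (\<Prod>j<n + 2. inner (v j) (std_basis n (p j))))"
  unfolding frame_det_def
proof (subst det_col[of _ "n + 2"], goal_cases)
  case 2
  have "p j < n + 2" if "p permutes {0..<n + 2}" "j < n + 2" for p j
    using permutes_in_image[OF that(1), of j] that(2) by simp
  then show ?case by (intro sum.cong refl arg_cong2[of _ _ _ _ "(*)"] prod.cong) auto
qed simp

lemma frame_det_cong: "(\<And>l. l \<le> n + 1 \<Longrightarrow> v l = w l) \<Longrightarrow> frame_det n v = frame_det n w"
  unfolding frame_det_sum by (intro sum.cong refl arg_cong2[of _ _ _ _ "(*)"] prod.cong) auto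

lemma frame_det_negate_last:
  assumes "\<And>l. l \<le> n \<Longrightarrow> w l = v l" "w (n + 1) = - v (n + 1)"
  shows "frame_det n w = - frame_det n v"
proof -
  have "(\<Prod>j<n + 2. inner (w j) (std_basis n (p j))) = - (\<Prod>j<n + 2. inner (v j) (std_basis n (p j)))" for p
  proof -
    have "(\<Prod>j<n + 1. inner (w j) (std_basis n (p j))) = (\<Prod>j<n + 1. inner (v j) (std_basis n (p j)))"
      using assms(1) by (intro prod.cong) auto
    then show ?thesis using assms(2) by (simp add: prod.lessThan_Suc)
  qed
  then show ?thesis by (simp add: frame_det_sum sum_negf[symmetric])
qed

lemma paravector_parseval:
  assumes "v \<in> paravectors (n + 2)"
  shows "inner v w = (\<Sum>k\<le>n + 1. inner v (std_basis n k) * inner w (std_basis n k))"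
proof -
  have "inner v w = inner (\<Sum>k\<le>n + 1. inner v (std_basis n k) *\<^sub>R std_basis n k) w"
    using paravector_expand[OF assms] by simp
  also have "\<dots> = (\<Sum>k\<le>n + 1. inner v (std_basis n k) * inner (std_basis n k) w)"
    by (simp only: inner_sum_left inner_scaleR_left)
  finally show ?thesis by (simp only: inner_commute[of w])
qed

text \<open>The coordinate matrix of an orthonormal system is orthogonal, by Parseval.\<close>

lemma frame_det_nonzero:
  assumes "g \<in> Spin (n + 2)"
  shows "frame_det n (\<lambda>l. sigma g (std_basis n l)) \<noteq> 0"
proof -
  let ?v = "\<lambda>l. sigma g (std_basis n l)"
  let ?M = "Matrix.mat (n + 2) (n + 2) (\<lambda>(k, l). inner (?v l) (std_basis n k))"
  have v: "?v l \<in> paravectors (n + 2)" for l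
    using assms std_basis_paravector by (intro sigma_Gamma) (auto simp: Spin_iff)
  have "transpose_mat ?M * ?M = 1\<^sub>m (n + 2)"
  proof (rule eq_matI)
    fix i j assume ij: "i < dim_row (1\<^sub>m (n + 2))" "j < dim_col (1\<^sub>m (n + 2))"
    have "(transpose_mat ?M * ?M) $$ (i, j) = (\<Sum>k\<in>{0..<n + 2}. inner (?v i) (std_basis n k) * inner (?v j) (std_basis n k))"
      using ij by (simp add: scalar_prod_def del: sum.op_ivl_Suc)
    also have "{0..<n + 2} = {..n + 1}" by auto
    also have "(\<Sum>k\<le>n + 1. inner (?v i) (std_basis n k) * inner (?v j) (std_basis n k)) = inner (?v i) (?v j)"
      using paravector_parseval[OF v, of i "?v j"] by simp
    also have "\<dots> = 1\<^sub>m (n + 2) $$ (i, j)"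
      using ij std_basis_orthonormal[of i n j] by (simp add: inner_sigma_Spin[OF assms])
    finally show "(transpose_mat ?M * ?M) $$ (i, j) = 1\<^sub>m (n + 2) $$ (i, j)" .
  qed simp_all
  then have "Determinant.det (transpose_mat ?M) * Determinant.det ?M = 1"
    by (metis det_mult det_one mat_carrier transpose_carrier_mat)
  then show ?thesis unfolding frame_det_def by auto
qed

lemma frame_det_continuous:
  assumes "continuous_on S g" "\<And>s. s \<in> S \<Longrightarrow> g s \<in> Spin (n + 2)"
  shows "continuous_on S (\<lambda>s. frame_det n (\<lambda>l. sigma (g s) (std_basis n l)))"
proof -
  have c: "g s \<in> clsub (n + 2)" "cl_star (g s) \<in> clsub (n + 2)" if "s \<in> S" for s
    using assms(2)[OF that] by (auto simp: Spin_iff intro: Gamma_clsub clsub_involutions)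
  have b: "std_basis n l \<in> clsub (n + 2)" for l
    using std_basis_paravector paravectors_clsub by blast
  have "continuous_on S (\<lambda>s. sigma (g s) (std_basis n l))" for l
    unfolding sigma_def
    by (intro continuous_on_cl_mult[where m = "n + 2"] continuous_on_clsub_linear(1)[where m = "n + 2"] assms continuous_intros)
      (use b c clsub_mult in blast)+
  then show ?thesis unfolding frame_det_sum by (intro continuous_intros)
qed

lemma continuous_on_spin_of_pointed:
  "continuous_on (pointed_horospheres n) (\<lambda>(\<kappa>, q). spin_of n \<kappa> q)"
  unfolding case_prod_beta
  by (intro continuous_on_spin_of continuous_intros) (auto simp: pointed_horospheres_def horosphere_iff)

text \<open>The determinant is continuous and never zero on a connected space, so its sign at one
  point decides. For the column (1, 0) the element \<open>spin_of\<close> is 1 and the matrix is the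
  identity.\<close>

lemma frame_det_spin_of_pos:
  assumes "\<kappa> \<in> SGamma (n + 1)" "q \<in> horosphere n (null_vec \<kappa>)"
  shows "frame_det n (\<lambda>l. sigma (spin_of n \<kappa> q) (std_basis n l)) > 0"
proof (rule ccontr)
  let ?E = "pointed_horospheres n"
  let ?f = "\<lambda>x. frame_det n (\<lambda>l. sigma ((\<lambda>(\<kappa>, q). spin_of n \<kappa> q) x) (std_basis n l))"
  assume "\<not> ?thesis"
  then have neg: "?f (\<kappa>, q) \<le> 0" by simp
  have S: "(\<lambda>(\<kappa>, q). spin_of n \<kappa> q) x \<in> Spin (n + 2)" if "x \<in> ?E" for x
    using that spin_of_Spin by (auto simp: pointed_horospheres_def horosphere_iff)
  have "connected (?f ` ?E)"
    by (intro connected_continuous_image connected_pointed_horospheres frame_det_continuous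
      continuous_on_spin_of_pointed S)
  moreover have k0: "(1, 0) \<in> SGamma (n + 1)" by (rule SGammaI1[OF Gamma.one])
  moreover define x0 where "x0 = ((1, 0) :: column, horo_point (null_vec (1, 0)))"
  ultimately have con: "connected (?f ` ?E)" and x0: "x0 \<in> ?E"
    using horo_point[OF null_vec_light_cone[OF k0]] by (auto simp: pointed_horospheres_def)
  have "(\<lambda>(\<kappa>, q). spin_of n \<kappa> q) x0 = 1"
    by (simp add: x0_def spin_of_def col_eval_def norm_eq_sqrt_inner)
  then have "?f x0 = frame_det n (std_basis n)" by simp
  also have "\<dots> = Determinant.det (1\<^sub>m (n + 2))"
    unfolding frame_det_def
    by (intro arg_cong[of _ _ Determinant.det] eq_matI) (auto simp: std_basis_orthonormal)
  finally have "?f x0 = 1" by simp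
  moreover have "(\<kappa>, q) \<in> ?E" using assms by (simp add: pointed_horospheres_def)
  ultimately have "0 \<in> ?f ` ?E"
    using connectedD_interval[OF con imageI[of "(\<kappa>, q)" ?E ?f] imageI[OF x0, of ?f] neg] by simp
  then show False using frame_det_nonzero S by fastforce
qed

lemma frame_of_tangential:
  assumes k: "\<kappa> \<in> SGamma (n + 1)" and V: "V = std_basis n j" "V \<in> paravectors (n + 1)"
  obtains L where "\<And>q. q \<in> hyp n \<Longrightarrow> \<exists>\<rho>. frame_of n (q, spin_of n \<kappa> q) j = L + \<rho> *\<^sub>R null_vec \<kappa>"
    "\<And>i. V = gen i \<Longrightarrow> \<exists>c c'. c > 0 \<and> flag_vec \<kappa> i = c *\<^sub>R L + c' *\<^sub>R null_vec \<kappa>"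
proof -
  obtain L where L: "\<And>q. q \<in> hyp n \<Longrightarrow> \<exists>\<rho>. L + \<rho> *\<^sub>R null_vec \<kappa> \<in> tangent_hyp n q \<and>
      cof n q (L + \<rho> *\<^sub>R null_vec \<kappa>) = sigma (spin_of n \<kappa> q) V"
    "\<And>i. V = gen i \<Longrightarrow> \<exists>c c'. c > 0 \<and> flag_vec \<kappa> i = c *\<^sub>R L + c' *\<^sub>R null_vec \<kappa>"
    using tangential_frame_vector[OF k V(2)] by metis
  have "\<exists>\<rho>. frame_of n (q, spin_of n \<kappa> q) j = L + \<rho> *\<^sub>R null_vec \<kappa>" if "q \<in> hyp n" for q
    using L(1)[OF that] frame_of_eqI[OF that] V(1) by metis
  then show thesis using that L(2) by blast
qed

text \<open>Together with p, the frame vector and the flag vector span the same plane, and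
  positivity of \<open>c\<close> is the agreement of the orientations.\<close>

lemma Dhat_Phi:
  assumes k: "\<kappa> \<in> SGamma (n + 1)" and q: "q \<in> horosphere n (null_vec \<kappa>)" and j: "1 \<le> j" "j \<le> n"
  shows "Dhat (Phi n \<kappa>) j q = frame_of n (q, spin_of n \<kappa> q) j"
proof -
  let ?p = "null_vec \<kappa>" and ?f = "frame_of n (q, spin_of n \<kappa> q) j"
  have qh: "q \<in> hyp n" and qp: "mform q ?p = 1" using q by (auto simp: horosphere_iff)
  have pp: "mform ?p ?p = 0" and pq: "mform ?p q = 1"
    using light_coneD(2)[OF null_vec_light_cone[OF k]] qp mform_commute by simp_all
  note g = spin_of_Spin[OF k qh]
  have b: "std_basis n j = gen j" "gen j \<in> paravectors (n + 1)"
    using j by (auto simp: std_basis_def intro: gen_in_paravectors)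
  obtain L \<rho> c c' where L: "?f = L + \<rho> *\<^sub>R ?p" and c: "c > 0" "flag_vec \<kappa> j = c *\<^sub>R L + c' *\<^sub>R ?p"
    using frame_of_tangential[OF k b(1)[symmetric] b(2)] qh by metis
  have flag: "flag_vec \<kappa> j = c *\<^sub>R ?f + (c' - c * \<rho>) *\<^sub>R ?p"
    by (simp add: L c(2) algebra_simps)
  have f: "?f \<in> tangent_hyp n q" "mform ?f q = 0" "mform ?f ?f = -1" "mform ?f ?p = 0" "mform ?p ?f = 0"
    using frame_of_props(1)[OF qh g, of j] frame_of_orthonormal[OF qh g, of j j] j
      tangential_frame_orthogonal(2)[OF k q, of j] mform_commute[of ?p ?f]
    by (auto simp: tangent_hyp_iff)
  have D: "snd (Phi n \<kappa>) j q = tangent_horo n (horosphere n ?p) q \<inter> {a *\<^sub>R ?p + b *\<^sub>R flag_vec \<kappa> j | a b. b > 0}"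
    using j q by (simp add: Phi_def Let_def)
  show ?thesis
    unfolding Dhat_def
  proof (rule the_equality)
    have "?f = (- (c' - c * \<rho>) / c) *\<^sub>R ?p + (1 / c) *\<^sub>R flag_vec \<kappa> j"
      unfolding flag using c(1)
      by (simp add: scaleR_right_distrib flip: scaleR_left_distrib) (simp add: field_simps)
    then have "?f \<in> {a *\<^sub>R ?p + b *\<^sub>R flag_vec \<kappa> j | a b. b > 0}" using c(1) by force
    then show "?f \<in> snd (Phi n \<kappa>) j q \<and> mform ?f ?f = - 1"
      unfolding D tangent_horo_def horo_vec_null_vec[OF k] using f by simp
  next
    fix w assume "w \<in> snd (Phi n \<kappa>) j q \<and> mform w w = - 1"
    then obtain a b where w: "w = a *\<^sub>R ?p + b *\<^sub>R flag_vec \<kappa> j" "b > 0" "mform w q = 0" "mform w w = -1"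
      unfolding D tangent_horo_def tangent_hyp_iff by blast
    define a' where "a' = a + b * (c' - c * \<rho>)"
    have w': "w = a' *\<^sub>R ?p + (b * c) *\<^sub>R ?f"
      unfolding w(1) flag a'_def by (simp add: algebra_simps)
    \<comment> \<open>Pairing with q detects the multiple of p, since (p|q) = 1 while the frame
      vector is tangent at q.\<close>
    have a': "a' = 0" using w(3) f(2) pq by (simp add: w')
    have "(b * c) * (b * c) = 1" using w(4) f(3) by (simp add: w' a')
    then have "b * c = 1 \<or> b * c = -1" by (simp only: square_eq_1_iff)
    moreover have "b * c > 0" using w(2) c(1) by simp
    ultimately have "b * c = 1" by linarith
    then show "w = ?f" using w' a' by simp
  qed
qed

text \<open>With the first n + 1 vectors identified, orthonormality leaves two opposite candidates
  for the last one, and the determinant selects the sign.\<close>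

lemma F_out_Phi:
  assumes k: "\<kappa> \<in> SGamma (n + 1)" and q: "q \<in> horosphere n (null_vec \<kappa>)" and j: "j \<le> n + 1"
  shows "F_out n (Phi n \<kappa>) q j = frame_of n (q, spin_of n \<kappa> q) j"
proof -
  let ?p = "null_vec \<kappa>" and ?F = "frame_of n (q, spin_of n \<kappa> q)"
  have qh: "q \<in> hyp n" and qp: "mform q ?p = 1" using q by (auto simp: horosphere_iff)
  note g = spin_of_Spin[OF k qh]
  define f where "f = (\<lambda>w l. if l = 0 then ?p - q else if l \<le> n then Dhat (Phi n \<kappa>) l q else w :: mvec)"
  have f: "f w l = (if l \<le> n then ?F l else w)" for w l
    using Dhat_Phi[OF k q, of l] tangential_frame_orthogonal(1)[OF k q] by (simp add: f_def)
  have co: "coframe n q (?F l) = sigma (spin_of n \<kappa> q) (std_basis n l)" for l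
    using frame_of_props(2)[OF qh g] coframe_eq_cof[OF qh] by simp
  have det: "positive_frame n q (f w) \<longleftrightarrow> (\<forall>k \<le> n + 1. f w k \<in> tangent_hyp n q) \<and>
     (\<forall>k \<le> n + 1. \<forall>l \<le> n + 1. mform (f w k) (f w l) = (if k = l then - 1 else 0)) \<and>
     frame_det n (\<lambda>l. coframe n q (f w l)) > 0" for w
    unfolding positive_frame_def frame_det_def ..
  have last: "f w l = ?F l" if "l \<le> n + 1" "w = ?F (n + 1)" for w l
    using that by (cases "l = n + 1") (auto simp: f)
  have "(THE w. positive_frame n q (f w)) = ?F (n + 1)"
  proof (rule the_equality)
    have "frame_det n (\<lambda>l. coframe n q (f (?F (n + 1)) l)) = frame_det n (\<lambda>l. sigma (spin_of n \<kappa> q) (std_basis n l))"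
      by (intro frame_det_cong) (simp only: last co)
    then show "positive_frame n q (f (?F (n + 1)))"
      unfolding det using frame_det_spin_of_pos[OF k q] frame_of_props(1)[OF qh g] frame_of_orthonormal[OF qh g]
      by (simp add: last)
  next
    fix w assume "positive_frame n q (f w)"
    then have t: "\<And>l. l \<le> n + 1 \<Longrightarrow> f w l \<in> tangent_hyp n q"
      and o: "\<And>l m. l \<le> n + 1 \<Longrightarrow> m \<le> n + 1 \<Longrightarrow> mform (f w l) (f w m) = (if l = m then - 1 else 0)"
      and d: "frame_det n (\<lambda>l. coframe n q (f w l)) > 0"
      unfolding det by blast+
    have w: "w \<in> tangent_hyp n q" "mform w w = -1"
      using t[of "n + 1"] o[of "n + 1" "n + 1"] by (simp_all add: f)
    have w_F: "mform w (?F l) = 0" if "l \<le> n" for l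
      using o[of "n + 1" l] that by (simp add: f)
    define c where "c = - mform w (?F (n + 1))"
    have "w - c *\<^sub>R ?F (n + 1) = 0"
    proof (rule tangent_eq_0_of_frame[OF qh g])
      show "w - c *\<^sub>R ?F (n + 1) \<in> tangent_hyp n q"
        using w(1) frame_of_props(1)[OF qh g] by (intro tangent_hyp_linear)
      fix l assume "l \<le> n + 1"
      then consider "l \<le> n" | "l = n + 1" by linarith
      then show "mform (w - c *\<^sub>R ?F (n + 1)) (?F l) = 0"
        using w_F[of l] frame_of_orthonormal[OF qh g, of "n + 1" l] by cases (auto simp: c_def)
    qed
    then have wc: "w = c *\<^sub>R ?F (n + 1)" by simp
    have "c * c = 1" using w(2) frame_of_orthonormal[OF qh g, of "n + 1" "n + 1"] by (simp add: wc)
    moreover have "c \<noteq> -1"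
    proof
      assume "c = -1"
      then have "frame_det n (\<lambda>l. coframe n q (f w l)) = - frame_det n (\<lambda>l. sigma (spin_of n \<kappa> q) (std_basis n l))"
        by (intro frame_det_negate_last) (simp_all add: f co wc, simp_all add: co[symmetric] coframe_eq_cof[OF qh])
      then show False using d frame_det_spin_of_pos[OF k q] by simp
    qed
    ultimately have "c = 1" by (simp add: square_eq_1_iff)
    then show "w = ?F (n + 1)" using wc by simp
  qed
  then have "F_out n (Phi n \<kappa>) q = f (?F (n + 1))"
    unfolding F_out_def complete_frame_def Let_def fst_Phi N_out_eq[OF k q] f_def[symmetric] by simp
  then show ?thesis using last[OF j] by simp
qed

section \<open>Spin decorations\<close>

lemma connected_sign_eq:
  fixes f g :: "'a :: topological_space \<Rightarrow> cl"
  assumes "connected S" "continuous_on S f" "continuous_on S g"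
    and "\<And>s. s \<in> S \<Longrightarrow> inner (g s) (g s) = 1" "\<And>s. s \<in> S \<Longrightarrow> f s = g s \<or> f s = - g s"
    and s0: "s0 \<in> S" "f s0 = g s0" and s: "s \<in> S"
  shows "f s = g s"
proof -
  have "f s0 \<noteq> - g s0"
  proof
    assume "f s0 = - g s0"
    with s0(2) have "g s0 = - g s0" by (rule subst)
    then have "inner (g s0) (g s0) = inner (g s0) (- g s0)" by (rule arg_cong)
    then show False using assms(4)[OF s0(1)] by simp
  qed
  then show ?thesis using connected_sign_constant[OF assms(1-5)] s0(1) s by blast
qed

lemma lifts_frame_spin_of:
  assumes k: "\<kappa> \<in> SGamma (n + 1)" and q: "q \<in> hyp n" and g: "g \<in> Spin (n + 2)"
    and W: "lifts_frame n W q f" and f: "\<And>j. j \<le> n + 1 \<Longrightarrow> f j = frame_of n (q, g) j"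
  shows "fst W = q" "snd W = g \<or> snd W = - g"
proof -
  obtain h where h: "W = (q, h)" "h \<in> Spin (n + 2)"
    using W unfolding lifts_frame_def SFr_def by (cases W) auto
  have "h = g \<or> h = - g"
    by (rule spin_frame_unique[OF q h(2) g]) (use W f h in \<open>auto simp: lifts_frame_def\<close>)
  then show "fst W = q" "snd W = g \<or> snd W = - g" by (simp_all add: h)
qed

lemma Spin_inner: "s \<in> Spin m \<Longrightarrow> inner s s = 1"
  by (simp add: Spin_iff)

lemma outward_spin_frame_sign:
  assumes lift: "continuous_spin_lift n \<Psi>"
  obtains \<epsilon> :: real where "\<epsilon> = 1 \<or> \<epsilon> = -1"
    "\<And>\<kappa> q. \<kappa> \<in> SGamma (n + 1) \<Longrightarrow> q \<in> horosphere n (null_vec \<kappa>) \<Longrightarrow>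
      snd (snd (\<Psi> \<kappa>)) q = (q, \<epsilon> *\<^sub>R spin_of n \<kappa> q)"
proof -
  let ?E = "pointed_horospheres n" and ?W = "\<lambda>(\<kappa>, q). snd (snd (\<Psi> \<kappa>)) q" and ?g = "\<lambda>(\<kappa>, q). spin_of n \<kappa> q"
  have W: "fst (?W (\<kappa>, q)) = q" "snd (?W (\<kappa>, q)) = ?g (\<kappa>, q) \<or> snd (?W (\<kappa>, q)) = - ?g (\<kappa>, q)"
    if "\<kappa> \<in> SGamma (n + 1)" "q \<in> horosphere n (null_vec \<kappa>)" for \<kappa> q
  proof -
    have "\<Psi> \<kappa> \<in> SHor n" "fst (\<Psi> \<kappa>) = Phi n \<kappa>"
      using lift that(1) by (auto simp: continuous_spin_lift_def)
    then obtain W_in W_out where \<Psi>: "\<Psi> \<kappa> = (Phi n \<kappa>, W_in, W_out)" "W_out \<in> outward_spin_frames n (Phi n \<kappa>)"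
      by (cases "\<Psi> \<kappa>") (auto simp: SHor_def)
    then have l: "lifts_frame n (W_out q) q (F_out n (Phi n \<kappa>) q)"
      using that(2) by (simp add: outward_spin_frames_def)
    have q: "q \<in> hyp n" using that(2) by (simp add: horosphere_iff)
    show "fst (?W (\<kappa>, q)) = q" "snd (?W (\<kappa>, q)) = ?g (\<kappa>, q) \<or> snd (?W (\<kappa>, q)) = - ?g (\<kappa>, q)"
      using lifts_frame_spin_of[OF that(1) q spin_of_Spin[OF that(1) q] l] F_out_Phi[OF that] by (simp_all add: \<Psi>)
  qed
  have "(\<forall>x\<in>?E. snd (?W x) = ?g x) \<or> (\<forall>x\<in>?E. snd (?W x) = - ?g x)"
  proof (rule connected_sign_constant[OF connected_pointed_horospheres])
    have "continuous_on ?E ?W"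
      using lift by (simp add: continuous_spin_lift_def Let_def pointed_horospheres_def)
    then show "continuous_on ?E (\<lambda>x. snd (?W x))" by (rule continuous_on_snd)
    show "continuous_on ?E ?g" by (rule continuous_on_spin_of_pointed)
    fix x assume "x \<in> ?E"
    then obtain \<kappa> q where x: "x = (\<kappa>, q)" "\<kappa> \<in> SGamma (n + 1)" "q \<in> horosphere n (null_vec \<kappa>)"
      by (auto simp: pointed_horospheres_def)
    show "inner (?g x) (?g x) = 1"
      using spin_of_Spin[OF x(2), of q] x by (simp add: horosphere_iff Spin_inner)
    show "snd (?W x) = ?g x \<or> snd (?W x) = - ?g x" unfolding x(1) by (rule W(2)[OF x(2,3)])
  qed
  then show thesis
  proof
    assume "\<forall>x\<in>?E. snd (?W x) = ?g x"
    then show thesis using W(1) by (intro that[of 1]) (auto simp: pointed_horospheres_def prod_eq_iff)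
  next
    assume "\<forall>x\<in>?E. snd (?W x) = - ?g x"
    then show thesis using W(1) by (intro that[of "-1"]) (auto simp: pointed_horospheres_def prod_eq_iff)
  qed
qed

text \<open>The one-parameter group exp (- \<theta> i_(n+1) / 2); the angle is halved because
  \<open>sigma\<close> multiplies on both sides. It starts at 1 and reaches -i_(n+1) at \<theta> =
  pi.\<close>

definition rotor :: "nat \<Rightarrow> real \<Rightarrow> cl" where
  "rotor n \<theta> = cos (\<theta> / 2) *\<^sub>R 1 - sin (\<theta> / 2) *\<^sub>R gen (n + 1)"

lemma rotor_Spin: "rotor n \<theta> \<in> Spin (n + 2)"
proof -
  have p: "rotor n \<theta> \<in> paravectors (n + 2)"
    unfolding rotor_def by (intro paravectors_linear gen_in_paravectors) auto
  have i: "inner (rotor n \<theta>) (rotor n \<theta>) = 1"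
    using sin_cos_squared_add3[of "\<theta> / 2"] by (simp add: rotor_def inner_simps)
  then have "rotor n \<theta> \<noteq> 0" by auto
  then show ?thesis using Gamma.gen[OF p] i by (simp add: Spin_iff)
qed

text \<open>The rotor commutes with 1 and i_(n+1), on which \<open>sigma\<close> is therefore
  multiplication by its square. Passing it through i_k with k <= n conjugates it, so there the two
  factors cancel.\<close>

lemma sigma_rotor:
  "sigma (rotor n \<theta>) (gen (n + 1)) = cos \<theta> *\<^sub>R gen (n + 1) + sin \<theta> *\<^sub>R 1"
  "sigma (rotor n \<theta>) 1 = cos \<theta> *\<^sub>R 1 - sin \<theta> *\<^sub>R gen (n + 1)"
  "k \<le> n \<Longrightarrow> sigma (rotor n \<theta>) (gen k) = gen k"
proof -
  let ?i = "gen (n + 1)" and ?c = "cos (\<theta> / 2)" and ?s = "sin (\<theta> / 2)"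
  have c: "cos \<theta> = ?c * ?c - ?s * ?s" and s: "sin \<theta> = 2 * (?s * ?c)"
    using cos_double[of "\<theta> / 2"] sin_double[of "\<theta> / 2"] by (simp_all add: power2_eq_square)
  have 1: "?c * ?c + ?s * ?s = 1" using sin_cos_squared_add3[of "\<theta> / 2"] by simp
  have star: "cl_star (rotor n \<theta>) = rotor n \<theta>" by (simp add: rotor_def)
  have r2: "rotor n \<theta> * rotor n \<theta> = cos \<theta> *\<^sub>R 1 - sin \<theta> *\<^sub>R ?i"
    unfolding c s rotor_def
    by (simp add: algebra_simps gen_square[of "Suc n", simplified]) (simp add: scaleR_2 mult.commute flip: scaleR_scaleR)
  then show "sigma (rotor n \<theta>) 1 = cos \<theta> *\<^sub>R 1 - sin \<theta> *\<^sub>R ?i" by (simp add: sigma_def star)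
  have "rotor n \<theta> * ?i = ?i * rotor n \<theta>" by (simp add: rotor_def algebra_simps)
  then have "sigma (rotor n \<theta>) ?i = ?i * (rotor n \<theta> * rotor n \<theta>)" by (simp add: sigma_def star mult.assoc)
  also have "\<dots> = cos \<theta> *\<^sub>R ?i + sin \<theta> *\<^sub>R 1" unfolding r2 by (simp add: right_diff_distrib gen_square)
  finally show "sigma (rotor n \<theta>) ?i = cos \<theta> *\<^sub>R ?i + sin \<theta> *\<^sub>R 1" .
  show "sigma (rotor n \<theta>) (gen k) = gen k" if "k \<le> n"
  proof -
    have "gen k * ?i = - (?i * gen k)" using that by (intro gen_anticommute) simp
    then have "rotor n \<theta> * gen k = gen k * (?c *\<^sub>R 1 + ?s *\<^sub>R ?i)"
      by (simp add: rotor_def algebra_simps)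
    then have "sigma (rotor n \<theta>) (gen k) = gen k * ((?c *\<^sub>R 1 + ?s *\<^sub>R ?i) * rotor n \<theta>)"
      by (simp only: sigma_def star mult.assoc)
    also have "(?c *\<^sub>R 1 + ?s *\<^sub>R ?i) * rotor n \<theta> = (?c * ?c) *\<^sub>R 1 + (?s * ?s) *\<^sub>R 1"
      unfolding rotor_def by (simp add: algebra_simps gen_square[of "Suc n", simplified])
    also have "\<dots> = (?c * ?c + ?s * ?s) *\<^sub>R 1" by (simp only: scaleR_left_distrib)
    finally show ?thesis unfolding 1 by simp
  qed
qed

lemma frame_of_rotor:
  assumes q: "q \<in> hyp n" and g: "g \<in> Spin (n + 2)" and k: "k \<le> n + 1"
  shows "frame_of n (q, g * rotor n \<theta>) k = rotate_frame n \<theta> (frame_of n (q, g)) k"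
proof (rule frame_of_eqI[OF q])
  note f = frame_of_props[OF q g]
  show "rotate_frame n \<theta> (frame_of n (q, g)) k \<in> tangent_hyp n q"
    using f(1) by (simp add: rotate_frame_def tangent_hyp_linear)
  consider "k = 0" | "1 \<le> k" "k \<le> n" | "k = n + 1" using k by linarith
  then show "cof n q (rotate_frame n \<theta> (frame_of n (q, g)) k) = sigma (g * rotor n \<theta>) (std_basis n k)"
  proof cases
    case 1
    then show ?thesis using sigma_rotor(1)[of n \<theta>] by (simp add: rotate_frame_def f(2) sigma_mult std_basis_def)
  next
    case 2
    then show ?thesis using sigma_rotor(3)[of k n \<theta>] by (simp add: rotate_frame_def f(2) sigma_mult std_basis_def)
  next
    case 3
    then show ?thesis using sigma_rotor(2)[of n \<theta>] by (simp add: rotate_frame_def f(2) sigma_mult std_basis_def)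
  qed
qed

lemma continuous_on_rotor: "continuous_on S (rotor n)"
  unfolding rotor_def[abs_def] by (intro continuous_intros) simp_all

text \<open>The path P from \<open>associated\<close> and right multiplication by the rotor lift the
  same rotating frames and agree at \<theta> = 0, so they agree at pi.\<close>

lemma inward_spin_frame_eq:
  assumes k: "\<kappa> \<in> SGamma (n + 1)" and q: "q \<in> horosphere n (null_vec \<kappa>)"
    and assoc: "associated n (Phi n \<kappa>) W_in W_out"
    and out: "W_out q = (q, \<epsilon> *\<^sub>R spin_of n \<kappa> q)" and \<epsilon>: "\<epsilon> = 1 \<or> \<epsilon> = -1"
  shows "W_in q = (q, \<epsilon> *\<^sub>R (- (spin_of n \<kappa> q * gen (n + 1))))"
proof -
  let ?g = "\<epsilon> *\<^sub>R spin_of n \<kappa> q"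
  have qh: "q \<in> hyp n" using q by (simp add: horosphere_iff)
  have g: "?g \<in> Spin (n + 2)" using spin_of_Spin[OF k qh] \<epsilon> Spin_uminus by auto
  have same: "frame_of n (q, ?g) = frame_of n (q, spin_of n \<kappa> q)"
    using \<epsilon> by (auto simp: fun_eq_iff frame_of.simps)
  obtain P where P: "continuous_on {0..pi} P" "P 0 = W_out q" "P pi = W_in q"
    "\<And>\<theta>. \<theta> \<in> {0..pi} \<Longrightarrow> lifts_frame n (P \<theta>) q (rotate_frame n \<theta> (F_out n (Phi n \<kappa>) q))"
    using assoc q unfolding associated_def by force
  have Spin: "?g * rotor n \<theta> \<in> Spin (n + 2)" for \<theta> by (rule Spin_mult[OF g rotor_Spin])
  have rot: "rotate_frame n \<theta> (F_out n (Phi n \<kappa>) q) j = frame_of n (q, ?g * rotor n \<theta>) j" if "j \<le> n + 1" for \<theta> j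
    unfolding frame_of_rotor[OF qh g that] same
    using F_out_Phi[OF k q] that by (simp add: rotate_frame_def)
  note lf = lifts_frame_spin_of[OF k qh Spin P(4) rot]
  have "snd (P pi) = ?g * rotor n pi"
  proof (rule connected_sign_eq[where S = "{0..pi}" and ?s0.0 = 0])
    show "continuous_on {0..pi} (\<lambda>\<theta>. snd (P \<theta>))" by (intro continuous_on_snd P(1))
    show "continuous_on {0..pi} (\<lambda>\<theta>. ?g * rotor n \<theta>)"
      using g rotor_Spin Gamma_clsub
      by (intro continuous_on_cl_mult[where m = "n + 2"] continuous_intros continuous_on_rotor) (auto simp: Spin_iff)
    show "snd (P 0) = ?g * rotor n 0" by (simp add: P(2) out rotor_def)
  qed (use lf(2) Spin_inner[OF Spin] in auto)
  moreover have "fst (P pi) = q" by (rule lf(1)) auto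
  ultimately show ?thesis by (simp add: prod_eq_iff P(3) rotor_def)
qed

section \<open>Parallel transport along a geodesic\<close>

text \<open>Pairings between vectors of two parallel frames are constant, so they keep their values
  at \<open>t1\<close> and the frames agree everywhere. The lifts then agree up to a sign, which is
  fixed at \<open>t1\<close>.\<close>

lemma parallel_spin_frame_unique:
  assumes W: "parallel_spin_frame n \<gamma> W" and W': "parallel_spin_frame n \<gamma> W'" and eq: "W t1 = W' t1"
  shows "W t = W' t"
proof -
  define G G' where "G = (\<lambda>t. snd (W t))" and "G' = (\<lambda>t. snd (W' t))"
  have SFr: "W t \<in> SFr n" "fst (W t) = \<gamma> t" "W' t \<in> SFr n" "fst (W' t) = \<gamma> t" for t
    using W W' unfolding parallel_spin_frame_def by blast+
  have WG: "W = (\<lambda>t. (\<gamma> t, G t))" "W' = (\<lambda>t. (\<gamma> t, G' t))"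
    using SFr(2,4) unfolding G_def G'_def fun_eq_iff by (metis prod.collapse)+
  have g: "G t \<in> Spin (n + 2)" "G' t \<in> Spin (n + 2)" and h: "\<gamma> t \<in> hyp n" for t
    using SFr(1,3)[of t] unfolding WG SFr_def by auto
  have tan: "frame_of n (\<gamma> t, G t) k \<in> tangent_hyp n (\<gamma> t)" "frame_of n (\<gamma> t, G' t) k \<in> tangent_hyp n (\<gamma> t)" for t k
    using frame_of_props(1)[OF h g(1)] frame_of_props(1)[OF h g(2)] by blast+
  have const: "mform (frame_of n (\<gamma> t, G t) k) (frame_of n (\<gamma> t, G' t) l) = (if k = l then -1 else 0)"
    if kl: "k \<le> n + 1" "l \<le> n + 1" for k l t
  proof -
    let ?m = "\<lambda>t. mform (frame_of n (\<gamma> t, G t) k) (frame_of n (\<gamma> t, G' t) l)"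
    have "parallel_along (tangent_hyp n) \<gamma> (\<lambda>t. frame_of n (\<gamma> t, G t) k)"
      using W kl(1) unfolding parallel_spin_frame_def WG by blast
    then obtain U where U: "\<And>t. ((\<lambda>t. frame_of n (\<gamma> t, G t) k) has_vector_derivative U t) (at t)"
      "\<And>t u. u \<in> tangent_hyp n (\<gamma> t) \<Longrightarrow> mform (U t) u = 0"
      unfolding parallel_along_def by blast
    have "parallel_along (tangent_hyp n) \<gamma> (\<lambda>t. frame_of n (\<gamma> t, G' t) l)"
      using W' kl(2) unfolding parallel_spin_frame_def WG by blast
    then obtain V where V: "\<And>t. ((\<lambda>t. frame_of n (\<gamma> t, G' t) l) has_vector_derivative V t) (at t)"
      "\<And>t u. u \<in> tangent_hyp n (\<gamma> t) \<Longrightarrow> mform (V t) u = 0"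
      unfolding parallel_along_def by blast
    have "(?m has_vector_derivative (mform (frame_of n (\<gamma> t, G t) k) (V t) + mform (U t) (frame_of n (\<gamma> t, G' t) l))) (at t)" for t
      by (rule mform_has_vector_derivative[OF U(1) V(1)])
    moreover have "mform (frame_of n (\<gamma> t, G t) k) (V t) = 0" "mform (U t) (frame_of n (\<gamma> t, G' t) l) = 0" for t
      using U(2)[OF tan(2)] V(2)[OF tan(1)] mform_commute by simp_all
    ultimately have 0: "(?m has_vector_derivative 0) (at t)" for t by simp
    obtain c where c: "\<And>t. t \<in> UNIV \<Longrightarrow> ?m t = c"
      by (rule has_vector_derivative_zero_constant[OF convex_UNIV 0]) blast
    have "G t1 = G' t1" using eq by (simp add: WG)
    then have "?m t1 = (if k = l then -1 else 0)"
      using frame_of_orthonormal[OF h g(2)[of t1] kl] by simp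
    then show ?thesis using c[of t] c[of t1] by simp
  qed
  have same: "frame_of n (\<gamma> t, G t) k = frame_of n (\<gamma> t, G' t) k" if k: "k \<le> n + 1" for k t
  proof -
    have "frame_of n (\<gamma> t, G t) k - frame_of n (\<gamma> t, G' t) k = 0"
    proof (rule tangent_eq_0_of_frame[OF h g(2)])
      show "frame_of n (\<gamma> t, G t) k - frame_of n (\<gamma> t, G' t) k \<in> tangent_hyp n (\<gamma> t)"
        using tan by (intro tangent_hyp_linear)
      show "mform (frame_of n (\<gamma> t, G t) k - frame_of n (\<gamma> t, G' t) k) (frame_of n (\<gamma> t, G' t) l) = 0" if "l \<le> n + 1" for l
        using const[OF k that, of t] frame_of_orthonormal[OF h[of t] g(2)[of t] k that] by simp
    qed
    then show ?thesis by simp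
  qed
  have "G t = G' t"
  proof (rule connected_sign_eq[where S = UNIV and ?s0.0 = t1])
    show "continuous_on UNIV G" "continuous_on UNIV G'"
      using W W' unfolding parallel_spin_frame_def G_def G'_def by (auto intro: continuous_on_snd)
    show "G t = G' t \<or> G t = - G' t" for t
      by (rule spin_frame_unique[OF h g(1,2)]) (rule same)
  qed (use g(2) Spin_inner eq in \<open>auto simp: WG\<close>)
  then show ?thesis by (simp add: WG)
qed

text \<open>Over the horosphere this is the inward spin frame up to the common sign. The formula
  also makes sense off the horosphere, where it gives the parallel transport along the geodesics
  from the centre.\<close>

definition transported_spin :: "nat \<Rightarrow> column \<Rightarrow> mvec \<Rightarrow> cl" where
  "transported_spin n \<kappa> q = - (spin_of n \<kappa> q * gen (n + 1))"

lemma transported_spin_rotor: "transported_spin n \<kappa> q = spin_of n \<kappa> q * rotor n pi"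
  by (simp add: transported_spin_def rotor_def)

lemma transported_spin_Spin:
  "\<kappa> \<in> SGamma (n + 1) \<Longrightarrow> q \<in> hyp n \<Longrightarrow> transported_spin n \<kappa> q \<in> Spin (n + 2)"
  unfolding transported_spin_rotor by (intro Spin_mult spin_of_Spin rotor_Spin)

text \<open>Along the geodesics that emanate from the centre, the first frame vector is the velocity and
  the others are constant vectors of Minkowski space.\<close>

lemma parallel_transported_spin:
  assumes k: "\<kappa> \<in> SGamma (n + 1)" and A: "A \<in> light_cone n" and B: "B \<in> light_cone n"
    and AB: "mform A B = 1 / 2" and a: "B = a *\<^sub>R null_vec \<kappa>" and \<epsilon>: "\<epsilon> = 1 \<or> \<epsilon> = -1"
    and \<gamma>: "\<And>t. \<gamma> t = exp t *\<^sub>R A + exp (- t) *\<^sub>R B"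
  shows "parallel_spin_frame n \<gamma> (\<lambda>t. (\<gamma> t, \<epsilon> *\<^sub>R transported_spin n \<kappa> (\<gamma> t)))"
proof -
  let ?p = "null_vec \<kappa>" and ?G = "\<lambda>t. spin_of n \<kappa> (\<gamma> t)"
  note g = exp_geodesic[OF A B AB]
  have \<gamma>_eq: "\<gamma> = (\<lambda>t. exp t *\<^sub>R A + exp (- t) *\<^sub>R B)" using \<gamma> by (simp add: fun_eq_iff)
  have h: "\<gamma> t \<in> hyp n" for t using g(1) by (simp add: \<gamma>)
  have GS: "?G t \<in> Spin (n + 2)" for t by (rule spin_of_Spin[OF k h])
  let ?F = "\<lambda>t. frame_of n (\<gamma> t, ?G t)"
  have a0: "a \<noteq> 0" using light_coneD(3)[OF B] a by auto
  have BB: "mform B B = 0" by (rule light_coneD(2)[OF B])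
  have p\<gamma>: "mform (\<gamma> t) ?p = exp t / (2 * a)" for t
  proof -
    have "mform (\<gamma> t) B = exp t / 2" unfolding \<gamma> using AB BB by simp
    then show ?thesis unfolding a using a0 by (simp add: field_simps)
  qed
  have p: "mform ?p ?p = 0" "mform (\<gamma> t) ?p > 0" for t
    using light_coneD(2)[OF null_vec_light_cone[OF k]] mform_hyp_light_pos[OF h null_vec_light_cone[OF k]] by auto
  have F0: "?F t 0 = (1 / mform (\<gamma> t) ?p) *\<^sub>R ?p - \<gamma> t" for t
    using normal_frame_vector[OF k h] by (intro frame_of_eqI[OF h]) (auto simp: std_basis_def)
  \<comment> \<open>The normal towards the centre points backwards along a geodesic that comes from
    the centre.\<close>
  have F0': "?F t 0 = - (exp t *\<^sub>R A - exp (- t) *\<^sub>R B)" for t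
  proof -
    have "(1 / mform (\<gamma> t) ?p) *\<^sub>R ?p = (2 * exp (- t)) *\<^sub>R B"
      unfolding p\<gamma> a by (simp add: exp_minus field_simps)
    also have "\<dots> = exp (- t) *\<^sub>R B + exp (- t) *\<^sub>R B" by (simp flip: scaleR_left_distrib)
    finally have e: "(1 / mform (\<gamma> t) ?p) *\<^sub>R ?p = exp (- t) *\<^sub>R B + exp (- t) *\<^sub>R B" .
    show ?thesis unfolding F0 e by (simp add: \<gamma> algebra_simps)
  qed
  \<comment> \<open>The vectors at times t and 0 differ by a multiple of p. The vector at time 0 is
    orthogonal to p and to \<gamma> 0, hence to A and to every \<gamma> t; tangency at \<gamma> t
    then makes this multiple zero.\<close>
  have const: "?F t j = ?F 0 j" if j: "1 \<le> j" "j \<le> n + 1" for t j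
  proof -
    have "std_basis n j \<in> paravectors (n + 1)"
      using j by (auto simp: std_basis_def intro: gen_in_paravectors paravectors_linear)
    from frame_of_tangential[OF k refl this] obtain L
      where L: "\<And>q. q \<in> hyp n \<Longrightarrow> \<exists>\<rho>. frame_of n (q, spin_of n \<kappa> q) j = L + \<rho> *\<^sub>R ?p" by metis
    obtain r where r: "?F t j = L + r *\<^sub>R ?p" using L[OF h] by blast
    obtain r' where r': "?F 0 j = L + r' *\<^sub>R ?p" using L[OF h] by blast
    have F\<gamma>: "mform (?F t j) (\<gamma> t) = 0" for t
      using frame_of_props(1)[OF h GS] by (simp add: tangent_hyp_iff)
    have Fp: "mform (?F t j) ?p = 0" for t
      using frame_of_orthonormal[OF h[of t] GS[of t] j(2), of 0] j F\<gamma>[of t] p(2)[of t] by (simp add: F0)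
    have "mform (?F 0 j) A = 0"
      using F\<gamma>[of 0] Fp[of 0] by (simp only: \<gamma> a mform_linear) simp
    then have "mform (?F 0 j) (\<gamma> t) = 0"
      using Fp[of 0] by (simp only: \<gamma> a mform_linear mult_zero_right add_0)
    moreover have "?F t j = ?F 0 j + (r - r') *\<^sub>R ?p" by (simp add: r r' algebra_simps)
    ultimately have "(r - r') * mform ?p (\<gamma> t) = 0" using F\<gamma>[of t] by (simp only: mform_linear add_0)
    then have "r = r'" using p(2)[of t] by (simp add: mform_commute[of ?p "\<gamma> t"])
    then show ?thesis by (simp add: r r')
  qed
  have same: "frame_of n (\<gamma> t, \<epsilon> *\<^sub>R transported_spin n \<kappa> (\<gamma> t)) j = rotate_frame n pi (?F t) j" if "j \<le> n + 1" for t j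
    using frame_of_rotor[OF h[of t] GS[of t] that, of pi] \<epsilon>
    by (auto simp: transported_spin_rotor[symmetric] frame_of.simps)
  have TS: "\<epsilon> *\<^sub>R transported_spin n \<kappa> (\<gamma> t) \<in> Spin (n + 2)" for t
    using transported_spin_Spin[OF k h] Spin_uminus \<epsilon> by auto
  show ?thesis
    unfolding parallel_spin_frame_def
  proof (intro conjI allI impI)
    have c: "continuous_on UNIV \<gamma>" unfolding \<gamma>_eq by (intro continuous_intros)
    have "continuous_on UNIV (\<lambda>t. ?G t * gen (n + 1))"
    proof (rule continuous_on_cl_mult[where m = "n + 2"])
      show "continuous_on UNIV ?G" by (intro continuous_on_spin_of c continuous_intros) (use h k in auto)
      show "?G t \<in> clsub (n + 2)" for t using GS Gamma_clsub by (simp add: Spin_iff)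
      show "gen (n + 1) \<in> clsub (n + 2)" using gen_in_paravectors[of "n + 1" "n + 2"] paravectors_clsub by auto
    qed (rule continuous_on_const)
    then show "continuous_on UNIV (\<lambda>t. (\<gamma> t, \<epsilon> *\<^sub>R transported_spin n \<kappa> (\<gamma> t)))"
      unfolding transported_spin_def by (intro continuous_intros c)
    show "(\<gamma> t, \<epsilon> *\<^sub>R transported_spin n \<kappa> (\<gamma> t)) \<in> SFr n" "fst (\<gamma> t, \<epsilon> *\<^sub>R transported_spin n \<kappa> (\<gamma> t)) = \<gamma> t" for t
      using h TS by (simp_all add: SFr_def)
    fix j assume j: "j \<le> n + 1"
    let ?f = "\<lambda>t. frame_of n (\<gamma> t, \<epsilon> *\<^sub>R transported_spin n \<kappa> (\<gamma> t)) j"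
    have tan: "?f t \<in> tangent_hyp n (\<gamma> t)" for t by (rule frame_of_props(1)[OF h TS])
    show "parallel_along (tangent_hyp n) \<gamma> ?f"
    proof (cases "j = 0")
      case True
      \<comment> \<open>Rotation by pi negates the first vector, which turns it into the
        velocity.\<close>
      then have f: "?f = (\<lambda>t. exp t *\<^sub>R A - exp (- t) *\<^sub>R B)" 
        using same[OF j] by (simp add: fun_eq_iff rotate_frame_def F0')
      show ?thesis
        unfolding parallel_along_def
      proof (intro exI[of _ \<gamma>] allI conjI ballI tan)
        show "(?f has_vector_derivative \<gamma> t) (at t)" for t
          unfolding f using g(5)[of t] by (simp only: \<gamma>)
        show "mform (\<gamma> t) u = 0" if "u \<in> tangent_hyp n (\<gamma> t)" for t u
          using that by (simp add: tangent_hyp_iff mform_commute[of "\<gamma> t" u])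
      qed
    next
      case False
      \<comment> \<open>Rotation by pi fixes the middle vectors and negates the last one, so
        constancy survives.\<close>
      then have "?f t = ?f 0" for t
        using same[OF j] const[of j] const[of "n + 1"] j by (simp add: rotate_frame_def)
      then have f: "?f = (\<lambda>t. ?f 0)" by blast
      show ?thesis
        unfolding parallel_along_def
      proof (intro exI[of _ "\<lambda>_. 0"] allI conjI ballI tan)
        show "(?f has_vector_derivative 0) (at t)" for t by (subst f) (rule has_vector_derivative_const)
      qed simp
    qed
  qed
qed

section \<open>The bracket\<close>

text \<open>Proportional null vectors belong to the same centre. If both columns are
  \<open>(a * s, s)\<close> with the same \<open>a\<close>, the two terms of the bracket coincide;
  mixed cases are excluded by T - Z, which vanishes exactly for the centre at infinity.\<close>

lemma bracket_eq_0:
  assumes "\<kappa> \<in> SGamma m" "\<kappa>' \<in> SGamma m" "null_vec \<kappa>' = c *\<^sub>R null_vec \<kappa>" "c > 0"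
  shows "bracket \<kappa> \<kappa>' = 0"
  using assms(1)
proof (cases rule: SGamma_cases)
  case (1 s)
  from assms(2) show ?thesis
  proof (cases rule: SGamma_cases)
    case (1 s')
    then show ?thesis using \<open>\<kappa> = (s, 0)\<close> by simp
  next
    case (2 a s')
    then show ?thesis
      using arg_cong[OF assms(3), of height_inv] 1 Gamma_norm(3)[of s']
      by (simp add: null_vec_special height_inv_def algebra_simps)
  qed
next
  case (2 a s)
  note k = 2
  from assms(2) show ?thesis
  proof (cases rule: SGamma_cases)
    case (1 s')
    then show ?thesis
      using arg_cong[OF assms(3), of height_inv] 2 Gamma_norm(3)[of s] assms(4)
      by (simp add: null_vec_special height_inv_def algebra_simps)
  next
    case (2 a' s')
    note s = Gamma_inner_pos[OF 2(2)] Gamma_inner_pos[OF k(2)]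
    have e: "inner s' s' *\<^sub>R (inner a' a' + 1, inner a' a' - 1, 2 *\<^sub>R a') =
        c *\<^sub>R (inner s s *\<^sub>R (inner a a + 1, inner a a - 1, 2 *\<^sub>R a))"
      using assms(3) unfolding k(3) 2(3) null_vec_special(3)[OF k(2,1)] null_vec_special(3)[OF 2(2,1)] .
    have "inner s' s' = c * inner s s"
      using arg_cong[OF e, of height_inv] unfolding height_inv_linear by (simp add: height_inv_def)
    moreover have "(inner s' s') *\<^sub>R a' = (c * inner s s) *\<^sub>R a"
    proof -
      have "(inner s' s' * 2) *\<^sub>R a' = (c * inner s s * 2) *\<^sub>R a"
        using arg_cong[OF e, of "\<lambda>u. snd (snd u)"] by simp
      then have "(1 / 2) *\<^sub>R ((inner s' s' * 2) *\<^sub>R a') = (1 / 2) *\<^sub>R ((c * inner s s * 2) *\<^sub>R a)" by simp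
      then show ?thesis by simp
    qed
    ultimately have "a' = a" using s by (metis less_irrefl real_vector.scale_left_imp_eq)
    then show ?thesis
      by (simp add: k(3) 2(3) cl_star_mult paravector_star[OF k(1)] mult.assoc)
  qed
qed

text \<open>For two finite centres the bracket factors as \<open>cl_star s * (a - a') * s'\<close>,
  which is zero or a product of group elements.\<close>

lemma bracket_Gamma0:
  assumes "\<kappa> \<in> SGamma m" "\<kappa>' \<in> SGamma m"
  shows "bracket \<kappa> \<kappa>' \<in> Gamma0 m"
proof -
  have mult: "x * y \<in> Gamma0 m" if "x \<in> Gamma m" "y \<in> Gamma0 m" for x y
    using that by (auto simp: Gamma0_def intro: Gamma.mult)
  have neg: "- x \<in> Gamma0 m" if "x \<in> Gamma0 m" for x
    using that Gamma_scale[of x m "-1"] by (auto simp: Gamma0_def)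
  have k': "snd \<kappa>' \<in> Gamma0 m" "fst \<kappa>' \<in> Gamma0 m" using assms(2) by (auto simp: SGamma_def)
  show ?thesis
    using assms(1)
  proof (cases rule: SGamma_cases)
    case (1 s)
    then show ?thesis using mult[OF Gamma_star[OF 1(1)] k'(1)] by (cases \<kappa>') simp
  next
    case (2 a s)
    note k = 2
    from assms(2) show ?thesis
    proof (cases rule: SGamma_cases)
      case (1 s')
      then show ?thesis using neg[OF mult[OF Gamma_star[OF 2(2)] k'(2)]] 2 by simp
    next
      case (2 a' s')
      have "a - a' \<in> paravectors m" using k(1) 2(1) by (intro paravectors_linear)
      then have "(a - a') * s' \<in> Gamma0 m"
        using 2(2) by (cases "a = a'") (auto simp: Gamma0_def intro!: Gamma.mult[OF Gamma.gen])
      from mult[OF Gamma_star[OF k(2)] this] show ?thesis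
        by (simp add: k(3) 2(3) cl_star_mult paravector_star[OF k(1)] algebra_simps)
    qed
  qed
qed

text \<open>On the geodesic between the two centres, \<open>\<alpha> p\<^sub>1 + \<beta> p\<^sub>2 = q\<close> makes all terms without
  \<open>i\<^bsub>n+1\<^esub>\<close> cancel, separately for \<open>\<alpha>\<close> and for \<open>\<beta>\<close>.\<close>

lemma conj_col_eval_times_col_eval:
  assumes k1: "\<kappa>1 \<in> SGamma (n + 1)" and k2: "\<kappa>2 \<in> SGamma (n + 1)" and q: "q \<in> hyp n"
    and comb: "q = \<alpha> *\<^sub>R null_vec \<kappa>1 + \<beta> *\<^sub>R null_vec \<kappa>2"
  shows "cl_conj (col_eval n \<kappa>1 q) * col_eval n \<kappa>2 q = - (1 / height_inv q) *\<^sub>R (gen (n + 1) * bracket \<kappa>1 \<kappa>2)"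
proof -
  obtain x1 y1 x2 y2 where xy: "\<kappa>1 = (x1, y1)" "\<kappa>2 = (x2, y2)" by (cases \<kappa>1; cases \<kappa>2)
  let ?i = "gen (n + 1)" and ?Q = "uhs_point n q" and ?X = "snd (snd q)" and ?h = "height_inv q"
  let ?e = "fst q + fst (snd q)"
  have G: "x1 \<in> Gamma0 (n + 1)" "y1 \<in> Gamma0 (n + 1)" "x2 \<in> Gamma0 (n + 1)" "y2 \<in> Gamma0 (n + 1)"
    using k1 k2 by (auto simp: xy SGamma_def)
  note N = Gamma0_norm[OF G(1)] Gamma0_norm[OF G(2)] Gamma0_norm[OF G(3)] Gamma0_norm[OF G(4)]
  note p = null_vec_eq[OF k1[unfolded xy]] null_vec_eq[OF k2[unfolded xy]]
  have r: "?h > 0" by (rule height_inv_pos[OF q])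
  have h: "?h = 2 * (\<alpha> * inner y1 y1 + \<beta> * inner y2 y2)"
    unfolding comb xy p height_inv_linear by (simp add: height_inv_def algebra_simps)
  have e: "?e = 2 * (\<alpha> * inner x1 x1 + \<beta> * inner x2 x2)"
    unfolding comb xy p by (simp add: algebra_simps)
  have X: "?X = (2 * \<alpha>) *\<^sub>R (x1 * cl_conj y1) + (2 * \<beta>) *\<^sub>R (x2 * cl_conj y2)"
    unfolding comb xy p by (simp add: mult.commute)
  have X': "cl_conj ?X = (2 * \<alpha>) *\<^sub>R (y1 * cl_conj x1) + (2 * \<beta>) *\<^sub>R (y2 * cl_conj x2)"
    unfolding X by (simp add: cl_conj_mult)
  let ?u = "cl_conj x1 * x2" and ?v = "cl_conj y1 * y2"
  \<comment> \<open>In each summand of \<open>?X\<close> an entry meets its own conjugate, which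
    gives a real number, so only multiples of \<open>?u\<close> and \<open>?v\<close>
    remain.\<close>
  have t1: "cl_conj x1 * ?X * y2 = (2 * \<alpha> * inner x1 x1) *\<^sub>R ?v + (2 * \<beta> * inner y2 y2) *\<^sub>R ?u"
  proof -
    have "cl_conj x1 * ?X * y2 = (2 * \<alpha>) *\<^sub>R ((cl_conj x1 * x1) * ?v) + (2 * \<beta>) *\<^sub>R (?u * (cl_conj y2 * y2))"
      unfolding X by (simp add: distrib_left distrib_right mult.assoc)
    then show ?thesis unfolding N by (simp add: cl_times_of_real)
  qed
  have t2: "cl_conj y1 * cl_conj ?X * x2 = (2 * \<alpha> * inner y1 y1) *\<^sub>R ?u + (2 * \<beta> * inner x2 x2) *\<^sub>R ?v"
  proof -
    have "cl_conj y1 * cl_conj ?X * x2 = (2 * \<alpha>) *\<^sub>R ((cl_conj y1 * y1) * ?u) + (2 * \<beta>) *\<^sub>R (?v * (cl_conj x2 * x2))"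
      unfolding X' by (simp add: distrib_left distrib_right mult.assoc)
    then show ?thesis unfolding N by (simp add: cl_times_of_real)
  qed
  \<comment> \<open>Moving i_(n+1) to the left turns conjugation into reversal; this is how the
    stars of the bracket arise.\<close>
  have comm: "cl_conj x * ?i = ?i * cl_star x" if "x \<in> Gamma0 (n + 1)" for x
    using gen_times_clsub[OF clsub_involutions(2)[OF Gamma0_clsub[OF that]], of "n + 1"] by (simp add: cl_star_prime)
  have QQ: "cl_conj ?Q * ?Q = of_real (?e / ?h)"
    using paravector_norm(2)[OF uhs_point_paravector[OF q]] inner_uhs_point(1)[OF q] by simp
  have q1: "cl_conj x1 * ?Q * y2 = (1 / ?h) *\<^sub>R (cl_conj x1 * ?X * y2 + ?i * (cl_star x1 * y2))"
  proof -
    have "cl_conj x1 * ?Q * y2 = (1 / ?h) *\<^sub>R (cl_conj x1 * ?X * y2 + (cl_conj x1 * ?i) * y2)"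
      by (simp add: uhs_point_def distrib_left distrib_right)
    then show ?thesis by (simp only: comm[OF G(1)] mult.assoc)
  qed
  have q2: "cl_conj y1 * cl_conj ?Q * x2 = (1 / ?h) *\<^sub>R (cl_conj y1 * cl_conj ?X * x2 - ?i * (cl_star y1 * x2))"
  proof -
    have "cl_conj y1 * cl_conj ?Q * x2 = (1 / ?h) *\<^sub>R (cl_conj y1 * cl_conj ?X * x2 - (cl_conj y1 * ?i) * x2)"
      by (simp add: uhs_point_def left_diff_distrib right_diff_distrib)
    then show ?thesis by (simp only: comm[OF G(2)] mult.assoc)
  qed
  have "cl_conj (col_eval n \<kappa>1 q) * col_eval n \<kappa>2 q =
      ?u - cl_conj x1 * ?Q * y2 - cl_conj y1 * cl_conj ?Q * x2 + cl_conj y1 * (cl_conj ?Q * ?Q) * y2"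
    by (simp add: col_eval_def xy cl_conj_mult algebra_simps)
  also have "\<dots> = (1 / ?h) *\<^sub>R (?h *\<^sub>R ?u - (cl_conj x1 * ?X * y2 + ?i * (cl_star x1 * y2))
      - (cl_conj y1 * cl_conj ?X * x2 - ?i * (cl_star y1 * x2)) + ?e *\<^sub>R ?v)"
    unfolding q1 q2 QQ using r by (simp add: scaleR_right_distrib scaleR_right_diff_distrib cl_times_of_real)
  \<comment> \<open>The multiples of \<open>?u\<close> cancel against \<open>?h\<close>, which
    collects the norms of the second entries, and those of \<open>?v\<close> against
    \<open>?e\<close>, which collects the norms of the first entries.\<close>
  also have "?h *\<^sub>R ?u - (cl_conj x1 * ?X * y2 + ?i * (cl_star x1 * y2))
      - (cl_conj y1 * cl_conj ?X * x2 - ?i * (cl_star y1 * x2)) + ?e *\<^sub>R ?v = - (?i * bracket \<kappa>1 \<kappa>2)"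
    unfolding t1 t2 h e xy by (simp add: algebra_simps)
  finally show ?thesis by simp
qed

text \<open>Multiplying the product formula on the left by \<open>?y1\<close> removes the conjugate.
  As q lies on the second horosphere, the squared norms of \<open>?y1\<close> and \<open>?y2\<close>
  are z (q|p_1) and z, so normalising leaves the factor 1 / sqrt (q|p_1).\<close>

lemma spin_of_transported:
  assumes k1: "\<kappa>1 \<in> SGamma (n + 1)" and k2: "\<kappa>2 \<in> SGamma (n + 1)" and q: "q \<in> horosphere n (null_vec \<kappa>2)"
    and comb: "q = \<alpha> *\<^sub>R null_vec \<kappa>1 + \<beta> *\<^sub>R null_vec \<kappa>2"
  shows "spin_of n \<kappa>2 q = transported_spin n \<kappa>1 q * ((1 / sqrt (mform q (null_vec \<kappa>1))) *\<^sub>R bracket \<kappa>1 \<kappa>2)"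
proof -
  let ?y1 = "col_eval n \<kappa>1 q" and ?y2 = "col_eval n \<kappa>2 q" and ?h = "height_inv q" and ?m = "mform q (null_vec \<kappa>1)"
  have qh: "q \<in> hyp n" and q2: "mform q (null_vec \<kappa>2) = 1" using q by (auto simp: horosphere_iff)
  have h: "?h > 0" by (rule height_inv_pos[OF qh])
  have m: "?m > 0" by (rule mform_hyp_light_pos[OF qh null_vec_light_cone[OF k1]])
  have n1: "inner ?y1 ?y1 = ?m / ?h" and n2: "inner ?y2 ?y2 = 1 / ?h"
    using inner_col_eval[OF k1 qh] inner_col_eval[OF k2 qh] q2 by simp_all
  then have norms: "norm ?y1 = sqrt ?m / sqrt ?h" "norm ?y2 = 1 / sqrt ?h"
    by (simp_all add: norm_eq_sqrt_inner real_sqrt_divide)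
  have "inner ?y1 ?y1 *\<^sub>R ?y2 = ?y1 * (cl_conj ?y1 * ?y2)"
    by (simp add: mult.assoc[symmetric] Gamma_norm(1)[OF col_eval_Gamma[OF k1 qh]] cl_times_of_real)
  also have "\<dots> = - (1 / ?h) *\<^sub>R (?y1 * gen (n + 1) * bracket \<kappa>1 \<kappa>2)"
    unfolding conj_col_eval_times_col_eval[OF k1 k2 qh comb] by (simp add: mult.assoc)
  finally have "(?h / ?m) *\<^sub>R (inner ?y1 ?y1 *\<^sub>R ?y2) = (?h / ?m) *\<^sub>R (- (1 / ?h) *\<^sub>R (?y1 * gen (n + 1) * bracket \<kappa>1 \<kappa>2))"
    by (rule arg_cong)
  then have y2: "?y2 = (1 / ?m) *\<^sub>R (- (?y1 * gen (n + 1) * bracket \<kappa>1 \<kappa>2))"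
    unfolding n1 using h m by simp
  have "spin_of n \<kappa>2 q = (sqrt ?h / ?m) *\<^sub>R (- (?y1 * gen (n + 1) * bracket \<kappa>1 \<kappa>2))"
    unfolding spin_of_def norms by (subst y2) simp
  also have "sqrt ?h / ?m = (sqrt ?h / sqrt ?m) * (1 / sqrt ?m)"
    using m by (simp add: real_sqrt_mult_self)
  finally show ?thesis
    unfolding transported_spin_def spin_of_def norms by (simp add: mult.assoc)
qed

section \<open>The lambda length\<close>

theorem mainTheorem3:
  fixes n :: nat
    and \<Psi> :: "column \<Rightarrow> spin_decorated"
    and \<xi>\<^sub>1 \<eta>\<^sub>1 \<xi>\<^sub>2 \<eta>\<^sub>2 :: cl
  assumes "continuous_spin_lift n \<Psi>"
    and "(\<xi>\<^sub>1, \<eta>\<^sub>1) \<in> SGamma (n + 1)"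
    and "(\<xi>\<^sub>2, \<eta>\<^sub>2) \<in> SGamma (n + 1)"
  shows "lambda_length n (\<Psi> (\<xi>\<^sub>1, \<eta>\<^sub>1)) (\<Psi> (\<xi>\<^sub>2, \<eta>\<^sub>2)) = bracket (\<xi>\<^sub>1, \<eta>\<^sub>1) (\<xi>\<^sub>2, \<eta>\<^sub>2)
    \<and> bracket (\<xi>\<^sub>1, \<eta>\<^sub>1) (\<xi>\<^sub>2, \<eta>\<^sub>2) = cl_star \<xi>\<^sub>1 * \<eta>\<^sub>2 - cl_star \<eta>\<^sub>1 * \<xi>\<^sub>2"
proof -
  define \<kappa>1 \<kappa>2 where \<kappa>: "\<kappa>1 = (\<xi>\<^sub>1, \<eta>\<^sub>1)" "\<kappa>2 = (\<xi>\<^sub>2, \<eta>\<^sub>2)"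
  have k1: "\<kappa>1 \<in> SGamma (n + 1)" and k2: "\<kappa>2 \<in> SGamma (n + 1)" using assms(2,3) by (simp_all add: \<kappa>)
  let ?p1 = "null_vec \<kappa>1" and ?p2 = "null_vec \<kappa>2" and ?b = "bracket \<kappa>1 \<kappa>2"
  let ?H1 = "horosphere n ?p1" and ?H2 = "horosphere n ?p2" and ?T = "transported_spin n \<kappa>1"
  note p1 = null_vec_light_cone[OF k1] and p2 = null_vec_light_cone[OF k2]
  note p1D = light_coneD[OF p1] and p2D = light_coneD[OF p2]
  have SH1: "\<Psi> \<kappa>1 \<in> SHor n" "fst (\<Psi> \<kappa>1) = Phi n \<kappa>1"
    using assms(1) k1 unfolding continuous_spin_lift_def by blast+
  obtain D1 W1_in W1_out where \<Psi>1: "\<Psi> \<kappa>1 = ((?H1, D1), W1_in, W1_out)" "Phi n \<kappa>1 = (?H1, D1)"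
    using SH1(2) fst_Phi[of n \<kappa>1] by (cases "\<Psi> \<kappa>1"; cases "Phi n \<kappa>1") simp
  have SH2: "\<Psi> \<kappa>2 \<in> SHor n" "fst (\<Psi> \<kappa>2) = Phi n \<kappa>2"
    using assms(1) k2 unfolding continuous_spin_lift_def by blast+
  obtain D2 W2_in W2_out where \<Psi>2: "\<Psi> \<kappa>2 = ((?H2, D2), W2_in, W2_out)" "Phi n \<kappa>2 = (?H2, D2)"
    using SH2(2) fst_Phi[of n \<kappa>2] by (cases "\<Psi> \<kappa>2"; cases "Phi n \<kappa>2") simp
  obtain \<epsilon> where \<epsilon>: "\<epsilon> = 1 \<or> \<epsilon> = -1" and out: "\<And>\<kappa> q. \<kappa> \<in> SGamma (n + 1) \<Longrightarrow> q \<in> horosphere n (null_vec \<kappa>) \<Longrightarrow>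
      snd (snd (\<Psi> \<kappa>)) q = (q, \<epsilon> *\<^sub>R spin_of n \<kappa> q)"
    using outward_spin_frame_sign[OF assms(1)] by metis
  have W2: "W2_out q = (q, \<epsilon> *\<^sub>R spin_of n \<kappa>2 q)" if "q \<in> ?H2" for q
    using out[OF k2 that] by (simp add: \<Psi>2)
  have W1: "W1_in q = (q, \<epsilon> *\<^sub>R ?T q)" if "q \<in> ?H1" for q
    unfolding transported_spin_def
  proof (rule inward_spin_frame_eq[OF k1 that _ _ \<epsilon>])
    show "associated n (Phi n \<kappa>1) W1_in W1_out" using SH1 by (simp add: SHor_def \<Psi>1)
    show "W1_out q = (q, \<epsilon> *\<^sub>R spin_of n \<kappa>1 q)" using out[OF k1 that] by (simp add: \<Psi>1)
  qed
  have "lambda_length n (\<Psi> \<kappa>1) (\<Psi> \<kappa>2) = ?b"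
  proof (cases "ray ?p1 = ray ?p2")
    case True
    then have "?p2 \<in> ray ?p1" using ray_self by simp
    then obtain c where "c > 0" "?p2 = c *\<^sub>R ?p1" unfolding ray_def by blast
    then have "?b = 0" using bracket_eq_0[OF k1 k2] by blast
    then show ?thesis by (simp add: \<Psi>1(1) \<Psi>2(1) centre_null_vec[OF k1] centre_null_vec[OF k2] True)
  next
    case False
    define m where "m = mform ?p1 ?p2"
    have m: "m > 0"
    proof (rule ccontr)
      assume "\<not> m > 0"
      then have "?p2 = (fst ?p2 / fst ?p1) *\<^sub>R ?p1"
        using mform_light_light[OF p1 p2] unfolding m_def by linarith
      then show False using False ray_scale p1D(3) p2D(3) by (metis divide_pos_pos)
    qed
    have m': "mform ?p2 ?p1 = m" by (simp add: m_def mform_commute)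
    \<comment> \<open>Serves both existence and uniqueness: the parametrisation of the geodesic is
      determined only up to a shift, so \<open>a\<close> and \<open>b\<close> stay free. The
      condition at \<open>t1\<close> gives exp t1 b m = 1, which turns (\<gamma> t2|p_1) into exp
      (t2 - t1).\<close>
    have key: "spin_of n \<kappa>2 q = ?T q * ((1 / exp ((t2 - t1) / 2)) *\<^sub>R ?b) \<and> ?T q \<in> Spin (n + 2)"
      if \<gamma>: "\<And>t. \<gamma> t = exp t *\<^sub>R (b *\<^sub>R ?p2) + exp (- t) *\<^sub>R (a *\<^sub>R ?p1)"
        and H: "\<gamma> t1 \<in> ?H1" "\<gamma> t2 \<in> ?H2" and q: "q = \<gamma> t2" for \<gamma> a b t1 t2 q
    proof -
      have 1: "exp t1 * b * m = 1" using H(1) p1D(2) m' by (simp add: horosphere_iff \<gamma>)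
      have "mform (\<gamma> t2) ?p1 = exp t2 * b * m" using p1D(2) m' by (simp add: \<gamma>)
      also have "\<dots> = exp (t2 - t1) * (exp t1 * b * m)" by (simp add: exp_diff)
      also have "\<dots> = (exp ((t2 - t1) / 2))\<^sup>2" unfolding 1 by (simp add: exp_double[symmetric])
      finally have "sqrt (mform q ?p1) = exp ((t2 - t1) / 2)" by (simp add: q)
      moreover have "q = (exp (- t2) * a) *\<^sub>R ?p1 + (exp t2 * b) *\<^sub>R ?p2" by (simp add: q \<gamma> add.commute)
      ultimately show ?thesis
        using spin_of_transported[OF k1 k2, of q] transported_spin_Spin[OF k1, of q] H(2) q
        by (simp add: horosphere_iff)
    qed
    have "(THE l. \<exists>\<gamma> t1 t2 W s.
        geodesic n \<gamma> \<and> tends_to_ideal \<gamma> (centre n ?H1) at_bot \<and>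
        tends_to_ideal \<gamma> (centre n ?H2) at_top \<and> \<gamma> t1 \<in> ?H1 \<and> \<gamma> t2 \<in> ?H2 \<and>
        parallel_spin_frame n \<gamma> W \<and> W t1 = W1_in (\<gamma> t1) \<and>
        s \<in> Spin (n + 1) \<and> spin_act (W t2) s = W2_out (\<gamma> t2) \<and>
        l = exp ((t2 - t1) / 2) *\<^sub>R s) = ?b" (is "(THE l. ?P l) = _")
    proof (rule the_equality)
      \<comment> \<open>Normalises (A|B) to 1 / 2 with the same multiple of both null
        vectors.\<close>
      define a where "a = 1 / sqrt (2 * m)"
      have a: "a > 0" and aam: "a * a * m = 1 / 2" using m by (simp_all add: a_def)
      let ?A = "a *\<^sub>R ?p2" and ?B = "a *\<^sub>R ?p1"
      define \<gamma> where "\<gamma> = (\<lambda>t. exp t *\<^sub>R ?A + exp (- t) *\<^sub>R ?B)"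
      have A: "?A \<in> light_cone n" and B: "?B \<in> light_cone n"
        using p1D p2D a by (simp_all add: light_cone_def minkowski_linear)
      have AB: "mform ?A ?B = 1 / 2" using aam m' by (simp add: mult.assoc)
      note g = exp_geodesic[OF A B AB, folded \<gamma>_def]
      have h: "\<gamma> t \<in> hyp n" for t using g(1) by (simp add: \<gamma>_def)
      \<comment> \<open>The times at which \<gamma> pairs to 1 with the first and with the second
        null vector.\<close>
      define t1 t2 where "t1 = - ln (a * m)" and "t2 = ln (a * m)"
      have e: "exp t1 = 1 / (a * m)" "exp (- t2) = 1 / (a * m)"
        using a m by (simp_all add: t1_def t2_def exp_minus inverse_eq_divide)
      have "mform (\<gamma> t1) ?p1 = exp t1 * (a * m)" by (simp add: \<gamma>_def p1D(2) m')
      then have H1: "\<gamma> t1 \<in> ?H1" using h e(1) a m by (simp add: horosphere_iff)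
      have "mform (\<gamma> t2) ?p2 = exp (- t2) * (a * m)" by (simp add: \<gamma>_def p2D(2) m_def)
      then have H2: "\<gamma> t2 \<in> ?H2" using h e(2) a m by (simp add: horosphere_iff)
      have \<gamma>: "\<gamma> t = exp t *\<^sub>R ?A + exp (- t) *\<^sub>R ?B" for t by (simp add: \<gamma>_def)
      define s where "s = (1 / exp ((t2 - t1) / 2)) *\<^sub>R ?b"
      note K = key[OF \<gamma> H1 H2 refl, folded s_def]
      have T: "?T (\<gamma> t2) \<in> Spin (n + 2)" using K by blast
      \<comment> \<open>Since \<open>s\<close> takes one unit element to another, it has norm 1. So
        the bracket is not zero, and \<open>bracket_Gamma0\<close> puts \<open>s\<close> into the
        spin group of dimension n + 1, not just n + 2.\<close>
      have "inner s s = inner (?T (\<gamma> t2) * s) (?T (\<gamma> t2) * s)"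
        using T inner_mult_left_Gamma[of "?T (\<gamma> t2)" "n + 2" s s] by (simp add: Spin_iff)
      also have "\<dots> = 1" using K Spin_inner[OF spin_of_Spin[OF k2 h[of t2]]] by simp
      finally have ss: "inner s s = 1" .
      then have "?b \<noteq> 0" by (auto simp: s_def)
      then have "?b \<in> Gamma (n + 1)" using bracket_Gamma0[OF k1 k2] by (simp add: Gamma0_def)
      then have "s \<in> Gamma (n + 1)" unfolding s_def by (intro Gamma_scale) simp_all
      then have s: "s \<in> Spin (n + 1)" using ss by (simp add: Spin_iff)
      have "tends_to_ideal \<gamma> (ray ?p1) at_bot" "tends_to_ideal \<gamma> (ray ?p2) at_top"
        using exp_tends_to_ideal(2)[OF A B p1 \<gamma>] exp_tends_to_ideal(1)[OF A B p2 \<gamma>] a by blast+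
      moreover note g(2) H1 H2 parallel_transported_spin[OF k1 A B AB refl \<epsilon> \<gamma>] s
      moreover have "spin_act (\<gamma> t2, \<epsilon> *\<^sub>R ?T (\<gamma> t2)) s = W2_out (\<gamma> t2)"
        using K W2[OF H2] by simp
      moreover have "?b = exp ((t2 - t1) / 2) *\<^sub>R s" by (simp add: s_def)
      ultimately show "?P ?b"
        unfolding centre_null_vec[OF k1] centre_null_vec[OF k2]
        using W1[OF H1] by (intro exI[of _ \<gamma>] exI[of _ t1] exI[of _ t2] exI[of _ "\<lambda>t. (\<gamma> t, \<epsilon> *\<^sub>R ?T (\<gamma> t))"] exI[of _ s]) simp
    next
      fix l assume "?P l"
      then obtain \<gamma> t1 t2 W s where geo: "geodesic n \<gamma>"
        and lim: "tends_to_ideal \<gamma> (ray ?p1) at_bot" "tends_to_ideal \<gamma> (ray ?p2) at_top"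
        and H: "\<gamma> t1 \<in> ?H1" "\<gamma> t2 \<in> ?H2" and W: "parallel_spin_frame n \<gamma> W" "W t1 = W1_in (\<gamma> t1)"
        and s: "spin_act (W t2) s = W2_out (\<gamma> t2)" and l: "l = exp ((t2 - t1) / 2) *\<^sub>R s"
        unfolding centre_null_vec[OF k1] centre_null_vec[OF k2] by blast
      obtain A B where AB: "A \<in> light_cone n" "B \<in> light_cone n" "mform A B = 1 / 2"
        and \<gamma>: "\<And>t. \<gamma> t = exp t *\<^sub>R A + exp (- t) *\<^sub>R B"
        using geodesic_exp[OF geo] by metis
      obtain b where b: "A = b *\<^sub>R ?p2" using lim(2) exp_tends_to_ideal(1)[OF AB(1,2) p2 \<gamma>] by blast
      obtain a where a: "B = a *\<^sub>R ?p1" using lim(1) exp_tends_to_ideal(2)[OF AB(1,2) p1 \<gamma>] by blast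
      \<comment> \<open>The unknown transport starts from the same inward spin frame as the explicit
        one, so uniqueness identifies them at \<open>t2\<close>.\<close>
      have "W t2 = (\<gamma> t2, \<epsilon> *\<^sub>R ?T (\<gamma> t2))"
        by (rule parallel_spin_frame_unique[OF W(1) parallel_transported_spin[OF k1 AB a \<epsilon> \<gamma>], of t1])
          (simp only: W(2) W1[OF H(1)])
      then have "\<epsilon> *\<^sub>R (?T (\<gamma> t2) * s) = \<epsilon> *\<^sub>R spin_of n \<kappa>2 (\<gamma> t2)" using s W2[OF H(2)] by simp
      then have Ts: "?T (\<gamma> t2) * s = spin_of n \<kappa>2 (\<gamma> t2)" using \<epsilon> by auto
      define s' where "s' = (1 / exp ((t2 - t1) / 2)) *\<^sub>R ?b"
      have K: "spin_of n \<kappa>2 (\<gamma> t2) = ?T (\<gamma> t2) * s'" "?T (\<gamma> t2) \<in> Spin (n + 2)"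
        using key[OF \<gamma>[unfolded a b] H refl] by (simp_all add: s'_def)
      have "cl_conj (?T (\<gamma> t2)) * (?T (\<gamma> t2) * s) = cl_conj (?T (\<gamma> t2)) * (?T (\<gamma> t2) * s')"
        using Ts K(1) by simp
      then have "s = s'" by (simp add: mult.assoc[symmetric] Spin_inverse(2)[OF K(2)])
      then show "l = ?b" by (simp add: l s'_def)
    qed
    then show ?thesis
      using False by (simp add: \<Psi>1(1) \<Psi>2(1) centre_null_vec[OF k1] centre_null_vec[OF k2])
  qed
  then show ?thesis by (simp add: \<kappa>)
qed


end
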